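(* Let $\Delta$ be an $n$-dimensional, compact, convex polytope (in $K^n$) such that every three-dimensional face of $\Delta$ is a pyramid. If no vertex of $\Delta$ is contained in more than $(n-3)$ two-dimensional, non-triangular faces of $\Delta$, then $D^2(\Delta)=0$.
   Context: $K$ is a field with $\mathbb{Q}\subseteq K\subseteq\mathbb{R}$; polytopes are compact convex polytopes in finite-dimensional $K$-vector spaces. A pyramid is the convex hull of a polygon and a point outside its plane (tetrahedra are pyramids). Definition of $D^k$. A cohomological system $\mathcal F$ on a finite fan $\Sigma$ is a covariant functor from $\Sigma$ (morphisms: face relations $\tau\le\sigma$) to $K$-vector spaces. Fix an orientation of each cone; for a facet $\tau$ of $\sigma$ let $\varepsilon(\tau,\sigma)=\pm1$ compare the orientation of $\tau$ with the one induced from $\sigma$. Put $C^k(\Sigma,\mathcal F)=\bigoplus_{\sigma\in\Sigma,\dim\sigma=k}\mathcal F(\sigma)$, with differential $C^k\to C^{k+1}$ built from the maps $\varepsilon(\tau,\sigma)\cdot(\mathcal F(\tau)\to\mathcal F(\sigma))$, and let $H^k(\Sigma,\mathcal F)$ be its cohomology. For a polytope $P\subseteq K^m$ let $\mathrm{cone}(P)\subseteq K^{m+1}$ be the cone over $P\times\{1\}$, and $\underline{\mathrm{cone}}(P)$ the fan of all its faces (including $\{0\}$ and $\mathrm{cone}(P)$ itself). Then $D^k(P):=H^{k+1}(\underline{\mathrm{cone}}(P),\mathrm{span})$, where $\mathrm{span}$ sends a cone to its linear span, with inclusions as maps. For non-empty $P$ this equals $H^k(\underline{\mathrm{cone}}(P),K^{m+1}/\mathrm{span})$.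 *)

theory Defs
  imports "HOL-Analysis.Analysis"
begin

(* A field K with Q <= K <= R is a type 'k of class linordered_field together with an embedding
   into the reals that preserves the order; the finite-dimensional K-vector space K^n is 'k ^ 'n.
   The library's convex, affine, aff_dim and face_of need a real vector space, so their analogues
   over K are defined here. Linear span and dimension are the library's vec.span and vec.dim. *)

definition ordered_field_embedding :: "('k::linordered_field \<Rightarrow> real) \<Rightarrow> bool" where
  "ordered_field_embedding \<iota> \<longleftrightarrow>
     \<iota> 1 = 1 \<and> (\<forall>x y. \<iota> (x + y) = \<iota> x + \<iota> y) \<and> (\<forall>x y. \<iota> (x * y) = \<iota> x * \<iota> y) \<and> strict_mono \<iota>"


section \<open>Polytopes over K\<close>

definition K_convex :: "('k::linordered_field ^ 'n) set \<Rightarrow> bool" where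
  "K_convex S \<longleftrightarrow>
     (\<forall>x\<in>S. \<forall>y\<in>S. \<forall>u v. 0 \<le> u \<longrightarrow> 0 \<le> v \<longrightarrow> u + v = 1 \<longrightarrow> u *s x + v *s y \<in> S)"

definition K_affine :: "('k::linordered_field ^ 'n) set \<Rightarrow> bool" where
  "K_affine S \<longleftrightarrow> (\<forall>x\<in>S. \<forall>y\<in>S. \<forall>u v. u + v = 1 \<longrightarrow> u *s x + v *s y \<in> S)"

definition K_polytope :: "('k::linordered_field ^ 'n) set \<Rightarrow> bool" where
  "K_polytope P \<longleftrightarrow> (\<exists>V. finite V \<and> P = K_convex hull V)"

definition K_aff_dim :: "('k::linordered_field ^ 'n) set \<Rightarrow> int" where
  "K_aff_dim P = (if P = {} then -1 else int (vec.dim {x - y | x y. x \<in> P \<and> y \<in> P}))"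

(* The choice a = 0 makes P itself and {} faces of P. *)
definition polytope_face :: "('k::linordered_field ^ 'n) set \<Rightarrow> ('k ^ 'n) set \<Rightarrow> bool" where
  "polytope_face F P \<longleftrightarrow>
     (\<exists>a b. (\<forall>x\<in>P. scalar_product a x \<le> b) \<and> F = {x \<in> P. scalar_product a x = b})"

definition polytope_vertex :: "('k::linordered_field ^ 'n) \<Rightarrow> ('k ^ 'n) set \<Rightarrow> bool" where
  "polytope_vertex v P \<longleftrightarrow> polytope_face {v} P"

definition polygon :: "('k::linordered_field ^ 'n) set \<Rightarrow> bool" where
  "polygon Q \<longleftrightarrow> K_polytope Q \<and> K_aff_dim Q = 2"

definition triangular :: "('k::linordered_field ^ 'n) set \<Rightarrow> bool" where
  "triangular T \<longleftrightarrow> K_aff_dim T = 2 \<and> (\<exists>V. card V = 3 \<and> T = K_convex hull V)"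

definition pyramid :: "('k::linordered_field ^ 'n) set \<Rightarrow> bool" where
  "pyramid S \<longleftrightarrow>
     (\<exists>Q p. polygon Q \<and> p \<notin> K_affine hull Q \<and> S = K_convex hull (insert p Q))"


section \<open>Cones and fans\<close>

(* K^(m+1) is indexed by 'n option; the coordinate None is the additional, last one. *)
definition lift1 :: "'k::linordered_field ^ 'n \<Rightarrow> 'k ^ 'n option" where
  "lift1 x = (\<chi> i. case i of None \<Rightarrow> 1 | Some j \<Rightarrow> x $ j)"

definition cone_over :: "('k::linordered_field ^ 'n) set \<Rightarrow> ('k ^ 'n option) set" where
  "cone_over P = insert 0 {t *s lift1 x | t x. 0 \<le> t \<and> x \<in> P}"

definition cone_face :: "('k::linordered_field ^ 'm) set \<Rightarrow> ('k ^ 'm) set \<Rightarrow> bool" where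
  "cone_face \<tau> \<sigma> \<longleftrightarrow>
     (\<exists>a. (\<forall>x\<in>\<sigma>. 0 \<le> scalar_product a x) \<and> \<tau> = {x \<in> \<sigma>. scalar_product a x = 0})"

definition cone_facet :: "('k::linordered_field ^ 'm) set \<Rightarrow> ('k ^ 'm) set \<Rightarrow> bool" where
  "cone_facet \<tau> \<sigma> \<longleftrightarrow> cone_face \<tau> \<sigma> \<and> vec.dim \<sigma> = vec.dim \<tau> + 1"

definition face_fan :: "('k::linordered_field ^ 'm) set \<Rightarrow> ('k ^ 'm) set set" where
  "face_fan \<sigma> = {\<tau>. cone_face \<tau> \<sigma>}"


section \<open>Orientations\<close>

(* Determinant of a matrix whose size is a number rather than a type. *)
definition det_nat :: "nat \<Rightarrow> (nat \<Rightarrow> nat \<Rightarrow> 'k::comm_ring_1) \<Rightarrow> 'k" where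
  "det_nat d A = (\<Sum>p | p permutes {..<d}. of_int (sign p) * (\<Prod>i<d. A i (p i)))"

definition ordered_basis :: "('k::linordered_field ^ 'm) list \<Rightarrow> ('k ^ 'm) set \<Rightarrow> bool" where
  "ordered_basis B \<sigma> \<longleftrightarrow>
     distinct B \<and> vec.independent (set B) \<and> vec.span (set B) = vec.span \<sigma>"

definition same_orientation :: "('k::linordered_field ^ 'm) list \<Rightarrow> ('k ^ 'm) list \<Rightarrow> bool" where
  "same_orientation B C \<longleftrightarrow> length B = length C \<and>
     (\<exists>A. (\<forall>j<length C. C ! j = (\<Sum>i<length B. A i j *s B ! i)) \<and> 0 < det_nat (length B) A)"

(* An orientation of a cone is given by an ordered basis of its span. *)
definition fan_orientation ::
  "('k::linordered_field ^ 'm) set set \<Rightarrow> (('k ^ 'm) set \<Rightarrow> ('k ^ 'm) list) \<Rightarrow> bool" where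
  "fan_orientation \<Sigma> ori \<longleftrightarrow> (\<forall>\<sigma>\<in>\<Sigma>. ordered_basis (ori \<sigma>) \<sigma>)"

(* The induced orientation of a facet is taken by the rule "outward vector first". Here -w lies in
   \<sigma> but not in \<tau>, so w points out of \<sigma> across \<tau>; the result is independent of w. *)
definition incidence ::
  "(('k::linordered_field ^ 'm) set \<Rightarrow> ('k ^ 'm) list) \<Rightarrow> ('k ^ 'm) set \<Rightarrow> ('k ^ 'm) set \<Rightarrow> 'k" where
  "incidence ori \<tau> \<sigma> =
     (if \<exists>w. - w \<in> \<sigma> - \<tau> \<and> same_orientation (ori \<sigma>) (w # ori \<tau>) then 1 else - 1)"


section \<open>Cohomology of a cohomological system on a fan\<close>

(* A system is given by subspaces F \<sigma> of one coordinate space and maps \<phi> \<tau> \<sigma> : F \<tau> \<rightarrow> F \<sigma>.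
   An element of the direct sum over the k-dimensional cones is a function on all cones that
   vanishes off the summation range. *)
definition cochains ::
  "('k::linordered_field ^ 'm) set set \<Rightarrow> (('k ^ 'm) set \<Rightarrow> ('k ^ 'l) set) \<Rightarrow> nat
    \<Rightarrow> (('k ^ 'm) set \<Rightarrow> 'k ^ 'l) set" where
  "cochains \<Sigma> F k =
     {c. \<forall>\<sigma>. if \<sigma> \<in> \<Sigma> \<and> vec.dim \<sigma> = k then c \<sigma> \<in> F \<sigma> else c \<sigma> = 0}"

definition differential ::
  "('k::linordered_field ^ 'm) set set \<Rightarrow> (('k ^ 'm) set \<Rightarrow> ('k ^ 'm) list)
    \<Rightarrow> (('k ^ 'm) set \<Rightarrow> ('k ^ 'm) set \<Rightarrow> 'k ^ 'l \<Rightarrow> 'k ^ 'l) \<Rightarrow> nat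
    \<Rightarrow> (('k ^ 'm) set \<Rightarrow> 'k ^ 'l) \<Rightarrow> (('k ^ 'm) set \<Rightarrow> 'k ^ 'l)" where
  "differential \<Sigma> ori \<phi> k c = (\<lambda>\<sigma>.
     if \<sigma> \<in> \<Sigma> \<and> vec.dim \<sigma> = k + 1
     then \<Sum>\<tau> | \<tau> \<in> \<Sigma> \<and> cone_facet \<tau> \<sigma>. incidence ori \<tau> \<sigma> *s \<phi> \<tau> \<sigma> (c \<tau>)
     else 0)"

definition cocycles ::
  "('k::linordered_field ^ 'm) set set \<Rightarrow> (('k ^ 'm) set \<Rightarrow> ('k ^ 'm) list)
    \<Rightarrow> (('k ^ 'm) set \<Rightarrow> ('k ^ 'l) set) \<Rightarrow> (('k ^ 'm) set \<Rightarrow> ('k ^ 'm) set \<Rightarrow> 'k ^ 'l \<Rightarrow> 'k ^ 'l)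
    \<Rightarrow> nat \<Rightarrow> (('k ^ 'm) set \<Rightarrow> 'k ^ 'l) set" where
  "cocycles \<Sigma> ori F \<phi> k = {c \<in> cochains \<Sigma> F k. differential \<Sigma> ori \<phi> k c = (\<lambda>\<sigma>. 0)}"

definition coboundaries ::
  "('k::linordered_field ^ 'm) set set \<Rightarrow> (('k ^ 'm) set \<Rightarrow> ('k ^ 'm) list)
    \<Rightarrow> (('k ^ 'm) set \<Rightarrow> ('k ^ 'l) set) \<Rightarrow> (('k ^ 'm) set \<Rightarrow> ('k ^ 'm) set \<Rightarrow> 'k ^ 'l \<Rightarrow> 'k ^ 'l)
    \<Rightarrow> nat \<Rightarrow> (('k ^ 'm) set \<Rightarrow> 'k ^ 'l) set" where
  "coboundaries \<Sigma> ori F \<phi> k =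
     (case k of 0 \<Rightarrow> {\<lambda>\<sigma>. 0} | Suc j \<Rightarrow> differential \<Sigma> ori \<phi> j ` cochains \<Sigma> F j)"

definition cohomology_class ::
  "('k::linordered_field ^ 'm) set set \<Rightarrow> (('k ^ 'm) set \<Rightarrow> ('k ^ 'm) list)
    \<Rightarrow> (('k ^ 'm) set \<Rightarrow> ('k ^ 'l) set) \<Rightarrow> (('k ^ 'm) set \<Rightarrow> ('k ^ 'm) set \<Rightarrow> 'k ^ 'l \<Rightarrow> 'k ^ 'l)
    \<Rightarrow> nat \<Rightarrow> (('k ^ 'm) set \<Rightarrow> 'k ^ 'l) \<Rightarrow> (('k ^ 'm) set \<Rightarrow> 'k ^ 'l) set" where
  "cohomology_class \<Sigma> ori F \<phi> k c =
     {\<lambda>\<sigma>. c \<sigma> + b \<sigma> | b. b \<in> coboundaries \<Sigma> ori F \<phi> k}"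

definition cohomology ::
  "('k::linordered_field ^ 'm) set set \<Rightarrow> (('k ^ 'm) set \<Rightarrow> ('k ^ 'm) list)
    \<Rightarrow> (('k ^ 'm) set \<Rightarrow> ('k ^ 'l) set) \<Rightarrow> (('k ^ 'm) set \<Rightarrow> ('k ^ 'm) set \<Rightarrow> 'k ^ 'l \<Rightarrow> 'k ^ 'l)
    \<Rightarrow> nat \<Rightarrow> (('k ^ 'm) set \<Rightarrow> 'k ^ 'l) set set" where
  "cohomology \<Sigma> ori F \<phi> k =
     cohomology_class \<Sigma> ori F \<phi> k ` cocycles \<Sigma> ori F \<phi> k"


section \<open>The invariants of a polytope\<close>

definition D ::
  "(('k::linordered_field ^ 'n option) set \<Rightarrow> ('k ^ 'n option) list) \<Rightarrow> nat \<Rightarrow> ('k ^ 'n) set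
    \<Rightarrow> (('k ^ 'n option) set \<Rightarrow> 'k ^ 'n option) set set" where
  "D ori k P = cohomology (face_fan (cone_over P)) ori vec.span (\<lambda>\<tau> \<sigma> v. v) (k + 1)"

definition D_zero ::
  "(('k::linordered_field ^ 'n option) set \<Rightarrow> ('k ^ 'n option) list) \<Rightarrow> nat \<Rightarrow> ('k ^ 'n) set
    \<Rightarrow> (('k ^ 'n option) set \<Rightarrow> 'k ^ 'n option) set" where
  "D_zero ori k P =
     cohomology_class (face_fan (cone_over P)) ori vec.span (\<lambda>\<tau> \<sigma> v. v) (k + 1) (\<lambda>\<sigma>. 0)"

end

theory Submission
  imports Defs "Jordan_Normal_Form.Determinant"
begin

text \<open>Let \<open>R(\<tau>)\<close> be the space of linear relations between chosen generators of the rays of a face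
  \<open>\<tau>\<close> of \<open>cone(\<Delta>)\<close>. Mapping the functions on the rays of \<open>\<tau>\<close> onto \<open>span \<tau>\<close> has kernel
  \<open>R(\<tau>)\<close>, and the system of these functions is a sum over the rays \<open>\<rho>\<close> of constant systems on the
  faces above \<open>\<rho>\<close>, which are acyclic. Hence \<open>D\<^sup>2(\<Delta>) = H\<^sup>4(R)\<close>.

  A cone \<open>g\<close> over a pyramid satisfies \<open>R(g) = R(Q)\<close> for the base \<open>Q\<close>, and \<open>R\<close> vanishes on triangles.
  So a cocycle of \<open>R\<close> attaches to every three-dimensional \<open>g\<close> above a non-triangular \<open>Q\<close> an element of
  \<open>R(Q)\<close>, and it is a coboundary as soon as this element depends, up to incidence signs, on \<open>Q\<close> only.
  Consider its coefficient at a vertex \<open>v\<close> of \<open>Q\<close>. Two faces \<open>g\<close> above \<open>Q\<close> in a common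
  four-dimensional face \<open>h\<close> have the same coefficient, unless \<open>h\<close> contains a second
  non-triangular two-dimensional face through \<open>v\<close>. At most \<open>n - 4\<close> of the \<open>h\<close> are exceptional in this
  way, while disconnecting the graph of the \<open>(n - 3)\<close>-dimensional polytope \<open>\<Delta>/Q\<close>, whose vertices and
  edges are these \<open>g\<close> and \<open>h\<close>, takes the removal of \<open>n - 3\<close> edges.\<close>

text \<open>Dimensions are shifted by one: a j-dimensional face of \<Delta> is a face of dimension j
  + 1 of the cone \<sigma>, so polygons have dimension 3, pyramids dimension 4, and n = dim \<sigma>
  - 1.

  The pyramid hypothesis enters the counting through uniqueness of the base. Two distinct
  3-dimensional faces meet in dimension at most 2, where no relations exist, so a 4-dimensional face
  has at most one 3-dimensional face with relations. Therefore distinct exceptional faces h, h'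
  above Q lead to distinct non-triangular faces through v: a common second face Q' would make Q and
  Q' two bases of the pyramid h \<inter> h'.

  Acyclicity is used in one place: the star of a ray, with the ray itself as empty face of its link,
  is exact in the degree of the 3-dimensional cones.

  K need not be complete, so polytope theory is developed without topology. Optima of linear
  functionals exist because cones are finitely generated, and connectivity, edge cuts and acyclicity
  are all obtained by sweeping with functionals.\<close>

notation scalar_product (infixl "\<cdot>" 70)

section \<open>Scalar products and separating functionals\<close>

lemma sp_simps [simp]:
  fixes a :: "'k::linordered_field ^ 'm"
  shows "a \<cdot> (x + y) = a \<cdot> x + a \<cdot> y" "a \<cdot> (x - y) = a \<cdot> x - a \<cdot> y"
    "a \<cdot> (c *s x) = c * (a \<cdot> x)" "a \<cdot> (- x) = - (a \<cdot> x)" "a \<cdot> 0 = 0"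
    "(a + b) \<cdot> x = a \<cdot> x + b \<cdot> x" "(a - b) \<cdot> x = a \<cdot> x - b \<cdot> x"
    "(c *s a) \<cdot> x = c * (a \<cdot> x)" "(- a) \<cdot> x = - (a \<cdot> x)" "0 \<cdot> x = 0"
  by (simp_all add: scalar_product_def sum.distrib sum_subtractf sum_distrib_left sum_negf algebra_simps)

lemma sp_sum:
  fixes a :: "'k::linordered_field ^ 'm"
  shows "a \<cdot> (\<Sum>i\<in>I. f i) = (\<Sum>i\<in>I. a \<cdot> f i)"
  by (induction I rule: infinite_finite_induct) auto

lemma sp_zero_span:
  fixes a :: "'k::linordered_field ^ 'm"
  assumes "\<forall>x\<in>S. a \<cdot> x = 0" "x \<in> vec.span S"
  shows "a \<cdot> x = 0"
  using assms(2) by (induction rule: vec.span_induct_alt) (use assms(1) in auto)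

text \<open>The prescribed values are written into every coordinate of a linear endomorphism; any
  row of its matrix then represents the functional.\<close>

lemma functional_extend:
  fixes f :: "'k::linordered_field ^ 'm \<Rightarrow> 'k"
  assumes "vec.independent B"
  shows "\<exists>a. \<forall>x\<in>B. a \<cdot> x = f x"
proof -
  obtain g :: "'k ^ 'm \<Rightarrow> 'k ^ 'm" where g: "Vector_Spaces.linear (*s) (*s) g" "\<forall>x\<in>B. g x = (\<chi> i. f x)"
    using vec.linear_independent_extend[OF assms, of "\<lambda>x. \<chi> i. f x"] by blast
  have "(matrix g $ undefined) \<cdot> x = g x $ undefined" for x
    unfolding matrix_works[OF g(1), of x, symmetric] by (simp add: matrix_vector_mult_def scalar_product_def)
  with g(2) show ?thesis by (intro exI[of _ "matrix g $ undefined"]) auto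
qed

lemma functional_separation:
  fixes x :: "'k::linordered_field ^ 'm"
  assumes "x \<notin> vec.span S"
  shows "\<exists>a. (\<forall>y\<in>S. a \<cdot> y = 0) \<and> a \<cdot> x = 1"
proof -
  obtain B where B: "B \<subseteq> S" "vec.independent B" "S \<subseteq> vec.span B"
    using vec.basis_exists by metis
  have "x \<notin> vec.span B" using assms B(1) vec.span_mono by blast
  then have "vec.independent (insert x B)" "x \<notin> B"
    using B(2) by (auto simp: vec.independent_insert vec.span_base)
  then obtain a where a: "\<forall>y\<in>insert x B. a \<cdot> y = (if y = x then 1 else 0)"
    using functional_extend[of "insert x B" "\<lambda>y. if y = x then 1 else 0"] by blast
  have "\<forall>y\<in>B. a \<cdot> y = 0" using a \<open>x \<notin> B\<close> by auto
  then have "\<forall>y\<in>S. a \<cdot> y = 0" using B(3) sp_zero_span by blast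
  then show ?thesis using a by auto
qed

section \<open>Finitely generated cones and their faces\<close>

definition K_conic :: "('k::linordered_field ^ 'm) set \<Rightarrow> ('k ^ 'm) set" where
  "K_conic S = {\<Sum>s\<in>S. c s *s s | c. \<forall>s\<in>S. 0 \<le> c s}"

definition fg_cone :: "('k::linordered_field ^ 'm) set \<Rightarrow> bool" where
  "fg_cone \<sigma> \<longleftrightarrow> (\<exists>S. finite S \<and> \<sigma> = K_conic S)"

lemma conicI: "\<forall>s\<in>S. 0 \<le> c s \<Longrightarrow> (\<Sum>s\<in>S. c s *s s) \<in> K_conic S"
  by (auto simp: K_conic_def)

lemma conic_zero: "0 \<in> K_conic S"
  using conicI[of S "\<lambda>_. 0"] by simp

lemma conic_base: assumes "finite S" "s \<in> S" shows "s \<in> K_conic S"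
proof -
  have "(\<Sum>t\<in>S. (if t = s then 1 else 0) *s t) \<in> K_conic S" by (rule conicI) auto
  moreover have "(\<Sum>t\<in>S. (if t = s then 1 else 0) *s t) = (\<Sum>t\<in>S. (if t = s then s else 0))"
    by (rule sum.cong) auto
  ultimately show ?thesis using assms by simp
qed

lemma conic_add: "x \<in> K_conic S \<Longrightarrow> y \<in> K_conic S \<Longrightarrow> x + y \<in> K_conic S"
proof -
  assume "x \<in> K_conic S" "y \<in> K_conic S"
  then obtain c d where "\<forall>s\<in>S. 0 \<le> c s" "\<forall>s\<in>S. 0 \<le> d s"
    "x = (\<Sum>s\<in>S. c s *s s)" "y = (\<Sum>s\<in>S. d s *s s)" by (auto simp: K_conic_def)
  then show ?thesis using conicI[of S "\<lambda>s. c s + d s"]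
    by (simp add: vec.scale_left_distrib sum.distrib)
qed

lemma conic_scale: "x \<in> K_conic S \<Longrightarrow> 0 \<le> t \<Longrightarrow> t *s x \<in> K_conic S"
proof -
  assume "x \<in> K_conic S" and t: "0 \<le> t"
  then obtain c where "\<forall>s\<in>S. 0 \<le> c s" "x = (\<Sum>s\<in>S. c s *s s)" by (auto simp: K_conic_def)
  then show ?thesis using t conicI[of S "\<lambda>s. t * c s"]
    by (simp add: vec.scale_sum_right)
qed

lemma conic_sum: "(\<And>i. i \<in> I \<Longrightarrow> f i \<in> K_conic S) \<Longrightarrow> (\<Sum>i\<in>I. f i) \<in> K_conic S"
  by (induction I rule: infinite_finite_induct) (auto intro: conic_zero conic_add)

lemma conic_mono: assumes "finite T" "S \<subseteq> T" shows "K_conic S \<subseteq> K_conic T"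
proof
  fix x assume "x \<in> K_conic S"
  then obtain c where c: "\<forall>s\<in>S. 0 \<le> c s" "x = (\<Sum>s\<in>S. c s *s s)" by (auto simp: K_conic_def)
  show "x \<in> K_conic T" unfolding c(2)
    using c(1) assms by (intro conic_sum conic_scale conic_base) auto
qed

lemma conic_sp_nonneg:
  assumes "\<forall>s\<in>S. 0 \<le> a \<cdot> s" "x \<in> K_conic S" shows "0 \<le> a \<cdot> x"
  using assms by (auto simp: K_conic_def sp_sum intro!: sum_nonneg)

lemma span_conic: assumes "finite S" shows "vec.span (K_conic S) = vec.span S"
proof -
  have "K_conic S \<subseteq> vec.span S"
    unfolding K_conic_def by (auto intro: vec.span_sum vec.span_scale vec.span_base)
  moreover have "S \<subseteq> K_conic S" using assms conic_base by blast
  ultimately show ?thesis by (metis subset_antisym vec.span_minimal vec.span_mono vec.subspace_span)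
qed

lemma fg_cone_zero: "fg_cone \<sigma> \<Longrightarrow> 0 \<in> \<sigma>"
  by (auto simp: fg_cone_def conic_zero)

lemma fg_cone_scale: "fg_cone \<sigma> \<Longrightarrow> x \<in> \<sigma> \<Longrightarrow> 0 \<le> t \<Longrightarrow> t *s x \<in> \<sigma>"
  by (auto simp: fg_cone_def conic_scale)

lemma cone_face_subset: "cone_face \<tau> \<sigma> \<Longrightarrow> \<tau> \<subseteq> \<sigma>"
  by (auto simp: cone_face_def)

lemma cone_face_refl: "cone_face \<sigma> \<sigma>"
  unfolding cone_face_def by (rule exI[of _ 0]) simp

lemma cone_face_inter: assumes "cone_face \<tau>1 \<sigma>" "cone_face \<tau>2 \<sigma>" shows "cone_face (\<tau>1 \<inter> \<tau>2) \<sigma>"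
proof -
  obtain a b where a: "\<forall>x\<in>\<sigma>. 0 \<le> a \<cdot> x" "\<tau>1 = {x\<in>\<sigma>. a \<cdot> x = 0}"
    and b: "\<forall>x\<in>\<sigma>. 0 \<le> b \<cdot> x" "\<tau>2 = {x\<in>\<sigma>. b \<cdot> x = 0}" using assms by (auto simp: cone_face_def)
  show ?thesis unfolding cone_face_def
    by (rule exI[of _ "a + b"]) (use a b in \<open>auto simp: add_nonneg_eq_0_iff\<close>)
qed

lemma cone_face_sub: "cone_face \<tau> \<sigma> \<Longrightarrow> \<tau> \<subseteq> \<tau>' \<Longrightarrow> \<tau>' \<subseteq> \<sigma> \<Longrightarrow> cone_face \<tau> \<tau>'"
  unfolding cone_face_def by blast

text \<open>A vanishing sum of non-negative terms vanishes termwise, so a generator off the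
  hyperplane has coefficient 0.\<close>

lemma conic_face:
  assumes "finite S" "\<forall>x\<in>K_conic S. 0 \<le> a \<cdot> x"
  shows "{x \<in> K_conic S. a \<cdot> x = 0} = K_conic {s\<in>S. a \<cdot> s = 0}"
proof
  show "K_conic {s\<in>S. a \<cdot> s = 0} \<subseteq> {x \<in> K_conic S. a \<cdot> x = 0}"
    using conic_mono[OF assms(1), of "{s\<in>S. a \<cdot> s = 0}"]
    by (auto simp: K_conic_def sp_sum intro!: sum.neutral)
next
  have pos: "\<forall>s\<in>S. 0 \<le> a \<cdot> s" using assms conic_base by blast
  show "{x \<in> K_conic S. a \<cdot> x = 0} \<subseteq> K_conic {s\<in>S. a \<cdot> s = 0}"
  proof
    fix x assume "x \<in> {x \<in> K_conic S. a \<cdot> x = 0}"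
    then obtain c where c: "\<forall>s\<in>S. 0 \<le> c s" "x = (\<Sum>s\<in>S. c s *s s)" and x: "a \<cdot> x = 0"
      by (auto simp: K_conic_def)
    have "(\<Sum>s\<in>S. c s * (a \<cdot> s)) = 0" using x c(2) by (simp add: sp_sum)
    then have "\<forall>s\<in>S. c s * (a \<cdot> s) = 0"
      using sum_nonneg_eq_0_iff[OF assms(1), of "\<lambda>s. c s * (a \<cdot> s)"] c(1) pos by auto
    then have "x = (\<Sum>s\<in>{s\<in>S. a \<cdot> s = 0}. c s *s s)"
      unfolding c(2) using assms(1) by (intro sum.mono_neutral_right) auto
    then show "x \<in> K_conic {s\<in>S. a \<cdot> s = 0}" using c(1) by (auto intro: conicI)
  qed
qed

text \<open>A face is thus determined by the generators it contains, which makes the fan finite and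
  every face finitely generated.\<close>

lemma cone_face_conic:
  assumes "finite S" "cone_face \<tau> (K_conic S)" shows "\<tau> = K_conic (S \<inter> \<tau>)"
proof -
  obtain a where a: "\<forall>x\<in>K_conic S. 0 \<le> a \<cdot> x" "\<tau> = {x\<in>K_conic S. a \<cdot> x = 0}"
    using assms(2) by (auto simp: cone_face_def)
  then have "\<tau> = K_conic {s\<in>S. a \<cdot> s = 0}" using conic_face[OF assms(1) a(1)] by simp
  moreover have "{s\<in>S. a \<cdot> s = 0} = S \<inter> \<tau>" using a(2) conic_base[OF assms(1)] by auto
  ultimately show ?thesis by simp
qed

lemma fg_cone_face: "fg_cone \<sigma> \<Longrightarrow> cone_face \<tau> \<sigma> \<Longrightarrow> fg_cone \<tau>"
  unfolding fg_cone_def using cone_face_conic by (metis finite_Int)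

lemma finite_face_fan: assumes "fg_cone \<sigma>" shows "finite (face_fan \<sigma>)"
proof -
  obtain S where S: "finite S" "\<sigma> = K_conic S" using assms by (auto simp: fg_cone_def)
  have "face_fan \<sigma> \<subseteq> K_conic ` Pow S"
    using cone_face_conic[OF S(1)] S(2) by (auto simp: face_fan_def)
  then show ?thesis using S(1) finite_subset by blast
qed

text \<open>The functional exposing \<tau> is controlled only on \<tau>1. A large multiple of a
  functional exposing \<tau>1 is added to it; finitely many generators decide how large.\<close>

lemma cone_face_trans:
  assumes "fg_cone \<sigma>" "cone_face \<tau>1 \<sigma>" "cone_face \<tau> \<tau>1" shows "cone_face \<tau> \<sigma>"
proof -
  obtain S where S: "finite S" "\<sigma> = K_conic S" using assms(1) by (auto simp: fg_cone_def)
  obtain a where a: "\<forall>x\<in>\<sigma>. 0 \<le> a \<cdot> x" "\<tau>1 = {x\<in>\<sigma>. a \<cdot> x = 0}"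
    using assms(2) by (auto simp: cone_face_def)
  obtain b where b: "\<forall>x\<in>\<tau>1. 0 \<le> b \<cdot> x" "\<tau> = {x\<in>\<tau>1. b \<cdot> x = 0}"
    using assms(3) by (auto simp: cone_face_def)
  \<comment> \<open>The sum dominates each single ratio, and the additional 1 makes the next
    inequality strict.\<close>
  define N where "N = 1 + (\<Sum>s\<in>{s\<in>S. 0 < a \<cdot> s}. \<bar>b \<cdot> s\<bar> / (a \<cdot> s))"
  have N: "0 < N * (a \<cdot> s) + b \<cdot> s" if "s \<in> S" "0 < a \<cdot> s" for s
  proof -
    have "\<bar>b \<cdot> s\<bar> / (a \<cdot> s) \<le> (\<Sum>s\<in>{s\<in>S. 0 < a \<cdot> s}. \<bar>b \<cdot> s\<bar> / (a \<cdot> s))"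
      using S(1) that by (intro member_le_sum) auto
    then have "\<bar>b \<cdot> s\<bar> / (a \<cdot> s) < N" by (simp add: N_def)
    then have "\<bar>b \<cdot> s\<bar> < N * (a \<cdot> s)" using that(2) by (simp add: divide_simps)
    then show ?thesis by linarith
  qed
  let ?c = "N *s a + b"
  have S1: "\<forall>s\<in>S. 0 \<le> a \<cdot> s" using a(1) S conic_base by blast
  have Sz: "s \<in> \<tau>1" if "s \<in> S" "a \<cdot> s = 0" for s using that a(2) S conic_base by blast
  have pos: "0 \<le> ?c \<cdot> s" if "s \<in> S" for s
    using N[OF that] b(1) Sz[OF that] S1 that by (cases "a \<cdot> s = 0") (auto simp: order_less_le)
  have cpos: "\<forall>x\<in>K_conic S. 0 \<le> ?c \<cdot> x" using conic_sp_nonneg[of S ?c] pos by blast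
  have "{x\<in>\<sigma>. ?c \<cdot> x = 0} = \<tau>"
  proof
    have "{s\<in>S. ?c \<cdot> s = 0} \<subseteq> \<tau>"
    proof
      fix s assume s: "s \<in> {s\<in>S. ?c \<cdot> s = 0}"
      then have "a \<cdot> s = 0" using N[of s] S1 by (cases "a \<cdot> s = 0") (auto simp: order_less_le)
      then show "s \<in> \<tau>" using s b(2) Sz by auto
    qed
    moreover have "fg_cone \<tau>" using fg_cone_face assms by blast
    ultimately have "K_conic {s\<in>S. ?c \<cdot> s = 0} \<subseteq> \<tau>"
    proof -
      obtain T where T: "finite T" "\<tau> = K_conic T" using \<open>fg_cone \<tau>\<close> by (auto simp: fg_cone_def)
      show ?thesis
      proof
        fix x assume "x \<in> K_conic {s\<in>S. ?c \<cdot> s = 0}"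
        then obtain c where c: "\<forall>s\<in>{s\<in>S. ?c \<cdot> s = 0}. 0 \<le> c s" "x = (\<Sum>s\<in>{s\<in>S. ?c \<cdot> s = 0}. c s *s s)"
          by (auto simp: K_conic_def)
        show "x \<in> \<tau>" unfolding c(2) T(2)
          using \<open>{s\<in>S. ?c \<cdot> s = 0} \<subseteq> \<tau>\<close> c(1) T(2) by (intro conic_sum conic_scale) auto
      qed
    qed
    then show "{x\<in>\<sigma>. ?c \<cdot> x = 0} \<subseteq> \<tau>" using conic_face[OF S(1) cpos] S(2) by simp
    show "\<tau> \<subseteq> {x\<in>\<sigma>. ?c \<cdot> x = 0}" using a b by auto
  qed
  then show ?thesis using cpos S(2) unfolding cone_face_def by blast
qed

section \<open>Dimensions of faces\<close>

text \<open>The functional exposing \<tau> vanishes on the whole span of \<tau>. This turns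
  comparisons of faces into comparisons of dimensions.\<close>

lemma face_span: assumes "cone_face \<tau> \<sigma>" "x \<in> \<sigma>" "x \<in> vec.span \<tau>" shows "x \<in> \<tau>"
  using assms sp_zero_span[of \<tau> _ x] by (auto simp: cone_face_def)

lemma face_dim_mono: "cone_face \<tau> \<sigma> \<Longrightarrow> vec.dim \<tau> \<le> vec.dim \<sigma>"
  by (simp add: cone_face_subset vec.dim_subset)

lemma face_dim_eq: assumes "cone_face \<tau> \<sigma>" "vec.dim \<sigma> \<le> vec.dim \<tau>" shows "\<tau> = \<sigma>"
proof -
  have "vec.span \<tau> = vec.span \<sigma>" using assms cone_face_subset vec.dim_eq_span by blast
  then show ?thesis using assms(1) face_span cone_face_subset vec.span_base by blast
qed

lemma face_dim_less: "cone_face \<tau> \<sigma> \<Longrightarrow> \<tau> \<noteq> \<sigma> \<Longrightarrow> vec.dim \<tau> < vec.dim \<sigma>"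
  using face_dim_eq not_less by blast

lemma span_insert_face:
  assumes "cone_face \<tau> g" "vec.dim g = vec.dim \<tau> + 1" "x \<in> g" "x \<notin> \<tau>"
  shows "vec.span g = vec.span (insert x \<tau>)"
proof -
  have "x \<notin> vec.span \<tau>" using assms face_span by blast
  then have "vec.dim (insert x \<tau>) = vec.dim \<tau> + 1" by (simp add: vec.dim_insert)
  then show ?thesis using assms cone_face_subset[OF assms(1)]
    by (metis insert_subset order_refl vec.dim_eq_span)
qed

section \<open>The faces above a given face\<close>

text \<open>The faces of \<open>\<sigma>\<close> above \<open>\<tau>\<close> form the face lattice of a polytope, with \<open>above 1 \<tau> \<sigma>\<close> as
  vertices and \<open>above 2 \<tau> \<sigma>\<close> as edges.\<close>

definition above :: "nat \<Rightarrow> ('k::linordered_field ^ 'm) set \<Rightarrow> ('k ^ 'm) set \<Rightarrow> ('k ^ 'm) set set" where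
  "above j \<tau> \<sigma> = {g. cone_face g \<sigma> \<and> \<tau> \<subseteq> g \<and> vec.dim g = vec.dim \<tau> + j}"

lemma aboveI: "cone_face g \<sigma> \<Longrightarrow> \<tau> \<subseteq> g \<Longrightarrow> vec.dim g = vec.dim \<tau> + j \<Longrightarrow> g \<in> above j \<tau> \<sigma>"
  by (simp add: above_def)

lemma aboveD:
  assumes "g \<in> above j \<tau> \<sigma>"
  shows "cone_face g \<sigma>" "\<tau> \<subseteq> g" "vec.dim g = vec.dim \<tau> + j" "g \<subseteq> \<sigma>"
  using assms cone_face_subset by (auto simp: above_def)

lemma finite_above: "fg_cone \<sigma> \<Longrightarrow> finite (above j \<tau> \<sigma>)"
  using finite_face_fan[of \<sigma>] by (rule finite_subset[rotated]) (auto simp: above_def face_fan_def)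

lemma above_face:
  assumes "fg_cone \<sigma>" "cone_face F \<sigma>"
  shows "above j \<tau> F = {g \<in> above j \<tau> \<sigma>. g \<subseteq> F}"
proof -
  have "cone_face g F \<longleftrightarrow> cone_face g \<sigma> \<and> g \<subseteq> F" for g
    using cone_face_trans[OF assms] cone_face_sub[of g \<sigma> F] cone_face_subset[of g F]
      cone_face_subset[OF assms(2)] by blast
  then show ?thesis by (auto simp: above_def)
qed

lemma above_face_mono: "fg_cone \<sigma> \<Longrightarrow> cone_face F \<sigma> \<Longrightarrow> above j \<tau> F \<subseteq> above j \<tau> \<sigma>"
  by (auto simp: above_face)

text \<open>Modulo the span of \<tau> the functional \<open>l\<close> is positive on \<sigma> away
  from 0. The slice \<open>l\<close> = 1 of this quotient cone is the quotient polytope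
  \<sigma>/\<tau>, whose faces are the faces of \<sigma> above \<tau>.\<close>

locale link =
  fixes \<sigma> \<tau> :: "('k::linordered_field ^ 'm) set" and l :: "'k ^ 'm"
  assumes fg: "fg_cone \<sigma>"
    and l_nonneg: "\<And>x. x \<in> \<sigma> \<Longrightarrow> 0 \<le> l \<cdot> x"
    and l_zero: "\<tau> = {x \<in> \<sigma>. l \<cdot> x = 0}"

lemma link_exists: "fg_cone \<sigma> \<Longrightarrow> cone_face \<tau> \<sigma> \<Longrightarrow> \<exists>l. link \<sigma> \<tau> l"
  unfolding cone_face_def link_def by blast

context link
begin

lemma face: "cone_face \<tau> \<sigma>"
  using l_nonneg l_zero unfolding cone_face_def by blast

lemma l_pos: "x \<in> \<sigma> \<Longrightarrow> x \<notin> \<tau> \<Longrightarrow> 0 < l \<cdot> x"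
  using l_nonneg[of x] l_zero by (auto simp: order_less_le)

lemma link_face: "cone_face F \<sigma> \<Longrightarrow> \<tau> \<subseteq> F \<Longrightarrow> link F \<tau> l"
  using fg_cone_face[OF fg] cone_face_subset[of F \<sigma>] l_nonneg l_zero by unfold_locales auto

text \<open>The ratio test of the simplex method.\<close>

lemma min_ratio:
  assumes "\<tau> \<noteq> \<sigma>" and b: "\<forall>x\<in>\<tau>. b \<cdot> x = 0"
  shows "\<exists>\<mu>. (\<forall>x\<in>\<sigma>. \<mu> * (l \<cdot> x) \<le> b \<cdot> x) \<and> (\<exists>x\<in>\<sigma>. x \<notin> \<tau> \<and> b \<cdot> x = \<mu> * (l \<cdot> x))"
proof -
  obtain S where S: "finite S" "\<sigma> = K_conic S" using fg by (auto simp: fg_cone_def)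
  have S\<sigma>: "S \<subseteq> \<sigma>" using S conic_base by blast
  define T where "T = {s\<in>S. s \<notin> \<tau>}"
  have "T \<noteq> {}"
  proof
    assume "T = {}"
    then have "S \<inter> \<tau> = S" by (auto simp: T_def)
    then show False using assms(1) cone_face_conic[OF S(1)] face S(2) by metis
  qed
  let ?R = "(\<lambda>s. (b \<cdot> s) / (l \<cdot> s)) ` T"
  define \<mu> where "\<mu> = Min ?R"
  have fin: "finite ?R" "?R \<noteq> {}" using S(1) \<open>T \<noteq> {}\<close> by (auto simp: T_def)
  have pos: "0 < l \<cdot> s" if "s \<in> T" for s using that l_pos S\<sigma> by (auto simp: T_def)
  have "\<forall>s\<in>S. 0 \<le> (b - \<mu> *s l) \<cdot> s"
  proof
    fix s assume s: "s \<in> S"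
    show "0 \<le> (b - \<mu> *s l) \<cdot> s"
    proof (cases "s \<in> T")
      case True
      then have "\<mu> \<le> (b \<cdot> s) / (l \<cdot> s)" unfolding \<mu>_def using fin by (intro Min_le) auto
      then show ?thesis using pos[OF True] by (simp add: field_simps)
    next
      case False
      then show ?thesis using s b l_zero by (auto simp: T_def)
    qed
  qed
  then have 1: "\<forall>x\<in>\<sigma>. 0 \<le> (b - \<mu> *s l) \<cdot> x" using S(2) conic_sp_nonneg by blast
  obtain s where s: "s \<in> T" "\<mu> = (b \<cdot> s) / (l \<cdot> s)" using Min_in[OF fin] by (auto simp: \<mu>_def)
  then have "b \<cdot> s = \<mu> * (l \<cdot> s)" using pos[OF s(1)] by simp
  then show ?thesis using 1 s(1) S\<sigma> by (intro exI[of _ \<mu>]) (auto simp: T_def)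
qed

lemma ratio_face:
  assumes "\<forall>x\<in>\<sigma>. \<mu> * (l \<cdot> x) \<le> b \<cdot> x" "\<forall>x\<in>\<tau>. b \<cdot> x = 0"
  shows "cone_face {x\<in>\<sigma>. b \<cdot> x = \<mu> * (l \<cdot> x)} \<sigma>" "\<tau> \<subseteq> {x\<in>\<sigma>. b \<cdot> x = \<mu> * (l \<cdot> x)}"
proof -
  show "cone_face {x\<in>\<sigma>. b \<cdot> x = \<mu> * (l \<cdot> x)} \<sigma>"
    unfolding cone_face_def by (rule exI[of _ "b - \<mu> *s l"]) (use assms in auto)
  show "\<tau> \<subseteq> {x\<in>\<sigma>. b \<cdot> x = \<mu> * (l \<cdot> x)}" using assms l_zero by auto
qed

end

text \<open>A functional that vanishes on \<tau> and at one point of \<sigma> off \<tau>, but not on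
  all of \<sigma>, is not proportional to \<open>l\<close> on \<sigma>. The face of minimal ratio is
  then proper, which drives the inductions on the dimension.\<close>

lemma exists_proper_functional:
  fixes \<sigma> :: "('k::linordered_field ^ 'm) set"
  assumes "link \<sigma> \<tau> l" "\<tau> \<noteq> \<sigma>" "vec.dim \<sigma> \<noteq> vec.dim \<tau> + 1"
  shows "\<exists>b. (\<forall>x\<in>\<tau>. b \<cdot> x = 0) \<and> (\<forall>\<mu>. {x\<in>\<sigma>. b \<cdot> x = \<mu> * (l \<cdot> x)} \<noteq> \<sigma>)"
proof -
  interpret link \<sigma> \<tau> l by fact
  obtain x where x: "x \<in> \<sigma>" "x \<notin> \<tau>" using assms(2) cone_face_subset[OF face] by blast
  have "\<not> \<sigma> \<subseteq> vec.span (insert x \<tau>)"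
  proof
    assume "\<sigma> \<subseteq> vec.span (insert x \<tau>)"
    then have "vec.dim \<sigma> \<le> vec.dim (insert x \<tau>)" by (rule vec.dim_mono)
    then show False using face_dim_less[OF face assms(2)] assms(3) by (simp add: vec.dim_insert split: if_splits)
  qed
  then obtain y where y: "y \<in> \<sigma>" "y \<notin> vec.span (insert x \<tau>)" by blast
  obtain b where b: "\<forall>z\<in>insert x \<tau>. b \<cdot> z = 0" "b \<cdot> y = 1" using functional_separation[OF y(2)] by blast
  have "{x\<in>\<sigma>. b \<cdot> x = \<mu> * (l \<cdot> x)} \<noteq> \<sigma>" for \<mu>
  proof
    assume eq: "{x\<in>\<sigma>. b \<cdot> x = \<mu> * (l \<cdot> x)} = \<sigma>"
    then have "b \<cdot> x = \<mu> * (l \<cdot> x)" using x by blast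
    then have "\<mu> = 0" using b(1) l_pos[OF x] by simp
    then have "b \<cdot> y = 0" using eq y(1) by (metis (mono_tags, lifting) mem_Collect_eq mult_zero_left)
    then show False using b(2) by simp
  qed
  then show ?thesis using b(1) by blast
qed

text \<open>The ratio test yields a proper face strictly above \<tau> until the dimension exceeds
  that of \<tau> by one.\<close>

lemma cover_exists:
  fixes \<sigma> :: "('k::linordered_field ^ 'm) set"
  assumes "fg_cone \<sigma>" "cone_face \<tau> \<sigma>" "\<tau> \<noteq> \<sigma>"
  shows "above 1 \<tau> \<sigma> \<noteq> {}"
  using assms
proof (induction "vec.dim \<sigma>" arbitrary: \<sigma> rule: less_induct)
  case less
  obtain l where l: "link \<sigma> \<tau> l" using link_exists less.prems by blast
  interpret link \<sigma> \<tau> l by fact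
  show ?case
  proof (cases "vec.dim \<sigma> = vec.dim \<tau> + 1")
    case True
    then have "\<sigma> \<in> above 1 \<tau> \<sigma>" using less.prems(2) cone_face_refl cone_face_subset by (blast intro: aboveI)
    then show ?thesis by blast
  next
    case False
    obtain b where b: "\<forall>x\<in>\<tau>. b \<cdot> x = 0" "\<And>\<mu>. {x\<in>\<sigma>. b \<cdot> x = \<mu> * (l \<cdot> x)} \<noteq> \<sigma>"
      using exists_proper_functional[OF l less.prems(3) False] by blast
    obtain \<mu> x where \<mu>: "\<forall>x\<in>\<sigma>. \<mu> * (l \<cdot> x) \<le> b \<cdot> x" "x \<in> \<sigma>" "x \<notin> \<tau>" "b \<cdot> x = \<mu> * (l \<cdot> x)"
      using min_ratio[OF less.prems(3) b(1)] by blast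
    define F where "F = {x\<in>\<sigma>. b \<cdot> x = \<mu> * (l \<cdot> x)}"
    have F: "cone_face F \<sigma>" "\<tau> \<subseteq> F" "F \<noteq> \<sigma>" "\<tau> \<noteq> F"
      using ratio_face[OF \<mu>(1) b(1)] b(2) \<mu> unfolding F_def by auto
    then have "above 1 \<tau> F \<noteq> {}"
      using less.hyps[OF face_dim_less[OF F(1,3)]] fg_cone_face[OF less.prems(1) F(1)]
        cone_face_sub[OF less.prems(2) F(2)] cone_face_subset[OF F(1)] by blast
    then show ?thesis using above_face_mono[OF less.prems(1) F(1)] by blast
  qed
qed

text \<open>A chain of covers climbing from \<open>h\<close> ends at \<sigma>, and its last proper
  member is a facet; the induction runs on the codimension of \<open>h\<close>.\<close>

lemma facet_exists:
  fixes \<sigma> :: "('k::linordered_field ^ 'm) set"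
  assumes "fg_cone \<sigma>" "cone_face h \<sigma>" "h \<noteq> \<sigma>"
  shows "\<exists>F. cone_face F \<sigma> \<and> h \<subseteq> F \<and> vec.dim \<sigma> = vec.dim F + 1"
  using assms(2,3)
proof (induction "vec.dim \<sigma> - vec.dim h" arbitrary: h rule: less_induct)
  case less
  obtain g where g: "g \<in> above 1 h \<sigma>" using cover_exists[OF assms(1)] less.prems by blast
  note g = aboveD[OF g]
  show ?case
  proof (cases "g = \<sigma>")
    case True
    then show ?thesis using less.prems g(3) by blast
  next
    case False
    have "vec.dim h < vec.dim \<sigma>" using face_dim_less less.prems by blast
    then obtain F where "cone_face F \<sigma>" "g \<subseteq> F" "vec.dim \<sigma> = vec.dim F + 1"
      using less.hyps[OF _ g(1) False] g(3) by force
    then show ?thesis using g(2) by blast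
  qed
qed

context link
begin

text \<open>Equivalently, modulo the span of \<open>\<tau>\<close> the cone \<open>\<sigma>\<close> is generated by the faces that cover \<open>\<tau>\<close>.\<close>

lemma negative_cover:
  assumes a: "\<forall>x\<in>\<tau>. a \<cdot> x = 0" and x: "x \<in> \<sigma>" "a \<cdot> x < 0"
  shows "\<exists>g\<in>above 1 \<tau> \<sigma>. \<forall>y\<in>g. y \<notin> \<tau> \<longrightarrow> a \<cdot> y < 0"
proof -
  have "\<tau> \<noteq> \<sigma>" using a x by fastforce
  then obtain \<mu> z where \<mu>: "\<forall>x\<in>\<sigma>. \<mu> * (l \<cdot> x) \<le> a \<cdot> x" "z \<in> \<sigma>" "z \<notin> \<tau>" "a \<cdot> z = \<mu> * (l \<cdot> z)"
    using min_ratio[OF _ a] by blast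
  define F where "F = {x\<in>\<sigma>. a \<cdot> x = \<mu> * (l \<cdot> x)}"
  have F: "cone_face F \<sigma>" "\<tau> \<subseteq> F" "\<tau> \<noteq> F" using ratio_face[OF \<mu>(1) a] \<mu> unfolding F_def by auto
  \<comment> \<open>The negative value at \<open>x\<close> forces \<mu> < 0. On \<open>F\<close> the
    functional \<open>a\<close> equals \<mu> times \<open>l\<close>, so it is negative on every
    cover inside \<open>F\<close>, off \<tau>.\<close>
  have "\<mu> * (l \<cdot> x) < 0" using \<mu>(1) x by force
  then have "\<mu> < 0" using l_nonneg[OF x(1)] by (simp add: mult_less_0_iff)
  obtain g where g: "g \<in> above 1 \<tau> F"
    using cover_exists[OF fg_cone_face[OF fg F(1)] cone_face_sub[OF face F(2) cone_face_subset[OF F(1)]] F(3)] by blast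
  have "a \<cdot> y < 0" if "y \<in> g" "y \<notin> \<tau>" for y
  proof -
    have "y \<in> F" using aboveD(4)[OF g] that by blast
    then show ?thesis using that(2) l_pos[of y] \<open>\<mu> < 0\<close> by (auto simp: F_def mult_neg_pos)
  qed
  then show ?thesis using g above_face_mono[OF fg F(1)] by blast
qed

text \<open>The vertex of \<sigma>/\<tau> given by a cover. It is fixed only modulo the span of
  \<tau>, which suffices for functionals vanishing on \<tau>.\<close>

definition pt :: "('k ^ 'm) set \<Rightarrow> 'k ^ 'm" where
  "pt g = (SOME x. x \<in> g \<and> l \<cdot> x = 1)"

lemma pt:
  assumes "g \<in> above 1 \<tau> \<sigma>"
  shows "pt g \<in> g" "l \<cdot> pt g = 1" "pt g \<notin> \<tau>"
proof -
  note g = aboveD[OF assms]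
  have "\<tau> \<noteq> g" using g(3) by auto
  then obtain x where x: "x \<in> g" "x \<notin> \<tau>" using g(2) by blast
  have pos: "0 < l \<cdot> x" using x g(4) l_pos by blast
  have "(1 / (l \<cdot> x)) *s x \<in> g" using fg_cone_scale[OF fg_cone_face[OF fg g(1)] x(1)] pos by simp
  moreover have "l \<cdot> ((1 / (l \<cdot> x)) *s x) = 1" using pos by simp
  ultimately have "\<exists>x. x \<in> g \<and> l \<cdot> x = 1" by blast
  then have *: "pt g \<in> g \<and> l \<cdot> pt g = 1" unfolding pt_def by (rule someI_ex)
  then show "pt g \<in> g" "l \<cdot> pt g = 1" by auto
  show "pt g \<notin> \<tau>" using * l_zero by auto
qed

lemma cover_decompose:
  assumes "g \<in> above 1 \<tau> \<sigma>" "x \<in> vec.span g"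
  shows "\<exists>z\<in>vec.span \<tau>. x = (l \<cdot> x) *s pt g + z"
proof -
  note g = aboveD[OF assms(1)]
  have "vec.span g = vec.span (insert (pt g) \<tau>)"
    using span_insert_face[OF cone_face_sub[OF face g(2,4)] g(3)] pt[OF assms(1)] by blast
  then obtain k where k: "x - k *s pt g \<in> vec.span \<tau>" using assms(2) vec.span_breakdown_eq by blast
  have "l \<cdot> (x - k *s pt g) = 0" using sp_zero_span[OF _ k] l_zero by auto
  then have "k = l \<cdot> x" using pt(2)[OF assms(1)] by simp
  then show ?thesis using k by (intro bexI[of _ "x - k *s pt g"]) auto
qed

text \<open>Modulo the span of \<tau> a cover is one-dimensional, so on it every functional
  vanishing on \<tau> is proportional to \<open>l\<close>.\<close>

lemma sp_cover:
  assumes "g \<in> above 1 \<tau> \<sigma>" "\<forall>x\<in>\<tau>. b \<cdot> x = 0" "x \<in> vec.span g"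
  shows "b \<cdot> x = (b \<cdot> pt g) * (l \<cdot> x)"
proof -
  obtain z where z: "z \<in> vec.span \<tau>" "x = (l \<cdot> x) *s pt g + z" using cover_decompose[OF assms(1,3)] by blast
  have "b \<cdot> z = 0" using sp_zero_span[OF assms(2) z(1)] .
  then show ?thesis by (subst z(2)) simp
qed

lemma covers_inter:
  assumes "g \<in> above 1 \<tau> \<sigma>" "g' \<in> above 1 \<tau> \<sigma>" "g \<noteq> g'"
  shows "g \<inter> g' = \<tau>"
proof (rule ccontr)
  note g = aboveD[OF assms(1)] aboveD[OF assms(2)]
  assume "g \<inter> g' \<noteq> \<tau>"
  moreover have f: "cone_face (g \<inter> g') \<sigma>" using g cone_face_inter by blast
  moreover have "cone_face \<tau> (g \<inter> g')" using face g f by (auto intro: cone_face_sub)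
  ultimately have d: "vec.dim \<tau> < vec.dim (g \<inter> g')" using face_dim_less by blast
  have "cone_face (g \<inter> g') g" "cone_face (g \<inter> g') g'" using f g cone_face_sub by blast+
  then have "g \<inter> g' = g" "g \<inter> g' = g'" using d g by (auto intro!: face_dim_eq)
  then show False using assms(3) by blast
qed

lemma cover_unique:
  assumes "g \<in> above 1 \<tau> \<sigma>" "g' \<in> above 1 \<tau> \<sigma>" "x \<in> g" "x \<in> g'" "x \<notin> \<tau>"
  shows "g = g'"
  using covers_inter[OF assms(1,2)] assms(3-) by blast

end

text \<open>The quotient is a segment. One end is \<open>g1\<close>, exposed by \<open>b\<close>;
  the other is found where b/l is largest. A third vertex would be a convex combination of the two
  ends, and its exposing functional would have to vanish at an end of non-zero weight.\<close>

lemma diamond: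
  fixes \<sigma> :: "('k::linordered_field ^ 'm) set"
  assumes "fg_cone \<sigma>" "cone_face \<tau> \<sigma>" "vec.dim \<sigma> = vec.dim \<tau> + 2" "g1 \<in> above 1 \<tau> \<sigma>"
  shows "\<exists>g2. g2 \<noteq> g1 \<and> above 1 \<tau> \<sigma> = {g1, g2}"
proof -
  obtain l where l: "link \<sigma> \<tau> l" using link_exists assms by blast
  interpret link \<sigma> \<tau> l by fact
  note g1 = aboveD[OF assms(4)]
  obtain b where b: "\<And>x. x \<in> \<sigma> \<Longrightarrow> 0 \<le> b \<cdot> x" "g1 = {x\<in>\<sigma>. b \<cdot> x = 0}"
    using g1(1) by (auto simp: cone_face_def)
  have b0: "\<forall>x\<in>\<tau>. b \<cdot> x = 0" using b(2) g1(2) by auto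
  have "\<tau> \<noteq> \<sigma>" using assms(3) by auto
  \<comment> \<open>The minimal ratio of \<open>- b\<close> to \<open>l\<close> marks the far end of
    the segment.\<close>
  then obtain \<mu> x where \<mu>: "\<forall>x\<in>\<sigma>. \<mu> * (l \<cdot> x) \<le> (- b) \<cdot> x" "x \<in> \<sigma>" "x \<notin> \<tau>" "(- b) \<cdot> x = \<mu> * (l \<cdot> x)"
    using min_ratio[of "- b"] b0 by auto
  define F where "F = {x\<in>\<sigma>. (- b) \<cdot> x = \<mu> * (l \<cdot> x)}"
  have F: "cone_face F \<sigma>" "\<tau> \<subseteq> F" "\<tau> \<noteq> F" using ratio_face[OF \<mu>(1)] b0 \<mu> unfolding F_def by auto
  obtain g2 where "g2 \<in> above 1 \<tau> F"
    using cover_exists[OF fg_cone_face[OF fg F(1)] cone_face_sub[OF face F(2) cone_face_subset[OF F(1)]] F(3)] by blast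
  then have g2: "g2 \<in> above 1 \<tau> \<sigma>" "g2 \<subseteq> F" using above_face[OF fg F(1)] by auto
  note g2' = aboveD[OF g2(1)]
  have "g1 \<noteq> \<sigma>" using g1(3) assms(3) by auto
  then obtain y where y: "y \<in> \<sigma>" "y \<notin> g1" using g1(4) by blast
  have "\<mu> < 0"
  proof (rule ccontr)
    assume "\<not> \<mu> < 0"
    then have "0 \<le> \<mu> * (l \<cdot> y)" using l_nonneg[OF y(1)] by simp
    then show False using y b(1)[OF y(1)] b(2) \<mu>(1) by force
  qed
  have "pt g2 \<in> F" using pt(1)[OF g2(1)] g2(2) by blast
  then have bp2: "b \<cdot> pt g2 = - \<mu>" using pt(2)[OF g2(1)] by (simp add: F_def minus_equation_iff)
  have bp1: "b \<cdot> pt g1 = 0" using pt(1)[OF assms(4)] b(2) by auto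
  have "g2 \<noteq> g1" using bp1 bp2 \<open>\<mu> < 0\<close> by auto
  have n2: "pt g2 \<notin> vec.span (insert (pt g1) \<tau>)"
    using sp_zero_span[of "insert (pt g1) \<tau>" b "pt g2"] bp1 b0 bp2 \<open>\<mu> < 0\<close> by auto
  have n1: "pt g1 \<notin> vec.span \<tau>" using face_span[OF face] pt[OF assms(4)] g1(4) by blast
  have "vec.dim (insert (pt g2) (insert (pt g1) \<tau>)) = vec.dim \<sigma>"
    using n1 n2 assms(3) by (simp add: vec.dim_insert)
  moreover have "insert (pt g2) (insert (pt g1) \<tau>) \<subseteq> \<sigma>"
    using pt(1)[OF g2(1)] pt(1)[OF assms(4)] g1(4) g2'(4) cone_face_subset[OF face] by blast
  ultimately have span: "vec.span \<sigma> = vec.span (insert (pt g2) (insert (pt g1) \<tau>))"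
    by (metis order_refl vec.dim_eq_span)
  have "g3 = g1 \<or> g3 = g2" if g3: "g3 \<in> above 1 \<tau> \<sigma>" for g3
  proof -
    note g3' = aboveD[OF g3] and p3 = pt[OF g3]
    have p3\<sigma>: "pt g3 \<in> \<sigma>" using p3 g3' by blast
    then obtain \<beta> where "pt g3 - \<beta> *s pt g2 \<in> vec.span (insert (pt g1) \<tau>)"
      using span vec.span_base vec.span_breakdown_eq by blast
    then obtain \<alpha> where \<alpha>: "pt g3 - \<beta> *s pt g2 - \<alpha> *s pt g1 \<in> vec.span \<tau>"
      using vec.span_breakdown_eq by blast
    define z where "z = pt g3 - \<beta> *s pt g2 - \<alpha> *s pt g1"
    have z: "pt g3 = \<beta> *s pt g2 + \<alpha> *s pt g1 + z" by (simp add: z_def)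
    have van: "c \<cdot> pt g3 = \<beta> * (c \<cdot> pt g2) + \<alpha> * (c \<cdot> pt g1)" if "\<forall>x\<in>\<tau>. c \<cdot> x = 0" for c
      using sp_zero_span[OF that \<alpha>] unfolding z_def[symmetric] by (subst z) simp
    \<comment> \<open>Both weights are non-negative: \<beta> because \<open>b\<close> is
      non-negative on \<sigma>, and \<alpha> because \<open>b\<close> is at most - \<mu> times
      \<open>l\<close> there.\<close>
    have "0 \<le> \<beta> * (- \<mu>)" using van[OF b0] bp1 bp2 b(1)[OF p3\<sigma>] by simp
    then have \<beta>0: "0 \<le> \<beta>" using \<open>\<mu> < 0\<close> by (simp add: mult_le_0_iff)
    have l3: "\<beta> + \<alpha> = 1" using van[of l] l_zero p3(2) pt(2)[OF g2(1)] pt(2)[OF assms(4)] by auto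
    have "\<mu> \<le> \<beta> * \<mu>" using \<mu>(1) p3\<sigma> van[OF b0] bp1 bp2 p3(2) by force
    then have \<alpha>0: "0 \<le> \<alpha>" using \<open>\<mu> < 0\<close> l3 by (simp add: mult_le_cancel_right1)
    obtain c where c: "\<And>x. x \<in> \<sigma> \<Longrightarrow> 0 \<le> c \<cdot> x" "g3 = {x\<in>\<sigma>. c \<cdot> x = 0}"
      using g3'(1) by (auto simp: cone_face_def)
    have c0: "\<forall>x\<in>\<tau>. c \<cdot> x = 0" using c(2) g3'(2) by auto
    have "pt g1 \<in> \<sigma>" "pt g2 \<in> \<sigma>" using pt(1)[OF g2(1)] pt(1)[OF assms(4)] g1(4) g2'(4) by auto
    moreover have "\<beta> * (c \<cdot> pt g2) + \<alpha> * (c \<cdot> pt g1) = 0" using van[OF c0] p3(1) c(2) by auto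
    ultimately have "\<beta> * (c \<cdot> pt g2) = 0" "\<alpha> * (c \<cdot> pt g1) = 0"
      using \<alpha>0 \<beta>0 c(1) by (simp_all add: add_nonneg_eq_0_iff)
    then have "c \<cdot> pt g2 = 0 \<or> c \<cdot> pt g1 = 0" using l3 by auto
    then have "pt g2 \<in> g3 \<or> pt g1 \<in> g3" using \<open>pt g1 \<in> \<sigma>\<close> \<open>pt g2 \<in> \<sigma>\<close> c(2) by auto
    then show ?thesis using cover_unique[OF g3 g2(1)] cover_unique[OF g3 assms(4)] pt[OF g2(1)] pt[OF assms(4)] by blast
  qed
  then have "above 1 \<tau> \<sigma> = {g1, g2}" using assms(4) g2(1) by blast
  then show ?thesis using \<open>g2 \<noteq> g1\<close> by blast
qed

section \<open>Connectivity\<close>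

lemma above_trans: "g \<in> above i \<tau> \<sigma> \<Longrightarrow> h \<in> above j g \<sigma> \<Longrightarrow> h \<in> above (i + j) \<tau> \<sigma>"
  by (auto simp: above_def)

lemma above_dim_eq:
  assumes "g \<in> above j \<tau> \<sigma>" "vec.dim \<sigma> = vec.dim \<tau> + j"
  shows "g = \<sigma>"
  using face_dim_eq[OF aboveD(1)[OF assms(1)]] aboveD(3)[OF assms(1)] assms(2) by simp

context link
begin

lemma above2_cases:
  assumes "h \<in> above 2 \<tau> \<sigma>" "g \<in> above 1 \<tau> h"
  shows "\<exists>g'. g' \<noteq> g \<and> above 1 \<tau> h = {g, g'}"
  using diamond[OF fg_cone_face[OF fg aboveD(1)[OF assms(1)]] _ aboveD(3)[OF assms(1)] assms(2)]
    cone_face_sub[OF face aboveD(2,4)[OF assms(1)]] by blast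

text \<open>The improving edge of the simplex method. After subtracting a multiple of
  \<open>l\<close> the functional vanishes on \<open>g\<close> and is negative at \<open>y\<close>;
  \<open>negative_cover\<close> in the link of \<open>g\<close> gives an edge along which it
  decreases, and the diamond property gives the other end of that edge.\<close>

lemma descending_neighbour:
  assumes g: "g \<in> above 1 \<tau> \<sigma>" and b: "\<forall>x\<in>\<tau>. b \<cdot> x = 0" and y: "y \<in> \<sigma>" "b \<cdot> y < (b \<cdot> pt g) * (l \<cdot> y)"
  shows "\<exists>h\<in>above 2 \<tau> \<sigma>. \<exists>g'\<in>above 1 \<tau> h. g \<in> above 1 \<tau> h \<and> b \<cdot> pt g' < b \<cdot> pt g"
proof -
  define a where "a = b - (b \<cdot> pt g) *s l"
  have a: "\<forall>x\<in>g. a \<cdot> x = 0" using sp_cover[OF g b] vec.span_base by (auto simp: a_def)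
  obtain l' where "link \<sigma> g l'" using link_exists[OF fg aboveD(1)[OF g]] by blast
  then interpret g: link \<sigma> g l' .
  obtain h where h: "h \<in> above 1 g \<sigma>" "\<forall>x\<in>h. x \<notin> g \<longrightarrow> a \<cdot> x < 0"
    using g.negative_cover[OF a y(1)] y(2) by (auto simp: a_def)
  have h2: "h \<in> above 2 \<tau> \<sigma>" using above_trans[OF g h(1)] by (simp add: numeral_2_eq_2)
  have gh: "g \<in> above 1 \<tau> h" using g aboveD[OF h(1)] by (simp add: above_face[OF fg])
  obtain g' where g': "g' \<noteq> g" "above 1 \<tau> h = {g, g'}" using above2_cases[OF h2 gh] by blast
  then have g'h: "g' \<in> above 1 \<tau> h" by blast
  then have g'\<sigma>: "g' \<in> above 1 \<tau> \<sigma>" using above_face_mono[OF fg aboveD(1)[OF h(1)]] by blast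
  have "pt g' \<notin> g" using cover_unique[OF g g'\<sigma>] pt[OF g'\<sigma>] g'(1) by blast
  then have "a \<cdot> pt g' < 0" using h(2) pt(1)[OF g'\<sigma>] aboveD(4)[OF g'h] by blast
  then have "b \<cdot> pt g' < b \<cdot> pt g" using pt(2)[OF g'\<sigma>] by (simp add: a_def)
  then show ?thesis using h2 gh g'h by blast
qed

text \<open>A descent along edges ends in the face of minimal ratio and never leaves the part of
  height at most \<open>c\<close>, so compatibility of \<open>f\<close> with the edges in this part
  is enough.\<close>

lemma descend:
  fixes f :: "('k ^ 'm) set \<Rightarrow> 'b"
  assumes b: "\<forall>x\<in>\<tau>. b \<cdot> x = 0"
    and y: "y \<in> \<sigma>" "y \<notin> \<tau>" "b \<cdot> y = \<mu> * (l \<cdot> y)"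
    and \<mu>: "\<forall>x\<in>\<sigma>. \<mu> * (l \<cdot> x) \<le> b \<cdot> x"
    and f: "\<And>h g g'. h \<in> above 2 \<tau> \<sigma> \<Longrightarrow> g \<in> above 1 \<tau> h \<Longrightarrow> g' \<in> above 1 \<tau> h \<Longrightarrow>
      b \<cdot> pt g \<le> c \<Longrightarrow> b \<cdot> pt g' \<le> c \<Longrightarrow> f g = f g'"
    and g: "g \<in> above 1 \<tau> \<sigma>" "b \<cdot> pt g \<le> c"
  shows "\<exists>g'\<in>above 1 \<tau> {x\<in>\<sigma>. b \<cdot> x = \<mu> * (l \<cdot> x)}. f g' = f g"
proof -
  \<comment> \<open>In place of a path, a lowest cover with the same value of \<open>f\<close> is
    taken; a descending edge at it would lead to a lower member of \<open>N\<close>.\<close>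
  define N where "N = {g'\<in>above 1 \<tau> \<sigma>. b \<cdot> pt g' \<le> c \<and> f g' = f g}"
  have N: "finite N" "N \<noteq> {}" using finite_above[OF fg] g by (auto simp: N_def)
  obtain k where k: "k \<in> N" "\<And>k'. k' \<in> N \<Longrightarrow> b \<cdot> pt k \<le> b \<cdot> pt k'"
    using ex_min_if_finite[of "(\<lambda>k. b \<cdot> pt k) ` N"] N by (auto simp: not_less)
  have k1: "k \<in> above 1 \<tau> \<sigma>" "b \<cdot> pt k \<le> c" "f k = f g" using k(1) by (auto simp: N_def)
  have "b \<cdot> pt k \<le> \<mu>"
  proof (rule ccontr)
    assume "\<not> b \<cdot> pt k \<le> \<mu>"
    then have "b \<cdot> y < (b \<cdot> pt k) * (l \<cdot> y)" using y(3) l_pos[OF y(1,2)] by simp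
    then obtain h g' where hg: "h \<in> above 2 \<tau> \<sigma>" "g' \<in> above 1 \<tau> h" "k \<in> above 1 \<tau> h" "b \<cdot> pt g' < b \<cdot> pt k"
      using descending_neighbour[OF k1(1) b y(1)] by blast
    then have "f g' = f k" using f[OF hg(1-3)] k1(2) by simp
    moreover have "g' \<in> above 1 \<tau> \<sigma>" using hg(2) above_face_mono[OF fg aboveD(1)[OF hg(1)]] by blast
    ultimately have "g' \<in> N" using k1 hg(4) by (auto simp: N_def)
    then show False using k(2) hg(4) by fastforce
  qed
  moreover have "\<mu> \<le> b \<cdot> pt k" using \<mu> pt[OF k1(1)] aboveD(4)[OF k1(1)] by force
  ultimately have "b \<cdot> pt k = \<mu>" by simp
  then have "k \<subseteq> {x\<in>\<sigma>. b \<cdot> x = \<mu> * (l \<cdot> x)}"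
    using sp_cover[OF k1(1) b] aboveD(4)[OF k1(1)] vec.span_base by auto
  then have "k \<in> above 1 \<tau> {x\<in>\<sigma>. b \<cdot> x = \<mu> * (l \<cdot> x)}"
    using k1(1) above_face[OF fg ratio_face(1)[OF \<mu> b]] by blast
  then show ?thesis using k1(3) by blast
qed

end

text \<open>Both vertices descend to the bottom face of a functional chosen so that this face is
  proper, and there the induction hypothesis applies.\<close>

lemma covers_connected:
  fixes \<sigma> :: "('k::linordered_field ^ 'm) set"
  assumes "fg_cone \<sigma>" "cone_face \<tau> \<sigma>"
    and "\<And>h g g'. h \<in> above 2 \<tau> \<sigma> \<Longrightarrow> g \<in> above 1 \<tau> h \<Longrightarrow> g' \<in> above 1 \<tau> h \<Longrightarrow> f g = f g'"
    and "g1 \<in> above 1 \<tau> \<sigma>" "g2 \<in> above 1 \<tau> \<sigma>"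
  shows "f g1 = f g2"
  using assms
proof (induction "vec.dim \<sigma>" arbitrary: \<sigma> g1 g2 rule: less_induct)
  case less
  obtain l where l: "link \<sigma> \<tau> l" using link_exists less.prems by blast
  interpret link \<sigma> \<tau> l by fact
  show ?case
  proof (cases "vec.dim \<sigma> = vec.dim \<tau> + 1")
    case True
    then show ?thesis using above_dim_eq less.prems(4,5) by metis
  next
    case False
    have "\<tau> \<noteq> \<sigma>" using aboveD(3)[OF less.prems(4)] face_dim_mono[OF aboveD(1)[OF less.prems(4)]] by auto
    then obtain b where b: "\<forall>x\<in>\<tau>. b \<cdot> x = 0" "\<And>\<mu>. {x\<in>\<sigma>. b \<cdot> x = \<mu> * (l \<cdot> x)} \<noteq> \<sigma>"
      using exists_proper_functional[OF l _ False] by blast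
    obtain \<mu> y where \<mu>: "\<forall>x\<in>\<sigma>. \<mu> * (l \<cdot> x) \<le> b \<cdot> x" and y: "y \<in> \<sigma>" "y \<notin> \<tau>" "b \<cdot> y = \<mu> * (l \<cdot> y)"
      using min_ratio[OF \<open>\<tau> \<noteq> \<sigma>\<close> b(1)] by blast
    define M where "M = {x\<in>\<sigma>. b \<cdot> x = \<mu> * (l \<cdot> x)}"
    have M: "cone_face M \<sigma>" "\<tau> \<subseteq> M" "M \<noteq> \<sigma>" using ratio_face[OF \<mu> b(1)] b(2) unfolding M_def by auto
    define c where "c = max (b \<cdot> pt g1) (b \<cdot> pt g2)"
    have "\<exists>g'\<in>above 1 \<tau> M. f g' = f g" if "g \<in> above 1 \<tau> \<sigma>" "b \<cdot> pt g \<le> c" for g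
      unfolding M_def using descend[OF b(1) y \<mu> _ that] less.prems(3) by blast
    then obtain g1' g2' where g': "g1' \<in> above 1 \<tau> M" "f g1' = f g1" "g2' \<in> above 1 \<tau> M" "f g2' = f g2"
      using less.prems(4,5) by (metis c_def max.cobounded1 max.cobounded2)
    have "f g1' = f g2'"
    proof (rule less.hyps[OF face_dim_less[OF M(1,3)] fg_cone_face[OF fg M(1)]])
      show "cone_face \<tau> M" using cone_face_sub[OF face M(2)] cone_face_subset[OF M(1)] by blast
      show "f g = f g'" if "h \<in> above 2 \<tau> M" "g \<in> above 1 \<tau> h" "g' \<in> above 1 \<tau> h" for h g g'
        using less.prems(3) that above_face_mono[OF fg M(1)] by blast
    qed (use g' in auto)
    then show ?thesis using g' by simp
  qed
qed

context link
begin

text \<open>Descent keeps \<open>a\<close> negative and ends in the bottom face, where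
  \<open>a\<close> is negative throughout; this face has a connected graph.\<close>

lemma negative_covers_connected:
  fixes f :: "('k ^ 'm) set \<Rightarrow> 'b"
  assumes a: "\<forall>x\<in>\<tau>. a \<cdot> x = 0"
    and f: "\<And>h g g'. h \<in> above 2 \<tau> \<sigma> \<Longrightarrow> g \<in> above 1 \<tau> h \<Longrightarrow> g' \<in> above 1 \<tau> h \<Longrightarrow>
      a \<cdot> pt g < 0 \<Longrightarrow> a \<cdot> pt g' < 0 \<Longrightarrow> f g = f g'"
    and g: "g1 \<in> above 1 \<tau> \<sigma>" "g2 \<in> above 1 \<tau> \<sigma>" "a \<cdot> pt g1 < 0" "a \<cdot> pt g2 < 0"
  shows "f g1 = f g2"
proof -
  have "\<tau> \<noteq> \<sigma>" using aboveD(3)[OF g(1)] face_dim_mono[OF aboveD(1)[OF g(1)]] by auto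
  then obtain \<mu> y where \<mu>: "\<forall>x\<in>\<sigma>. \<mu> * (l \<cdot> x) \<le> a \<cdot> x" and y: "y \<in> \<sigma>" "y \<notin> \<tau>" "a \<cdot> y = \<mu> * (l \<cdot> y)"
    using min_ratio[OF _ a] by blast
  define M where "M = {x\<in>\<sigma>. a \<cdot> x = \<mu> * (l \<cdot> x)}"
  have M: "cone_face M \<sigma>" "\<tau> \<subseteq> M" using ratio_face[OF \<mu> a] unfolding M_def by auto
  \<comment> \<open>The larger of two negative heights: edges with both ends below it lie in the
    region where \<open>f\<close> is known to be compatible.\<close>
  define c where "c = max (a \<cdot> pt g1) (a \<cdot> pt g2)"
  have c: "c < 0" using g by (simp add: c_def)
  have "\<exists>g'\<in>above 1 \<tau> M. f g' = f g" if "g \<in> above 1 \<tau> \<sigma>" "a \<cdot> pt g \<le> c" for g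
  proof -
    have "f g = f g'" if "h \<in> above 2 \<tau> \<sigma>" "g \<in> above 1 \<tau> h" "g' \<in> above 1 \<tau> h" "a \<cdot> pt g \<le> c" "a \<cdot> pt g' \<le> c" for h g g'
      using f[OF that(1-3)] that(4,5) c by simp
    then show ?thesis unfolding M_def using descend[OF a y \<mu> _ that] by blast
  qed
  then obtain g1' g2' where g': "g1' \<in> above 1 \<tau> M" "f g1' = f g1" "g2' \<in> above 1 \<tau> M" "f g2' = f g2"
    using g by (metis c_def max.cobounded1 max.cobounded2)
  have "\<mu> < 0"
    using \<mu> pt(1,2)[OF g(1)] aboveD(4)[OF g(1)] g(3) by force
  have neg: "a \<cdot> pt g < 0" if "g \<in> above 1 \<tau> M" for g
  proof -
    have "g \<in> above 1 \<tau> \<sigma>" using that above_face_mono[OF fg M(1)] by blast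
    then show ?thesis using pt(1,2)[of g] aboveD(4)[OF that] \<open>\<mu> < 0\<close> by (auto simp: M_def)
  qed
  have "f g1' = f g2'"
  proof (rule covers_connected[OF fg_cone_face[OF fg M(1)]])
    show "cone_face \<tau> M" using cone_face_sub[OF face M(2)] cone_face_subset[OF M(1)] by blast
    show "f g = f g'" if h: "h \<in> above 2 \<tau> M" "g \<in> above 1 \<tau> h" "g' \<in> above 1 \<tau> h" for h g g'
    proof (rule f)
      show "h \<in> above 2 \<tau> \<sigma>" using h(1) above_face_mono[OF fg M(1)] by blast
      have "above 1 \<tau> h \<subseteq> above 1 \<tau> M" using above_face_mono[OF fg_cone_face[OF fg M(1)] aboveD(1)[OF h(1)]] .
      then show "a \<cdot> pt g < 0" "a \<cdot> pt g' < 0" using h neg by auto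
    qed (use h in auto)
  qed (use g' in auto)
  then show ?thesis using g' by simp
qed

end

text \<open>The edge cut that separates the vertices with property \<open>A\<close> from the others
  in the graph of \<sigma>/\<tau>.\<close>

definition cut :: "('k::linordered_field ^ 'm) set \<Rightarrow> ('k ^ 'm) set \<Rightarrow> (('k ^ 'm) set \<Rightarrow> bool) \<Rightarrow> ('k ^ 'm) set set" where
  "cut \<tau> \<sigma> A = {h \<in> above 2 \<tau> \<sigma>. \<exists>g\<in>above 1 \<tau> h. \<exists>g'\<in>above 1 \<tau> h. A g \<and> \<not> A g'}"

text \<open>The graph of a \<open>d\<close>-polytope, here the polytope of the faces of \<open>\<sigma>\<close> above \<open>\<tau>\<close>, is
  \<open>d\<close>-edge-connected. A cut edge lies in a facet \<open>F\<close>, which contributes \<open>d - 1\<close> cut edges by induction;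
  one more lies outside \<open>F\<close> since the vertices outside \<open>F\<close> span a connected graph and every vertex
  of \<open>F\<close> has a neighbour outside \<open>F\<close>.\<close>

lemma card_cut:
  fixes \<sigma> :: "('k::linordered_field ^ 'm) set"
  assumes "fg_cone \<sigma>" "cone_face \<tau> \<sigma>" "g1 \<in> above 1 \<tau> \<sigma>" "g2 \<in> above 1 \<tau> \<sigma>" "A g1" "\<not> A g2"
  shows "vec.dim \<sigma> \<le> vec.dim \<tau> + 1 + card (cut \<tau> \<sigma> A)"
  using assms
proof (induction "vec.dim \<sigma>" arbitrary: \<sigma> g1 g2 rule: less_induct)
  case less
  have fin: "finite (cut \<tau> \<sigma> A)" using finite_above[OF less.prems(1)] by (auto simp: cut_def)
  obtain h0 g g' where h0: "h0 \<in> above 2 \<tau> \<sigma>" "g \<in> above 1 \<tau> h0" "g' \<in> above 1 \<tau> h0" "A g" "\<not> A g'"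
    using covers_connected[OF less.prems(1,2), where f = A and ?g1.0 = g1 and ?g2.0 = g2] less.prems by blast
  then have h0cut: "h0 \<in> cut \<tau> \<sigma> A" by (auto simp: cut_def)
  show ?case
  proof (cases "h0 = \<sigma>")
    \<comment> \<open>Here \<sigma>/\<tau> is a single edge, of dimension 1, and one cut edge is
      enough.\<close>
    case True
    then have "vec.dim \<sigma> = vec.dim \<tau> + 2" using aboveD(3)[OF h0(1)] by simp
    moreover have "card (cut \<tau> \<sigma> A) \<noteq> 0" using fin h0cut by auto
    ultimately show ?thesis by simp
  next
    case False
    obtain F where F: "cone_face F \<sigma>" "h0 \<subseteq> F" "vec.dim \<sigma> = vec.dim F + 1"
      using facet_exists[OF less.prems(1) aboveD(1)[OF h0(1)] False] by blast
    have fgF: "fg_cone F" using fg_cone_face[OF less.prems(1) F(1)] .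
    have \<tau>F: "cone_face \<tau> F"
      using cone_face_sub[OF less.prems(2) _ cone_face_subset[OF F(1)]] aboveD(2)[OF h0(1)] F(2) by blast
    have "h0 \<in> above 2 \<tau> F" using h0(1) F(2) above_face[OF less.prems(1) F(1)] by blast
    then have "above 1 \<tau> h0 \<subseteq> above 1 \<tau> F" using above_face_mono[OF fgF aboveD(1)] by blast
    then have gF: "g \<in> above 1 \<tau> F" "g' \<in> above 1 \<tau> F" using h0 by auto
    then have IH: "vec.dim F \<le> vec.dim \<tau> + 1 + card (cut \<tau> F A)"
      using less.hyps[OF _ fgF \<tau>F gF h0(4,5)] F(3) by simp
    obtain \<phi> where \<phi>: "\<And>x. x \<in> \<sigma> \<Longrightarrow> 0 \<le> \<phi> \<cdot> x" "F = {x\<in>\<sigma>. \<phi> \<cdot> x = 0}"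
      using F(1) by (auto simp: cone_face_def)
    obtain l where "link \<sigma> \<tau> l" using link_exists less.prems by blast
    then interpret link \<sigma> \<tau> l .
    have \<phi>0: "\<forall>x\<in>\<tau>. (- \<phi>) \<cdot> x = 0" using \<phi>(2) cone_face_subset[OF \<tau>F] by auto
    have "F \<noteq> \<sigma>" using F(3) by auto
    then obtain y where y: "y \<in> \<sigma>" "y \<notin> F" using cone_face_subset[OF F(1)] by blast
    then have y\<phi>: "(- \<phi>) \<cdot> y < 0" using \<phi> by (auto simp: order_less_le)
    have "\<exists>h\<in>cut \<tau> \<sigma> A. \<not> h \<subseteq> F"
    proof (rule ccontr)
      assume contr: "\<not> (\<exists>h\<in>cut \<tau> \<sigma> A. \<not> h \<subseteq> F)"
      \<comment> \<open>All cut edges are supposed to lie in \<open>F\<close>, hence an edge with an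
        end outside \<open>F\<close> is not cut.\<close>
      have const: "A k = A k'" if "h \<in> above 2 \<tau> \<sigma>" "k \<in> above 1 \<tau> h" "k' \<in> above 1 \<tau> h" "(- \<phi>) \<cdot> pt k < 0" for h k k'
      proof (rule ccontr)
        assume "A k \<noteq> A k'"
        then have "h \<in> cut \<tau> \<sigma> A" using that by (auto simp: cut_def)
        then have "h \<subseteq> F" using contr by blast
        moreover have "pt k \<in> k" using pt(1) that(2) above_face_mono[OF fg aboveD(1)[OF that(1)]] by blast
        ultimately have "\<phi> \<cdot> pt k = 0" using aboveD(4)[OF that(2)] \<phi>(2) by blast
        then show False using that(4) by simp
      qed
      have out: "\<exists>k'\<in>above 1 \<tau> \<sigma>. (- \<phi>) \<cdot> pt k' < 0 \<and> A k = A k'" if k: "k \<in> above 1 \<tau> F" for k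
      proof -
        have k\<sigma>: "k \<in> above 1 \<tau> \<sigma>" using k above_face_mono[OF fg F(1)] by blast
        have "\<phi> \<cdot> pt k = 0" using pt(1)[OF k\<sigma>] aboveD(4)[OF k] \<phi>(2) by blast
        then obtain h k' where h: "h \<in> above 2 \<tau> \<sigma>" "k' \<in> above 1 \<tau> h" "k \<in> above 1 \<tau> h" "(- \<phi>) \<cdot> pt k' < 0"
          using descending_neighbour[OF k\<sigma> \<phi>0 y(1)] y\<phi> by auto
        then show ?thesis using const[OF h(1,2,3,4)] above_face_mono[OF fg aboveD(1)[OF h(1)]] by blast
      qed
      obtain k k' where k: "k \<in> above 1 \<tau> \<sigma>" "(- \<phi>) \<cdot> pt k < 0" "A g = A k"
        "k' \<in> above 1 \<tau> \<sigma>" "(- \<phi>) \<cdot> pt k' < 0" "A g' = A k'" using out[OF gF(1)] out[OF gF(2)] by blast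
      have "A k = A k'" by (rule negative_covers_connected[OF \<phi>0 _ k(1,4,2,5)]) (rule const)
      then show False using k h0 by simp
    qed
    then obtain h where h: "h \<in> cut \<tau> \<sigma> A" "\<not> h \<subseteq> F" by blast
    have "cut \<tau> F A \<subseteq> cut \<tau> \<sigma> A - {h}"
      using above_face[OF fg F(1), of 2 \<tau>] h(2) by (auto simp: cut_def)
    then have "card (cut \<tau> F A) \<le> card (cut \<tau> \<sigma> A - {h})" using fin by (intro card_mono) auto
    also have "\<dots> < card (cut \<tau> \<sigma> A)" using fin h(1) by (rule card_Diff1_less)
    finally show ?thesis using IH F(3) by simp
  qed
qed

section \<open>Acyclicity of the link of a face\<close>

context link
begin

text \<open>Each further vector is handled by a perturbation a + t b, where t avoids finitely many
  values of the infinite field.\<close>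

lemma nonvanishing_functional:
  assumes "finite Y" "\<forall>y\<in>Y. y \<notin> vec.span \<tau>"
  shows "\<exists>a. (\<forall>x\<in>\<tau>. a \<cdot> x = 0) \<and> (\<forall>y\<in>Y. a \<cdot> y \<noteq> 0)"
  using assms
proof (induction Y rule: finite_induct)
  case empty
  show ?case by (rule exI[of _ 0]) simp
next
  case (insert y Y)
  then obtain a where a: "\<forall>x\<in>\<tau>. a \<cdot> x = 0" "\<forall>y\<in>Y. a \<cdot> y \<noteq> 0" by auto
  obtain b where b: "\<forall>x\<in>\<tau>. b \<cdot> x = 0" "b \<cdot> y = 1" using functional_separation[of y \<tau>] insert.prems by auto
  \<comment> \<open>Excluded are the zeros of a + t b on the given vectors. Where \<open>b\<close>
    vanishes the quotient is 0 by convention, which merely excludes one more value.\<close>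
  have "\<exists>t. t \<notin> (\<lambda>w. - (a \<cdot> w) / (b \<cdot> w)) ` insert y Y"
    by (rule ex_new_if_finite[OF infinite_UNIV_char_0]) (use insert.hyps(1) in simp)
  then obtain t where t: "\<And>w. w \<in> insert y Y \<Longrightarrow> t \<noteq> - (a \<cdot> w) / (b \<cdot> w)" by blast
  have "(a + t *s b) \<cdot> w \<noteq> 0" if w: "w \<in> insert y Y" for w
  proof (cases "b \<cdot> w = 0")
    case True
    then show ?thesis using w a(2) b(2) by auto
  next
    case False
    have "t * (b \<cdot> w) \<noteq> - (a \<cdot> w)" using t[OF w] False by (metis nonzero_mult_div_cancel_right)
    then show ?thesis by (simp add: eq_neg_iff_add_eq_0 add.commute)
  qed
  then show ?case using a(1) b(1) by (intro exI[of _ "a + t *s b"]) auto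
qed

text \<open>The points of two distinct covers differ modulo the span of \<tau>, so finitely many
  differences have to be avoided. The vertices of \<sigma>/\<tau> then have pairwise distinct
  heights.\<close>

lemma generic_functional:
  "\<exists>a. (\<forall>x\<in>\<tau>. a \<cdot> x = 0) \<and> inj_on (\<lambda>g. a \<cdot> pt g) (above 1 \<tau> \<sigma>)"
proof -
  let ?C = "above 1 \<tau> \<sigma>"
  define Y where "Y = (\<lambda>(g, g'). pt g - pt g') ` {(g, g'). g \<in> ?C \<and> g' \<in> ?C \<and> g \<noteq> g'}"
  have "finite {(g, g'). g \<in> ?C \<and> g' \<in> ?C \<and> g \<noteq> g'}"
    by (rule finite_subset[of _ "?C \<times> ?C"]) (auto simp: finite_above[OF fg])
  then have "finite Y" by (simp add: Y_def)
  moreover have "pt g - pt g' \<notin> vec.span \<tau>" if "g \<in> ?C" "g' \<in> ?C" "g \<noteq> g'" for g g'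
  proof
    assume "pt g - pt g' \<in> vec.span \<tau>"
    then have "pt g - pt g' \<in> vec.span g'" using vec.span_mono[OF aboveD(2)[OF that(2)]] by blast
    then have "pt g - pt g' + pt g' \<in> vec.span g'" using pt(1)[OF that(2)] vec.span_base vec.span_add by blast
    then have "pt g \<in> g'" using face_span[OF aboveD(1)[OF that(2)]] pt(1)[OF that(1)] aboveD(4)[OF that(1)] by auto
    then show False using cover_unique[OF that(1,2)] pt[OF that(1)] that(3) by blast
  qed
  then have "\<forall>y\<in>Y. y \<notin> vec.span \<tau>" by (auto simp: Y_def)
  ultimately obtain a where a: "\<forall>x\<in>\<tau>. a \<cdot> x = 0" "\<forall>y\<in>Y. a \<cdot> y \<noteq> 0"
    using nonvanishing_functional by blast
  have "inj_on (\<lambda>g. a \<cdot> pt g) ?C"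
  proof (rule inj_onI, rule ccontr)
    fix g g' assume g: "g \<in> ?C" "g' \<in> ?C" "a \<cdot> pt g = a \<cdot> pt g'" "g \<noteq> g'"
    then have "pt g - pt g' \<in> Y" by (auto simp: Y_def)
    then have "a \<cdot> (pt g - pt g') \<noteq> 0" using a(2) by blast
    then show False using g(3) by simp
  qed
  then show ?thesis using a(1) by blast
qed

end

text \<open>The two properties of incidence numbers on which the cochain calculus rests: they are
  units of square 1, and the two ways around a diamond have opposite signs. Orientations do not
  appear beyond this interface.\<close>

locale incidence_signs =
  fixes \<sigma> :: "('k::linordered_field ^ 'm) set" and inc :: "('k ^ 'm) set \<Rightarrow> ('k ^ 'm) set \<Rightarrow> 'k"
  assumes fg: "fg_cone \<sigma>"
    and inc_square: "cone_face e \<sigma> \<Longrightarrow> f \<in> above 1 e \<sigma> \<Longrightarrow> inc e f * inc e f = 1"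
    and inc_diamond: "cone_face e \<sigma> \<Longrightarrow> h \<in> above 2 e \<sigma> \<Longrightarrow> above 1 e h = {g, g'} \<Longrightarrow> g \<noteq> g' \<Longrightarrow>
      inc e g * inc g h = - (inc e g' * inc g' h)"
begin

text \<open>After exchanging the sums, each \<open>e\<close> is reached through exactly two faces
  \<open>g\<close>, whose contributions cancel by the diamond relation. The parameter \<tau> allows
  both the whole fan and the star of a ray.\<close>

lemma coboundary_coboundary:
  assumes "cone_face k \<sigma>" "vec.dim k = vec.dim \<tau> + j + 2"
  shows "(\<Sum>g\<in>above (j + 1) \<tau> k. inc g k * (\<Sum>e\<in>above j \<tau> g. inc e g * q e)) = 0"
proof -
  have fgk: "fg_cone k" using fg_cone_face[OF fg assms(1)] .
  have "(\<Sum>g\<in>above (j + 1) \<tau> k. inc g k * (\<Sum>e\<in>above j \<tau> g. inc e g * q e)) =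
    (\<Sum>g\<in>above (j + 1) \<tau> k. \<Sum>e\<in>{e\<in>above j \<tau> k. e \<subseteq> g}. inc e g * inc g k * q e)"
  proof (rule sum.cong[OF refl])
    fix g assume "g \<in> above (j + 1) \<tau> k"
    then have "above j \<tau> g = {e\<in>above j \<tau> k. e \<subseteq> g}" using above_face[OF fgk] aboveD(1) by blast
    then show "inc g k * (\<Sum>e\<in>above j \<tau> g. inc e g * q e) = (\<Sum>e\<in>{e\<in>above j \<tau> k. e \<subseteq> g}. inc e g * inc g k * q e)"
      by (simp add: sum_distrib_left algebra_simps)
  qed
  also have "\<dots> = (\<Sum>e\<in>above j \<tau> k. \<Sum>g\<in>{g\<in>above (j + 1) \<tau> k. e \<subseteq> g}. inc e g * inc g k * q e)"
    by (rule sum.swap_restrict) (simp_all add: finite_above[OF fgk])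
  also have "\<dots> = 0"
  proof (rule sum.neutral, rule ballI)
    fix e assume e: "e \<in> above j \<tau> k"
    have ek: "cone_face e k" and e\<sigma>: "cone_face e \<sigma>"
      using aboveD(1)[OF e] cone_face_trans[OF fg assms(1)] by auto
    have dim: "vec.dim k = vec.dim e + 2" using assms(2) aboveD(3)[OF e] by simp
    have eq: "{g\<in>above (j + 1) \<tau> k. e \<subseteq> g} = above 1 e k" using aboveD(2,3)[OF e] by (auto simp: above_def)
    have "e \<noteq> k" using dim by auto
    then obtain g1 where g1: "g1 \<in> above 1 e k" using cover_exists[OF fgk ek] by blast
    obtain g2 where g2: "g2 \<noteq> g1" "above 1 e k = {g1, g2}" using diamond[OF fgk ek dim g1] by blast
    have "k \<in> above 2 e \<sigma>" using aboveI[OF assms(1) cone_face_subset[OF ek] dim] .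
    then have "inc e g1 * inc g1 k = - (inc e g2 * inc g2 k)" using inc_diamond[OF e\<sigma> _ g2(2) g2(1)[symmetric]] by blast
    then show "(\<Sum>g\<in>{g\<in>above (j + 1) \<tau> k. e \<subseteq> g}. inc e g * inc g k * q e) = 0"
      unfolding eq g2(2) using g2(1) by simp
  qed
  finally show ?thesis .
qed

text \<open>The potential \<open>p\<close> is built by adding the covers \<open>w\<close> of \<open>\<tau>\<close> in the order given by a generic
  functional. The edges that go down from \<open>w\<close> all prescribe the same value at \<open>w\<close>: they form a
  connected graph in the link of \<open>w\<close>, and two adjacent ones lie in a 2-face around which \<open>z\<close> is closed.\<close>

lemma potential_exists:
  assumes \<tau>: "cone_face \<tau> \<sigma>"
    and closed: "\<And>k. k \<in> above 3 \<tau> \<sigma> \<Longrightarrow> (\<Sum>f\<in>above 2 \<tau> k. inc f k * z f) = 0"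
  shows "\<exists>p. \<forall>f\<in>above 2 \<tau> \<sigma>. z f = (\<Sum>e\<in>above 1 \<tau> f. inc e f * p e)"
proof -
  obtain l where "link \<sigma> \<tau> l" using link_exists[OF fg \<tau>] by blast
  then interpret link \<sigma> \<tau> l .
  obtain a where a: "\<forall>x\<in>\<tau>. a \<cdot> x = 0" "inj_on (\<lambda>g. a \<cdot> pt g) (above 1 \<tau> \<sigma>)"
    using generic_functional by blast
  define ht where "ht g = a \<cdot> pt g" for g
  have up1: "above 1 \<tau> f \<subseteq> above 1 \<tau> \<sigma>" if "f \<in> above j \<tau> \<sigma>" for f j
    using above_face_mono[OF fg aboveD(1)[OF that]] .
  \<comment> \<open>\<open>W\<close> runs through lower sets for the height, and only edges with
    both ends in \<open>W\<close> are considered; a new vertex \<open>w\<close> thus adds just the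
    edges going down from it.\<close>
  have "finite W \<Longrightarrow> W \<subseteq> above 1 \<tau> \<sigma> \<Longrightarrow> (\<forall>u\<in>above 1 \<tau> \<sigma>. \<forall>w\<in>W. ht u < ht w \<longrightarrow> u \<in> W) \<Longrightarrow>
    \<exists>p. \<forall>f\<in>above 2 \<tau> \<sigma>. above 1 \<tau> f \<subseteq> W \<longrightarrow> z f = (\<Sum>e\<in>above 1 \<tau> f. inc e f * p e)" for W
  proof (induction W rule: finite_ranking_induct[where f = ht])
    case empty
    have "above 1 \<tau> f \<noteq> {}" if "f \<in> above 2 \<tau> \<sigma>" for f
    proof (rule cover_exists[OF fg_cone_face[OF fg aboveD(1)[OF that]]])
      show "cone_face \<tau> f" using cone_face_sub[OF \<tau> aboveD(2,4)[OF that]] .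
      show "\<tau> \<noteq> f" using aboveD(3)[OF that] by auto
    qed
    then show ?case by auto
  next
    case (insert w W)
    show ?case
    proof (cases "w \<in> W")
      case True
      then have "insert w W = W" by blast
      then show ?thesis using insert.IH insert.prems by simp
    next
      case False
      have w: "w \<in> above 1 \<tau> \<sigma>" using insert.prems(1) by blast
      note w' = aboveD[OF w]
      have W: "u \<in> W" if "u \<in> above 1 \<tau> \<sigma>" "ht u < ht w" for u using insert.prems(2) that by blast
      have Wht: "ht u < ht w" if "u \<in> W" for u
      proof -
        have "u \<in> above 1 \<tau> \<sigma>" "u \<noteq> w" using that insert.prems(1) False by auto
        then have "ht u \<noteq> ht w" using inj_onD[OF a(2) _ _ w] unfolding ht_def by blast
        then show ?thesis using insert.hyps(2)[OF that] by simp
      qed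
      have "\<forall>u\<in>above 1 \<tau> \<sigma>. \<forall>v\<in>W. ht u < ht v \<longrightarrow> u \<in> W"
      proof (intro ballI impI)
        fix u v assume u: "u \<in> above 1 \<tau> \<sigma>" "v \<in> W" "ht u < ht v"
        have "ht u < ht w" using u(3) Wht[OF u(2)] by simp
        then show "u \<in> W" using W u by blast
      qed
      then obtain p where p: "\<And>f. f \<in> above 2 \<tau> \<sigma> \<Longrightarrow> above 1 \<tau> f \<subseteq> W \<Longrightarrow> z f = (\<Sum>e\<in>above 1 \<tau> f. inc e f * p e)"
        using insert.IH insert.prems(1) by blast
      \<comment> \<open>With the value 0 at \<open>w\<close>, the defect \<open>d f\<close> on an
        edge going down from \<open>w\<close> is what the value at \<open>w\<close>, times
        \<open>inc w f\<close>, still has to supply.\<close>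
      define p0 where "p0 e = (if e = w then 0 else p e)" for e
      have p0: "(\<Sum>e\<in>above 1 \<tau> f. inc e f * p0 e) = z f" if "f \<in> above 2 \<tau> \<sigma>" "above 1 \<tau> f \<subseteq> W" for f
      proof -
        have "(\<Sum>e\<in>above 1 \<tau> f. inc e f * p0 e) = (\<Sum>e\<in>above 1 \<tau> f. inc e f * p e)"
          using that False by (intro sum.cong) (auto simp: p0_def)
        then show ?thesis using p[OF that] by simp
      qed
      define d where "d f = z f - (\<Sum>e\<in>above 1 \<tau> f. inc e f * p0 e)" for f
      obtain l' where "link \<sigma> w l'" using link_exists[OF fg w'(1)] by blast
      then interpret w: link \<sigma> w l' .
      \<comment> \<open>It vanishes on \<open>w\<close> and measures heights relative to
        \<open>w\<close>; in the link of \<open>w\<close> it is negative at the edges that go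
        down.\<close>
      define b where "b = a - ht w *s l"
      have b0: "\<forall>x\<in>w. b \<cdot> x = 0" using sp_cover[OF w a(1)] vec.span_base by (auto simp: b_def ht_def)
      have b_pt: "b \<cdot> pt u = ht u - ht w" if "u \<in> above 1 \<tau> \<sigma>" for u using pt(2)[OF that] by (simp add: b_def ht_def)
      \<comment> \<open>If all edges of \<open>k\<close> at \<open>w\<close> go down, then
        \<open>w\<close> is the highest vertex of \<open>k\<close>: a higher vertex would, by
        \<open>negative_cover\<close> for \<open>- b\<close>, produce an edge of \<open>k\<close> at
        \<open>w\<close> going up.\<close>
      have lower: "ht u < ht w" if u: "u \<in> above 1 \<tau> k" "u \<noteq> w" and k: "k \<in> above 3 \<tau> \<sigma>" "w \<subseteq> k"
        and neg: "\<And>f. f \<in> above 1 w k \<Longrightarrow> b \<cdot> w.pt f < 0" for u k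
      proof (rule ccontr)
        assume nl: "\<not> ht u < ht w"
        have u\<sigma>: "u \<in> above 1 \<tau> \<sigma>" using u(1) up1[OF k(1)] by blast
        have "ht u \<noteq> ht w" using inj_onD[OF a(2) _ u\<sigma> w] u(2) by (auto simp: ht_def)
        then have "(- b) \<cdot> pt u < 0" using nl b_pt[OF u\<sigma>] by simp
        moreover have "pt u \<in> k" using pt(1)[OF u\<sigma>] aboveD(4)[OF u(1)] by blast
        moreover have "\<forall>x\<in>w. (- b) \<cdot> x = 0" using b0 by simp
        ultimately obtain f where f: "f \<in> above 1 w k" "\<forall>y\<in>f. y \<notin> w \<longrightarrow> (- b) \<cdot> y < 0"
          using link.negative_cover[OF w.link_face[OF aboveD(1)[OF k(1)] k(2)]] by blast
        have "f \<in> above 1 w \<sigma>" using f(1) above_face_mono[OF fg aboveD(1)[OF k(1)]] by blast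
        then have "(- b) \<cdot> w.pt f < 0" using f(2) w.pt by blast
        then show False using neg[OF f(1)] by simp
      qed
      have const: "inc w f1 * d f1 = inc w f2 * d f2"
        if f12: "f1 \<in> above 1 w \<sigma>" "f2 \<in> above 1 w \<sigma>" "b \<cdot> w.pt f1 < 0" "b \<cdot> w.pt f2 < 0" for f1 f2
      proof (rule w.negative_covers_connected[OF b0 _ f12])
        fix k f f'
        assume k: "k \<in> above 2 w \<sigma>" and f: "f \<in> above 1 w k" "f' \<in> above 1 w k" and neg: "b \<cdot> w.pt f < 0" "b \<cdot> w.pt f' < 0"
        show "inc w f * d f = inc w f' * d f'"
        proof (cases "f = f'")
          case ff: False
          have wk: "above 1 w k = {f, f'}" using w.above2_cases[OF k f(1)] f(2) ff by blast
          have k3: "k \<in> above 3 \<tau> \<sigma>" using above_trans[OF w k] by (simp add: numeral_3_eq_3)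
          have fgk: "fg_cone k" using fg_cone_face[OF fg aboveD(1)[OF k]] .
          have wk1: "w \<in> above 1 \<tau> k" using w aboveD(2)[OF k] above_face[OF fg aboveD(1)[OF k]] by blast
          have low: "u \<in> W" if "u \<in> above 1 \<tau> k" "u \<noteq> w" for u
          proof -
            have "b \<cdot> w.pt g < 0" if "g \<in> above 1 w k" for g using that neg unfolding wk by blast
            then have "ht u < ht w" using lower[OF that k3 aboveD(2)[OF k]] by blast
            then show ?thesis using W up1[OF k3] that(1) by blast
          qed
          have ffk: "f \<in> above 2 \<tau> k" "f' \<in> above 2 \<tau> k"
            using above_trans[OF wk1 f(1)] above_trans[OF wk1 f(2)] by (simp_all add: numeral_2_eq_2)
          \<comment> \<open>Around \<open>k\<close> the defects sum to zero, since \<open>z\<close>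
            is closed and \<open>p0\<close> contributes a coboundary of a coboundary. Edges other
            than \<open>f\<close> and \<open>f'\<close> avoid \<open>w\<close> and have no
            defect.\<close>
          have "(\<Sum>g\<in>above 2 \<tau> k. inc g k * d g) =
            (\<Sum>g\<in>above 2 \<tau> k. inc g k * z g) - (\<Sum>g\<in>above (1 + 1) \<tau> k. inc g k * (\<Sum>e\<in>above 1 \<tau> g. inc e g * p0 e))"
            by (simp add: d_def right_diff_distrib sum_subtractf numeral_2_eq_2)
          also have "\<dots> = 0"
            using closed[OF k3] coboundary_coboundary[OF aboveD(1)[OF k3], of \<tau> 1 p0] aboveD(3)[OF k3] by simp
          finally have "0 = (\<Sum>g\<in>above 2 \<tau> k. inc g k * d g)" by simp
          also have "\<dots> = (\<Sum>g\<in>{f, f'}. inc g k * d g)"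
          proof (rule sum.mono_neutral_right)
            show "finite (above 2 \<tau> k)" using finite_above[OF fgk] .
            show "\<forall>g\<in>above 2 \<tau> k - {f, f'}. inc g k * d g = 0"
            proof
              fix g assume g: "g \<in> above 2 \<tau> k - {f, f'}"
              have g\<sigma>: "g \<in> above 2 \<tau> \<sigma>" using g above_face_mono[OF fg aboveD(1)[OF k]] by blast
              have gk: "above 1 \<tau> g \<subseteq> above 1 \<tau> k" using above_face_mono[OF fgk aboveD(1)] g by blast
              have "w \<notin> above 1 \<tau> g"
              proof
                assume "w \<in> above 1 \<tau> g"
                then have "w \<subseteq> g" by (rule aboveD(4))
                then have "g \<in> above 1 w k" using g aboveD(3)[OF w] by (auto simp: above_def)
                then show False using wk g by blast
              qed
              then have "above 1 \<tau> g \<subseteq> W" using gk low by blast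
              then show "inc g k * d g = 0" using p0[OF g\<sigma>] by (simp add: d_def)
            qed
          qed (use ffk in auto)
          finally have e1: "inc f k * d f = - (inc f' k * d f')" using ff by (simp add: eq_neg_iff_add_eq_0)
          have e2: "inc w f * inc f k = - (inc w f' * inc f' k)" using inc_diamond[OF w'(1) k wk ff] .
          have sq: "inc g k * inc g k = 1" if "g \<in> {f, f'}" for g
          proof (rule inc_square)
            have g: "g \<in> above 1 w k" using that f by blast
            show "cone_face g \<sigma>" using g aboveD(1) cone_face_trans[OF fg aboveD(1)[OF k]] by blast
            show "k \<in> above 1 g \<sigma>" using aboveI[OF aboveD(1)[OF k] aboveD(4)[OF g]] aboveD(3)[OF k] aboveD(3)[OF g] by simp
          qed
          have "inc w f * d f = (inc w f * inc f k) * (inc f k * d f)" using sq[of f] by (simp add: algebra_simps)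
          also have "\<dots> = (inc w f' * inc f' k) * (inc f' k * d f')" unfolding e1 e2 by simp
          also have "\<dots> = inc w f' * d f'" using sq[of f'] by (simp add: algebra_simps)
          finally show ?thesis .
        qed simp
      qed
      define L where "L = {f\<in>above 1 w \<sigma>. b \<cdot> w.pt f < 0}"
      \<comment> \<open>A vertex from which no edge goes down is unconstrained and gets the value
        0.\<close>
      define x where "x = (if L = {} then 0 else inc w (SOME f. f \<in> L) * d (SOME f. f \<in> L))"
      have x: "inc w f * d f = x" if "f \<in> L" for f
      proof -
        have "(SOME f. f \<in> L) \<in> L" using someI[of "\<lambda>f. f \<in> L"] that by blast
        then show ?thesis using const that by (auto simp: x_def L_def)
      qed
      have "z f = (\<Sum>e\<in>above 1 \<tau> f. inc e f * (p0(w := x)) e)" if f: "f \<in> above 2 \<tau> \<sigma>" "above 1 \<tau> f \<subseteq> insert w W" for f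
      proof (cases "w \<in> above 1 \<tau> f")
        case wf: True
        obtain u where u: "u \<noteq> w" "above 1 \<tau> f = {w, u}" using above2_cases[OF f(1) wf] by blast
        have uW: "u \<in> W" using f(2) u by blast
        have uf: "u \<in> above 1 \<tau> f" using u by blast
        have u\<sigma>: "u \<in> above 1 \<tau> \<sigma>" using uf up1[OF f(1)] by blast
        have fw: "f \<in> above 1 w \<sigma>" using f(1) aboveD(3,4)[OF wf] by (auto simp: above_def)
        have "pt u \<in> f" using pt(1)[OF u\<sigma>] aboveD(4)[OF uf] by blast
        then have "b \<cdot> pt u = (b \<cdot> w.pt f) * (l' \<cdot> pt u)" using w.sp_cover[OF fw b0] vec.span_base by blast
        moreover have "b \<cdot> pt u < 0" using b_pt[OF u\<sigma>] Wht[OF uW] by simp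
        moreover have "0 \<le> l' \<cdot> pt u" using w.l_nonneg pt(1)[OF u\<sigma>] aboveD(4)[OF u\<sigma>] by blast
        ultimately have "b \<cdot> w.pt f < 0" by (simp add: mult_less_0_iff)
        then have "f \<in> L" using fw by (simp add: L_def)
        then have "inc w f * x = (inc w f * inc w f) * d f" using x[of f] by (simp add: algebra_simps)
        also have "\<dots> = d f" using inc_square[OF w'(1) fw] by simp
        finally show ?thesis unfolding u(2) d_def using u(1) by (simp add: p0_def u(2))
      next
        case wf: False
        have fW: "above 1 \<tau> f \<subseteq> W" using f(2) wf by blast
        have "(\<Sum>e\<in>above 1 \<tau> f. inc e f * (p0(w := x)) e) = (\<Sum>e\<in>above 1 \<tau> f. inc e f * p0 e)"
          using wf by (intro sum.cong) auto
        then show ?thesis using p0[OF f(1) fW] by simp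
      qed
      then show ?thesis by blast
    qed
  qed
  from this[of "above 1 \<tau> \<sigma>"] show ?thesis using finite_above[OF fg] up1 by blast
qed

end

section \<open>Incidence signs\<close>

lemma det_nat_eq_det:
  "det_nat d A = Determinant.det (Matrix.mat d d (\<lambda>(i, j). A i j))"
  by (auto simp: det_nat_def Determinant.det_def lessThan_atLeast0 permutes_in_image intro!: sum.cong prod.cong)

lemma det_nat_cong:
  assumes "\<And>i j. i < d \<Longrightarrow> j < d \<Longrightarrow> A i j = A' i j"
  shows "det_nat d A = det_nat d A'"
  unfolding det_nat_eq_det by (rule arg_cong[where f = Determinant.det]) (auto simp: assms)

lemma det_nat_mult:
  "det_nat d (\<lambda>i j. \<Sum>k<d. A i k * M k j) = det_nat d A * det_nat d M"
proof -
  let ?A = "Matrix.mat d d (\<lambda>(i, j). A i j)" and ?M = "Matrix.mat d d (\<lambda>(i, j). M i j)"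
  have "Matrix.mat d d (\<lambda>(i, j). \<Sum>k<d. A i k * M k j) = ?A * ?M"
    by (rule eq_matI) (auto simp: Matrix.scalar_prod_def lessThan_atLeast0)
  then show ?thesis using Determinant.det_mult[of ?A d ?M] by (simp add: det_nat_eq_det)
qed

lemma det_nat_id: "det_nat d (\<lambda>i j. if i = j then 1 else 0) = (1 :: 'a::comm_ring_1)"
proof -
  have "Matrix.mat d d (\<lambda>(i, j). if i = j then 1 else 0) = (1\<^sub>m d :: 'a mat)" by (rule eq_matI) auto
  then show ?thesis by (simp only: det_nat_eq_det det_one)
qed

text \<open>This matrix arises when an outward vector is replaced by a multiple of it plus a vector
  in the span of the facet.\<close>

lemma det_nat_first_column:
  assumes "\<And>i j. i < Suc d \<Longrightarrow> j < Suc d \<Longrightarrow> 0 < j \<Longrightarrow> M i j = (if i = j then 1 else 0)"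
  shows "det_nat (Suc d) M = M 0 0"
proof -
  let ?M = "Matrix.mat (Suc d) (Suc d) (\<lambda>(i, j). M i j)"
  have "Determinant.det ?M = prod_list (diag_mat ?M)"
    by (rule det_lower_triangular[of "Suc d"]) (use assms in auto)
  also have "\<dots> = (\<Prod>i=0..<Suc d. M i i)" by (simp add: prod_list_diag_prod)
  also have "\<dots> = M 0 0 * (\<Prod>i=1..<Suc d. M i i)" by (subst prod.atLeast_Suc_lessThan) auto
  also have "(\<Prod>i=1..<Suc d. M i i) = 1" using assms by (intro prod.neutral) auto
  finally show ?thesis by (simp add: det_nat_eq_det)
qed

text \<open>This matrix arises when a new first vector is kept and only the basis behind it is
  changed.\<close>

lemma det_nat_block:
  fixes N :: "nat \<Rightarrow> nat \<Rightarrow> 'a :: idom"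
  shows "det_nat (Suc d) (\<lambda>i j. case i of 0 \<Rightarrow> (if j = 0 then 1 else 0)
    | Suc i' \<Rightarrow> (case j of 0 \<Rightarrow> 0 | Suc j' \<Rightarrow> N i' j')) = det_nat d N"
proof -
  let ?N = "Matrix.mat d d (\<lambda>(i, j). N i j)"
  let ?M = "Matrix.mat (Suc d) (Suc d) (\<lambda>(i, j). case i of 0 \<Rightarrow> (if j = 0 then 1 else 0)
    | Suc i' \<Rightarrow> (case j of 0 \<Rightarrow> 0 | Suc j' \<Rightarrow> N i' j'))"
  have "?M = four_block_mat (1\<^sub>m 1) (0\<^sub>m 1 d) (0\<^sub>m d 1) ?N"
    by (rule eq_matI) (auto split: nat.splits)
  also have "Determinant.det \<dots> = Determinant.det (1\<^sub>m 1 :: 'a mat) * Determinant.det ?N"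
    by (rule det_four_block_mat_lower_left_zero[of _ 1 _ d]) auto
  finally show ?thesis by (simp add: det_nat_eq_det)
qed

lemma det_nat_swap:
  assumes "\<And>i. i < Suc (Suc d) \<Longrightarrow> A' i 0 = A i 1" "\<And>i. i < Suc (Suc d) \<Longrightarrow> A' i 1 = A i 0"
    and "\<And>i j. i < Suc (Suc d) \<Longrightarrow> j < d \<Longrightarrow> A' i (Suc (Suc j)) = A i (Suc (Suc j))"
  shows "det_nat (Suc (Suc d)) A' = - det_nat (Suc (Suc d)) A"
proof -
  let ?n = "Suc (Suc d)"
  let ?A = "Matrix.mat ?n ?n (\<lambda>(i, j). A i j)"
  have "A' i j = A i (if j = 0 then 1 else if j = 1 then 0 else j)" if "i < ?n" "j < ?n" for i j
    using assms(1,2)[OF that(1)] assms(3)[OF that(1), of "j - 2"] that(2) by (cases j; cases "j - 1") auto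
  then have "Matrix.mat ?n ?n (\<lambda>(i, j). A' i j) = swapcols 0 1 ?A"
    by (intro eq_matI) (auto simp: mat_swapcols_def)
  then show ?thesis using det_swapcols[of 0 ?n 1 ?A] by (simp add: det_nat_eq_det)
qed

section \<open>Coordinates and volumes relative to an ordered basis\<close>

definition dual_list :: "(nat \<Rightarrow> 'k::linordered_field ^ 'm) \<Rightarrow> ('k ^ 'm) list \<Rightarrow> bool" where
  "dual_list \<beta> B \<longleftrightarrow> (\<forall>i<length B. \<forall>j<length B. \<beta> i \<cdot> B ! j = (if i = j then 1 else 0))"

text \<open>For \<beta> dual to a basis B this is the determinant of the coordinates of
  \<open>C\<close> relative to B. It makes the matrix explicit whose existence
  \<open>same_orientation\<close> asserts.\<close>

definition vol :: "(nat \<Rightarrow> 'k::linordered_field ^ 'm) \<Rightarrow> ('k ^ 'm) list \<Rightarrow> 'k" where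
  "vol \<beta> C = det_nat (length C) (\<lambda>i j. \<beta> i \<cdot> C ! j)"

text \<open>The value at 0 is - 1, as in the second case of \<open>incidence\<close>; this is why
  multiplicativity is restricted to non-zero arguments.\<close>

definition pm :: "'k::linordered_field \<Rightarrow> 'k" where
  "pm x = (if 0 < x then 1 else - 1)"

lemma pm_mult: "x \<noteq> 0 \<Longrightarrow> y \<noteq> 0 \<Longrightarrow> pm (x * y) = pm x * pm y"
  by (auto simp: pm_def zero_less_mult_iff)

lemma pm_minus: "x \<noteq> 0 \<Longrightarrow> pm (- x) = - pm x"
  by (auto simp: pm_def)

lemma dual_list_exists:
  assumes "distinct B" "vec.independent (set B)"
  shows "\<exists>\<beta>. dual_list \<beta> B"
proof -
  have "\<exists>a. \<forall>x\<in>set B. a \<cdot> x = (if x = B ! i then 1 else 0)" for i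
    using functional_extend[OF assms(2)] .
  then obtain \<beta> where "\<And>i. \<forall>x\<in>set B. \<beta> i \<cdot> x = (if x = B ! i then 1 else 0)" by metis
  then have "dual_list \<beta> B" using assms(1) by (auto simp: dual_list_def nth_eq_iff_index_eq)
  then show ?thesis by blast
qed

lemma dual_list_sum:
  assumes "dual_list \<beta> B" "i < length B"
  shows "\<beta> i \<cdot> (\<Sum>k<length B. c k *s B ! k) = c i"
proof -
  have "\<beta> i \<cdot> (\<Sum>k<length B. c k *s B ! k) = (\<Sum>k<length B. if k = i then c k else 0)"
    unfolding sp_sum using assms by (intro sum.cong) (auto simp: dual_list_def)
  then show ?thesis using assms(2) by simp
qed

lemma span_list_expand:
  assumes "x \<in> vec.span (set L)"
  shows "\<exists>c. x = (\<Sum>i<length L. c i *s L ! i)"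
  using assms
proof (induction rule: vec.span_induct_alt)
  case base
  show ?case by (rule exI[of _ "\<lambda>_. 0"]) simp
next
  case (step c x y)
  then obtain b k where b: "y = (\<Sum>i<length L. b i *s L ! i)" and k: "k < length L" "x = L ! k"
    by (auto simp: in_set_conv_nth)
  have "(\<Sum>i<length L. (b i + (if i = k then c else 0)) *s L ! i) =
      y + (\<Sum>i<length L. (if i = k then c else 0) *s L ! i)"
    by (simp add: b vec.scale_left_distrib sum.distrib)
  also have "(\<Sum>i<length L. (if i = k then c else 0) *s L ! i) = (\<Sum>i<length L. if i = k then c *s L ! i else 0)"
    by (rule sum.cong) auto
  also have "y + \<dots> = c *s x + y" using k by simp
  finally show ?case by metis
qed

lemma dual_list_expand:
  assumes "dual_list \<beta> B" "x \<in> vec.span (set B)"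
  shows "x = (\<Sum>i<length B. (\<beta> i \<cdot> x) *s B ! i)"
proof -
  obtain c where c: "x = (\<Sum>i<length B. c i *s B ! i)" using span_list_expand[OF assms(2)] by blast
  have "\<beta> i \<cdot> x = c i" if "i < length B" for i using dual_list_sum[OF assms(1) that] c by simp
  then show ?thesis by (subst c) (auto intro!: sum.cong)
qed

lemma same_orientation_iff:
  assumes "dual_list \<beta> B" "length C = length B" "set C \<subseteq> vec.span (set B)"
  shows "same_orientation B C \<longleftrightarrow> 0 < vol \<beta> C"
proof
  assume "same_orientation B C"
  then obtain A where A: "\<And>j. j < length C \<Longrightarrow> C ! j = (\<Sum>i<length B. A i j *s B ! i)" "0 < det_nat (length B) A"
    by (auto simp: same_orientation_def)
  have "det_nat (length B) A = vol \<beta> C"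
    unfolding vol_def assms(2) using A(1) dual_list_sum[OF assms(1)] assms(2) by (intro det_nat_cong) auto
  then show "0 < vol \<beta> C" using A(2) by simp
next
  assume v: "0 < vol \<beta> C"
  have "C ! j = (\<Sum>i<length B. (\<beta> i \<cdot> C ! j) *s B ! i)" if "j < length C" for j
    using that assms(3) by (intro dual_list_expand[OF assms(1)]) auto
  then show "same_orientation B C" using v assms(2)
    by (auto simp: same_orientation_def vol_def intro!: exI[of _ "\<lambda>i j. \<beta> i \<cdot> C ! j"])
qed

lemma vol_transform:
  assumes "length C' = length C" "\<And>j. j < length C \<Longrightarrow> C' ! j = (\<Sum>k<length C. M k j *s C ! k)"
  shows "vol \<beta> C' = vol \<beta> C * det_nat (length C) M"
  unfolding vol_def assms(1) det_nat_mult[symmetric]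
  by (rule det_nat_cong) (simp add: assms(2) sp_sum mult.commute)

text \<open>Expressing B through \<open>C\<close> exhibits an inverse: the volume of
  \<open>C\<close> times the determinant of that matrix is the volume of B, which is 1.\<close>

lemma vol_nonzero:
  assumes "dual_list \<beta> B" "length C = length B" "set B \<subseteq> vec.span (set C)"
  shows "vol \<beta> C \<noteq> 0"
proof -
  have "\<exists>c. B ! j = (\<Sum>k<length C. c k *s C ! k)" if "j < length C" for j
    using that assms(2,3) by (intro span_list_expand) auto
  then obtain M where M: "\<And>j. j < length C \<Longrightarrow> B ! j = (\<Sum>k<length C. M j k *s C ! k)" by metis
  have "vol \<beta> B = vol \<beta> C * det_nat (length C) (\<lambda>k j. M j k)"
    by (rule vol_transform) (use assms(2) M in auto)
  moreover have "vol \<beta> B = 1"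
  proof -
    have "vol \<beta> B = det_nat (length B) (\<lambda>i j. if i = j then 1 else 0)"
      unfolding vol_def using assms(1) by (intro det_nat_cong) (auto simp: dual_list_def)
    then show ?thesis by (simp add: det_nat_id)
  qed
  ultimately show ?thesis by auto
qed

section \<open>Incidence numbers as signs of volumes\<close>

lemma length_ordered_basis:
  assumes "ordered_basis B \<sigma>" shows "length B = vec.dim \<sigma>"
proof -
  have "length B = card (set B)" using assms by (simp add: ordered_basis_def distinct_card)
  also have "\<dots> = vec.dim (set B)" using assms by (simp add: ordered_basis_def vec.dim_eq_card_independent)
  also have "\<dots> = vec.dim \<sigma>" using assms by (metis ordered_basis_def vec.dim_span)
  finally show ?thesis .
qed

text \<open>Independence of the outward vector. Two admissible vectors differ by a positive factor t
  modulo the span of \<tau>, as a functional exposing \<tau> is positive on both of their negatives;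
  hence the volumes differ by the factor t and have equal signs.\<close>

lemma incidence_eq:
  fixes ori :: "('k::linordered_field ^ 'm) set \<Rightarrow> ('k ^ 'm) list"
  assumes \<tau>: "cone_face \<tau> g" "vec.dim g = vec.dim \<tau> + 1"
    and ori: "ordered_basis (ori \<tau>) \<tau>" "ordered_basis (ori g) g"
    and \<beta>: "dual_list \<beta> (ori g)" and w: "- w \<in> g - \<tau>"
  shows "incidence ori \<tau> g = pm (vol \<beta> (w # ori \<tau>))" "vol \<beta> (w # ori \<tau>) \<noteq> 0"
proof -
  have len: "length (ori g) = Suc (length (ori \<tau>))" using length_ordered_basis[OF ori(1)] length_ordered_basis[OF ori(2)] \<tau>(2) by simp
  have sp\<tau>: "vec.span (set (ori \<tau>)) = vec.span \<tau>" and spg: "vec.span (set (ori g)) = vec.span g"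
    using ori by (auto simp: ordered_basis_def)
  have \<tau>g: "vec.span \<tau> \<subseteq> vec.span g" using \<tau>(1) cone_face_subset vec.span_mono by blast
  have neg: "v \<in> vec.span g" if "- v \<in> g - \<tau>" for v
    using that vec.span_neg[OF vec.span_base, of "- v" g] by simp
  have set_w: "set (v # ori \<tau>) \<subseteq> vec.span (set (ori g))" if "- v \<in> g - \<tau>" for v
    using neg[OF that] \<tau>g spg sp\<tau> vec.span_base[of _ "set (ori \<tau>)"] by auto
  have span_w: "vec.span g = vec.span (insert w \<tau>)"
  proof -
    have "vec.span g = vec.span (insert (- w) \<tau>)" using span_insert_face[OF \<tau>] w by blast
    moreover have "- w \<in> vec.span (insert w \<tau>)" "w \<in> vec.span (insert (- w) \<tau>)"
      using vec.span_neg[OF vec.span_base, of w "insert w \<tau>"] vec.span_neg[OF vec.span_base, of "- w" "insert (- w) \<tau>"] by auto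
    then have "vec.span (insert (- w) \<tau>) = vec.span (insert w \<tau>)"
      unfolding vec.span_eq using vec.span_base[of _ "insert w \<tau>"] vec.span_base[of _ "insert (- w) \<tau>"] by auto
    ultimately show ?thesis by simp
  qed
  have "vec.span (set (w # ori \<tau>)) = vec.span g"
    unfolding span_w using sp\<tau> by (simp add: vec.span_insert)
  then have "set (ori g) \<subseteq> vec.span (set (w # ori \<tau>))" using spg vec.span_base by blast
  then show nz: "vol \<beta> (w # ori \<tau>) \<noteq> 0" using vol_nonzero[OF \<beta>] len by simp
  obtain a where a: "\<And>x. x \<in> g \<Longrightarrow> 0 \<le> a \<cdot> x" "\<tau> = {x\<in>g. a \<cdot> x = 0}" using \<tau>(1) by (auto simp: cone_face_def)
  have pos: "0 < vol \<beta> (w # ori \<tau>)" if w': "- w' \<in> g - \<tau>" and p: "0 < vol \<beta> (w' # ori \<tau>)" for w'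
  proof -
    obtain t where t: "w' - t *s w \<in> vec.span \<tau>"
      using neg[OF w'] span_w vec.span_breakdown_eq by blast
    have "a \<cdot> (w' - t *s w) = 0" using sp_zero_span[OF _ t] a(2) by auto
    then have "a \<cdot> (- w') = t * (a \<cdot> (- w))" by simp
    moreover have "0 < a \<cdot> (- w')" "0 < a \<cdot> (- w)" using a(1)[of "- w'"] a(1)[of "- w"] a(2) w w' by (auto simp: order_less_le)
    ultimately have "0 < t" by (metis order_less_asym zero_less_mult_pos2)
    obtain c where c: "w' - t *s w = (\<Sum>i<length (ori \<tau>). c i *s ori \<tau> ! i)"
      using span_list_expand[of "w' - t *s w" "ori \<tau>"] t sp\<tau> by blast
    \<comment> \<open>The first column holds the coordinates of \<open>w'\<close> relative to
      \<open>w\<close> and the basis of \<tau>; the remaining columns are those of the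
      identity.\<close>
    define M where "M i j = (if j = 0 then (case i of 0 \<Rightarrow> t | Suc i' \<Rightarrow> c i') else if i = j then 1 else 0)" for i j :: nat
    have "vol \<beta> (w' # ori \<tau>) = vol \<beta> (w # ori \<tau>) * det_nat (length (w # ori \<tau>)) M"
    proof (rule vol_transform)
      fix j assume j: "j < length (w # ori \<tau>)"
      show "(w' # ori \<tau>) ! j = (\<Sum>k<length (w # ori \<tau>). M k j *s (w # ori \<tau>) ! k)"
      proof (cases j)
        case 0
        have "w' = t *s w + (\<Sum>i<length (ori \<tau>). c i *s ori \<tau> ! i)" unfolding c[symmetric] by simp
        then show ?thesis by (simp add: 0 M_def sum.lessThan_Suc_shift del: sum.lessThan_Suc)
      next
        case (Suc j')
        have "(\<Sum>k<length (w # ori \<tau>). M k j *s (w # ori \<tau>) ! k) =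
          (\<Sum>k<length (w # ori \<tau>). if k = j then (w # ori \<tau>) ! k else 0)"
          by (rule sum.cong) (auto simp: M_def Suc)
        then show ?thesis using j Suc by simp
      qed
    qed simp
    moreover have "det_nat (length (w # ori \<tau>)) M = t"
      using det_nat_first_column[of "length (ori \<tau>)" M] by (simp add: M_def)
    ultimately show ?thesis using p \<open>0 < t\<close> by (simp add: zero_less_mult_iff)
  qed
  have "(\<exists>w. - w \<in> g - \<tau> \<and> same_orientation (ori g) (w # ori \<tau>)) \<longleftrightarrow> 0 < vol \<beta> (w # ori \<tau>)"
    using same_orientation_iff[OF \<beta> _ set_w] len pos w by auto
  then show "incidence ori \<tau> g = pm (vol \<beta> (w # ori \<tau>))" by (simp add: incidence_def pm_def)
qed

text \<open>Replacing the basis of \<open>g\<close> by \<open>w\<close> followed by the basis of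
  \<tau> is a block change of basis behind \<open>v\<close>, so the two volumes multiply. The
  product of incidences becomes the orientation of one list, which can be compared along different
  paths.\<close>

lemma incidence_composite:
  fixes ori :: "('k::linordered_field ^ 'm) set \<Rightarrow> ('k ^ 'm) list"
  assumes \<tau>: "cone_face \<tau> g" "vec.dim g = vec.dim \<tau> + 1" and g: "cone_face g h" "vec.dim h = vec.dim g + 1"
    and ori: "ordered_basis (ori \<tau>) \<tau>" "ordered_basis (ori g) g" "ordered_basis (ori h) h"
    and \<beta>: "dual_list \<beta> (ori h)" and w: "- w \<in> g - \<tau>" and v: "- v \<in> h - g"
  shows "incidence ori \<tau> g * incidence ori g h = pm (vol \<beta> (v # w # ori \<tau>))" "vol \<beta> (v # w # ori \<tau>) \<noteq> 0"
proof -
  obtain \<gamma> where \<gamma>: "dual_list \<gamma> (ori g)" using dual_list_exists ori(2) by (auto simp: ordered_basis_def)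
  note 1 = incidence_eq[OF \<tau> ori(1,2) \<gamma> w] and 2 = incidence_eq[OF g ori(2,3) \<beta> v]
  have len: "length (ori g) = length (w # ori \<tau>)" using length_ordered_basis[OF ori(1)] length_ordered_basis[OF ori(2)] \<tau>(2) by simp
  have "vec.span \<tau> \<subseteq> vec.span g" using \<tau>(1) cone_face_subset vec.span_mono by blast
  moreover have "w \<in> vec.span g" using w vec.span_neg[OF vec.span_base, of "- w" g] by simp
  ultimately have "set (w # ori \<tau>) \<subseteq> vec.span (set (ori g))"
    using ori(1,2) vec.span_base[of _ "set (ori \<tau>)"] by (auto simp: ordered_basis_def)
  then have expand: "(w # ori \<tau>) ! j = (\<Sum>k<length (ori g). (\<gamma> k \<cdot> (w # ori \<tau>) ! j) *s ori g ! k)"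
    if "j < length (w # ori \<tau>)" for j
    using that nth_mem[of j "w # ori \<tau>"] by (intro dual_list_expand[OF \<gamma>]) blast
  define M :: "nat \<Rightarrow> nat \<Rightarrow> 'k" where "M i j = (case i of 0 \<Rightarrow> (if j = 0 then 1 else 0)
    | Suc i' \<Rightarrow> (case j of 0 \<Rightarrow> 0 | Suc j' \<Rightarrow> \<gamma> i' \<cdot> (w # ori \<tau>) ! j'))" for i j
  have "vol \<beta> (v # w # ori \<tau>) = vol \<beta> (v # ori g) * det_nat (length (v # ori g)) M"
  proof (rule vol_transform)
    fix j assume j: "j < length (v # ori g)"
    show "(v # w # ori \<tau>) ! j = (\<Sum>k<length (v # ori g). M k j *s (v # ori g) ! k)"
    proof (cases j)
      case 0
      then show ?thesis by (simp add: M_def sum.lessThan_Suc_shift del: sum.lessThan_Suc)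
    next
      case (Suc j')
      then show ?thesis using expand[of j'] j len
        by (simp add: M_def sum.lessThan_Suc_shift del: sum.lessThan_Suc)
    qed
  qed (simp add: len)
  also have "det_nat (length (v # ori g)) M = vol \<gamma> (w # ori \<tau>)"
    unfolding M_def vol_def len[symmetric] using det_nat_block[of "length (ori g)"] by simp
  finally have vol: "vol \<beta> (v # w # ori \<tau>) = vol \<beta> (v # ori g) * vol \<gamma> (w # ori \<tau>)" .
  show "vol \<beta> (v # w # ori \<tau>) \<noteq> 0" using vol 1 2 by simp
  show "incidence ori \<tau> g * incidence ori g h = pm (vol \<beta> (v # w # ori \<tau>))"
    unfolding vol using 1 2 by (simp add: pm_mult)
qed

text \<open>In a diamond the vector \<open>w\<close> pointing out of \<open>g\<close> across
  \<open>e\<close> also points out of \<open>h\<close> across \<open>g'\<close>, and likewise for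
  \<open>w'\<close> with \<open>g\<close> and \<open>g'\<close> exchanged. The two composites
  therefore use the same vectors, with the first two swapped, and this changes the sign of the
  volume.\<close>

lemma incidence_signs_incidence:
  fixes \<sigma> :: "('k::linordered_field ^ 'm) set"
  assumes fg: "fg_cone \<sigma>" and ori: "fan_orientation (face_fan \<sigma>) ori"
  shows "incidence_signs \<sigma> (incidence ori)"
proof
  show "incidence ori e f * incidence ori e f = 1" for e f by (simp add: incidence_def)
  fix e h g g' assume e: "cone_face e \<sigma>" and h: "h \<in> above 2 e \<sigma>" and gg: "above 1 e h = {g, g'}" "g \<noteq> g'"
  note h' = aboveD[OF h]
  have fgh: "fg_cone h" using fg_cone_face[OF fg h'(1)] .
  have eh: "cone_face e h" using cone_face_sub[OF e h'(2,4)] .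
  obtain l where "link h e l" using link_exists[OF fgh eh] by blast
  then interpret link h e l .
  have g: "g \<in> above 1 e h" "g' \<in> above 1 e h" using gg by auto
  note g1 = aboveD[OF g(1)] and g2 = aboveD[OF g(2)]
  have basis: "ordered_basis (ori \<rho>) \<rho>" if "cone_face \<rho> h" for \<rho>
    using ori cone_face_trans[OF assms(1) h'(1) that] by (auto simp: fan_orientation_def face_fan_def)
  obtain \<beta> where \<beta>: "dual_list \<beta> (ori h)"
    using dual_list_exists basis[OF cone_face_refl] by (auto simp: ordered_basis_def)
  define w w' where "w = - pt g" and "w' = - pt g'"
  have w: "- w \<in> g - e" "- w' \<in> g' - e" using pt g by (auto simp: w_def w'_def)
  then have w': "- w \<in> h - g'" "- w' \<in> h - g"
    using g1(4) g2(4) cover_unique[OF g] gg(2) by blast+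
  have dims: "vec.dim g = vec.dim e + 1" "vec.dim g' = vec.dim e + 1" "vec.dim h = vec.dim g + 1" "vec.dim h = vec.dim g' + 1"
    using g1(3) g2(3) h'(3) by auto
  have sub: "cone_face e g" "cone_face e g'" using cone_face_sub[OF eh] g1(2,4) g2(2,4) by auto
  note b = basis[OF eh] basis[OF g1(1)] basis[OF g2(1)] basis[OF cone_face_refl]
  note 1 = incidence_composite[OF sub(1) dims(1) g1(1) dims(3) b(1,2,4) \<beta> w(1) w'(2)]
  note 2 = incidence_composite[OF sub(2) dims(2) g2(1) dims(4) b(1,3,4) \<beta> w(2) w'(1)]
  have "det_nat (Suc (Suc (length (ori e)))) (\<lambda>i j. \<beta> i \<cdot> (w' # w # ori e) ! j) =
      - det_nat (Suc (Suc (length (ori e)))) (\<lambda>i j. \<beta> i \<cdot> (w # w' # ori e) ! j)"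
    by (rule det_nat_swap) simp_all
  then have "vol \<beta> (w' # w # ori e) = - vol \<beta> (w # w' # ori e)" by (simp add: vol_def)
  then show "incidence ori e g * incidence ori g h = - (incidence ori e g' * incidence ori g' h)"
    using 1 2 by (simp add: pm_minus)
qed (rule fg)

section \<open>Cocycles on a cone with pyramidal faces\<close>

locale fan_cone = incidence_signs \<sigma> inc
  for \<sigma> :: "('k::linordered_field ^ 'm) set" and inc :: "('k ^ 'm) set \<Rightarrow> ('k ^ 'm) set \<Rightarrow> 'k" +
  assumes pointed: "cone_face {0} \<sigma>"
begin

abbreviation faces :: "nat \<Rightarrow> ('k ^ 'm) set \<Rightarrow> ('k ^ 'm) set set" where
  "faces j \<equiv> above j {0}"

lemma facesD: "f \<in> faces j \<tau> \<Longrightarrow> vec.dim f = j"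
  using aboveD(3) by fastforce

lemma zero_face: "cone_face \<tau> \<sigma> \<Longrightarrow> cone_face {0} \<tau>"
  using cone_face_sub[OF pointed] cone_face_subset fg_cone_zero[OF fg_cone_face[OF fg]] by blast

lemma facesI: "cone_face f \<sigma> \<Longrightarrow> cone_face f \<tau> \<Longrightarrow> vec.dim f = j \<Longrightarrow> f \<in> faces j \<tau>"
  using fg_cone_zero[OF fg_cone_face[OF fg]] by (intro aboveI) auto

lemma faces_sub: "cone_face \<tau> \<sigma> \<Longrightarrow> faces j \<tau> = {f \<in> faces j \<sigma>. f \<subseteq> \<tau>}"
  by (rule above_face[OF fg])

lemma faces_faces: "\<tau> \<in> faces i \<sigma> \<Longrightarrow> f \<in> faces j \<tau> \<Longrightarrow> f \<in> faces j \<sigma>"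
  using faces_sub aboveD(1) by blast

lemma above_faces: "\<tau> \<in> faces i \<sigma> \<Longrightarrow> cone_face k \<sigma> \<Longrightarrow> above j \<tau> k = {f \<in> faces (i + j) k. \<tau> \<subseteq> f}"
  using facesD[of \<tau> i \<sigma>] aboveD(2)[of \<tau> i "{0}" \<sigma>] by (auto simp: above_def)

section \<open>Ray generators and their linear relations\<close>

definition gen :: "('k ^ 'm) set \<Rightarrow> 'k ^ 'm" where
  "gen \<rho> = (SOME x. x \<in> \<rho> \<and> x \<noteq> 0)"

lemma gen:
  assumes "\<rho> \<in> faces 1 \<sigma>"
  shows "gen \<rho> \<in> \<rho>" "gen \<rho> \<noteq> 0"
proof -
  have "\<rho> \<noteq> {0}" using aboveD(3)[OF assms] by auto
  then have "\<exists>x. x \<in> \<rho> \<and> x \<noteq> 0" using aboveD(2)[OF assms] by blast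
  then have "gen \<rho> \<in> \<rho> \<and> gen \<rho> \<noteq> 0" unfolding gen_def by (rule someI_ex)
  then show "gen \<rho> \<in> \<rho>" "gen \<rho> \<noteq> 0" by auto
qed

lemma ray_subset:
  assumes "\<rho> \<in> faces 1 \<sigma>" "cone_face \<tau> \<sigma>" "x \<in> \<rho>" "x \<in> \<tau>" "x \<noteq> 0"
  shows "\<rho> \<subseteq> \<tau>"
proof -
  note r = aboveD[OF assms(1)]
  have i: "cone_face (\<rho> \<inter> \<tau>) \<sigma>" using cone_face_inter r(1) assms(2) by blast
  have "{0} \<noteq> \<rho> \<inter> \<tau>" using assms by blast
  then have "vec.dim {0 :: 'k ^ 'm} < vec.dim (\<rho> \<inter> \<tau>)" using face_dim_less[OF zero_face[OF i]] by blast
  then have "\<rho> \<inter> \<tau> = \<rho>" using r(3) cone_face_sub[OF i _ r(4)] by (intro face_dim_eq) auto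
  then show ?thesis by blast
qed

lemma ray_eqI:
  assumes "\<rho> \<in> faces 1 \<sigma>" "\<rho>' \<in> faces 1 \<sigma>" "x \<in> \<rho>" "x \<in> \<rho>'" "x \<noteq> 0"
  shows "\<rho> = \<rho>'"
  using ray_subset[OF assms(1) aboveD(1)[OF assms(2)]] ray_subset[OF assms(2) aboveD(1)[OF assms(1)]] assms(3-) by blast

lemma inj_gen: "inj_on gen (faces 1 \<sigma>)"
proof (rule inj_onI)
  fix \<rho> \<rho>' assume \<rho>: "\<rho> \<in> faces 1 \<sigma>" "\<rho>' \<in> faces 1 \<sigma>" "gen \<rho> = gen \<rho>'"
  show "\<rho> = \<rho>'"
    using ray_eqI[OF \<rho>(1,2) gen(1)[OF \<rho>(1)] _ gen(2)[OF \<rho>(1)]] gen(1)[OF \<rho>(2)] \<rho>(3) by simp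
qed

lemma finite_faces: "cone_face \<tau> \<sigma> \<Longrightarrow> finite (faces j \<tau>)"
  using finite_above[OF fg_cone_face[OF fg]] .

text \<open>A functional that vanishes on all generators but not on \<tau> would, up to sign, be
  negative on some ray by \<open>negative_cover\<close>.\<close>

lemma span_gens:
  assumes \<tau>: "cone_face \<tau> \<sigma>"
  shows "vec.span \<tau> = vec.span (gen ` faces 1 \<tau>)"
proof (rule antisym)
  have "gen ` faces 1 \<tau> \<subseteq> \<tau>" using gen(1) by (auto simp: faces_sub[OF \<tau>])
  then show "vec.span (gen ` faces 1 \<tau>) \<subseteq> vec.span \<tau>" by (rule vec.span_mono)
  have "\<tau> \<subseteq> vec.span (gen ` faces 1 \<tau>)"
  proof (rule subsetI, rule ccontr)
    fix x assume x: "x \<in> \<tau>" "x \<notin> vec.span (gen ` faces 1 \<tau>)"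
    obtain a where a: "\<forall>y\<in>gen ` faces 1 \<tau>. a \<cdot> y = 0" "a \<cdot> x = 1" using functional_separation[OF x(2)] by blast
    obtain l where l: "link \<tau> {0} l" using link_exists[OF fg_cone_face[OF fg \<tau>] zero_face[OF \<tau>]] by blast
    obtain \<rho> where \<rho>: "\<rho> \<in> faces 1 \<tau>" "\<forall>y\<in>\<rho>. y \<notin> {0} \<longrightarrow> (- a) \<cdot> y < 0"
      using link.negative_cover[OF l, of "- a" x] a(2) x(1) by auto
    have "\<rho> \<in> faces 1 \<sigma>" using \<rho>(1) faces_sub[OF \<tau>] by blast
    then have "(- a) \<cdot> gen \<rho> < 0" using \<rho>(2) gen by blast
    then show False using a(1) \<rho>(1) by simp
  qed
  then show "vec.span \<tau> \<subseteq> vec.span (gen ` faces 1 \<tau>)" by (rule vec.span_minimal) (rule vec.subspace_span)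
qed

text \<open>Surjectivity of the map from functions on the rays of \<tau> to its span. The sum runs
  over all rays of \<sigma>, so that functions belonging to different faces can be added.\<close>

lemma coefficients_exist:
  assumes \<tau>: "cone_face \<tau> \<sigma>" and x: "x \<in> vec.span \<tau>"
  shows "\<exists>u. x = (\<Sum>\<rho>\<in>faces 1 \<sigma>. u \<rho> *s gen \<rho>) \<and> (\<forall>\<rho>. u \<rho> \<noteq> 0 \<longrightarrow> \<rho> \<in> faces 1 \<tau>)"
proof -
  have "x \<in> range (\<lambda>u. \<Sum>v\<in>gen ` faces 1 \<tau>. u v *s v)"
    using x unfolding span_gens[OF \<tau>] using vec.span_finite finite_faces[OF \<tau>] by blast
  then obtain u where u: "x = (\<Sum>v\<in>gen ` faces 1 \<tau>. u v *s v)" by blast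
  define w where "w \<rho> = (if \<rho> \<in> faces 1 \<tau> then u (gen \<rho>) else 0)" for \<rho>
  have "inj_on gen (faces 1 \<tau>)" using inj_gen inj_on_subset faces_sub[OF \<tau>, of 1] by blast
  then have "x = (\<Sum>\<rho>\<in>faces 1 \<tau>. w \<rho> *s gen \<rho>)" using u by (simp add: sum.reindex w_def)
  also have "\<dots> = (\<Sum>\<rho>\<in>faces 1 \<sigma>. w \<rho> *s gen \<rho>)"
    using finite_faces[OF cone_face_refl] faces_sub[OF \<tau>, of 1]
    by (intro sum.mono_neutral_left) (auto simp: w_def)
  finally show ?thesis by (intro exI[of _ w]) (auto simp: w_def)
qed

text \<open>Relations of all faces are functions on one common set of rays, restricted only in their
  support; hence intersecting faces intersects the spaces of relations.\<close>

definition relations :: "('k ^ 'm) set \<Rightarrow> (('k ^ 'm) set \<Rightarrow> 'k) set" where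
  "relations \<tau> = {r. (\<forall>\<rho>. r \<rho> \<noteq> 0 \<longrightarrow> \<rho> \<in> faces 1 \<sigma> \<and> \<rho> \<subseteq> \<tau>) \<and> (\<Sum>\<rho>\<in>faces 1 \<sigma>. r \<rho> *s gen \<rho>) = 0}"

definition simplicial :: "('k ^ 'm) set \<Rightarrow> bool" where
  "simplicial \<tau> \<longleftrightarrow> (\<forall>r\<in>relations \<tau>. \<forall>\<rho>. r \<rho> = 0)"

lemma relations_mono: "\<tau> \<subseteq> \<tau>' \<Longrightarrow> relations \<tau> \<subseteq> relations \<tau>'"
  unfolding relations_def by blast

lemma relations_inter: "r \<in> relations \<tau> \<Longrightarrow> r \<in> relations \<tau>' \<Longrightarrow> r \<in> relations (\<tau> \<inter> \<tau>')"
  unfolding relations_def by blast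

text \<open>Pairing the relation with \<open>a\<close> leaves the term of \<rho> alone.\<close>

lemma relation_single_ray:
  assumes r: "r \<in> relations \<tau>" and \<rho>: "\<rho> \<in> faces 1 \<sigma>" "a \<cdot> gen \<rho> \<noteq> 0"
    and other: "\<And>\<rho>'. \<rho>' \<in> faces 1 \<sigma> \<Longrightarrow> \<rho>' \<subseteq> \<tau> \<Longrightarrow> \<rho>' \<noteq> \<rho> \<Longrightarrow> a \<cdot> gen \<rho>' = 0"
  shows "r \<rho> = 0"
proof -
  have "0 = a \<cdot> (\<Sum>\<rho>\<in>faces 1 \<sigma>. r \<rho> *s gen \<rho>)" using r by (simp add: relations_def)
  also have "\<dots> = (\<Sum>\<rho>'\<in>faces 1 \<sigma>. r \<rho>' * (a \<cdot> gen \<rho>'))" by (simp add: sp_sum)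
  also have "\<dots> = (\<Sum>\<rho>'\<in>{\<rho>}. r \<rho>' * (a \<cdot> gen \<rho>'))"
  proof (rule sum.mono_neutral_right)
    show "\<forall>\<rho>'\<in>faces 1 \<sigma> - {\<rho>}. r \<rho>' * (a \<cdot> gen \<rho>') = 0"
    proof
      fix \<rho>' assume \<rho>': "\<rho>' \<in> faces 1 \<sigma> - {\<rho>}"
      show "r \<rho>' * (a \<cdot> gen \<rho>') = 0"
        using other[of \<rho>'] \<rho>' r by (cases "r \<rho>' = 0") (auto simp: relations_def)
    qed
  qed (use \<rho>(1) finite_faces[OF cone_face_refl] in auto)
  finally show ?thesis using \<rho>(2) by simp
qed

text \<open>In dimension 2 there are exactly two rays by the diamond property, and a functional
  exposing one of them is non-zero on the other.\<close>

lemma simplicial_dim_le_2: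
  assumes \<tau>: "cone_face \<tau> \<sigma>" "vec.dim \<tau> \<le> 2"
  shows "simplicial \<tau>"
  unfolding simplicial_def
proof (intro ballI allI, rule ccontr)
  fix r \<rho> assume r: "r \<in> relations \<tau>" "r \<rho> \<noteq> 0"
  then have \<rho>: "\<rho> \<in> faces 1 \<sigma>" "\<rho> \<subseteq> \<tau>" by (auto simp: relations_def)
  have \<rho>\<tau>: "\<rho> \<in> faces 1 \<tau>" using \<rho> faces_sub[OF \<tau>(1)] by blast
  have fg\<tau>: "fg_cone \<tau>" using fg_cone_face[OF fg \<tau>(1)] .
  have "1 \<le> vec.dim \<tau>" using vec.dim_subset[OF \<rho>(2)] facesD[OF \<rho>(1)] by simp
  then consider "vec.dim \<tau> = 1" | "vec.dim \<tau> = vec.dim {0 :: 'k ^ 'm} + 2" using \<tau>(2) by fastforce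
  then show False
  proof cases
    case 1
    have eq: "\<rho>' = \<tau>" if "\<rho>' \<in> faces 1 \<sigma>" "\<rho>' \<subseteq> \<tau>" for \<rho>'
      using cone_face_sub[OF aboveD(1)[OF that(1)] that(2) cone_face_subset[OF \<tau>(1)]] facesD[OF that(1)] 1
      by (intro face_dim_eq) auto
    have "gen \<rho> \<notin> vec.span {}" using gen(2)[OF \<rho>(1)] by simp
    then obtain a where "a \<cdot> gen \<rho> = 1" using functional_separation by blast
    then show False using relation_single_ray[OF r(1) \<rho>(1), of a] eq eq[OF \<rho>] r(2) by auto
  next
    case 2
    obtain \<rho>2 where \<rho>2: "\<rho>2 \<noteq> \<rho>" "faces 1 \<tau> = {\<rho>, \<rho>2}"
      using diamond[OF fg\<tau> zero_face[OF \<tau>(1)] 2 \<rho>\<tau>] by blast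
    have 2: "\<rho>2 \<in> faces 1 \<tau>" using \<rho>2 by blast
    then have 2: "\<rho>2 \<in> faces 1 \<sigma>" using faces_sub[OF \<tau>(1)] by blast
    obtain a where a: "\<rho>2 = {x\<in>\<sigma>. a \<cdot> x = 0}" using aboveD(1)[OF 2] by (auto simp: cone_face_def)
    have "gen \<rho> \<notin> \<rho>2" using ray_eqI[OF \<rho>(1) 2] gen[OF \<rho>(1)] \<rho>2(1) by blast
    then have "a \<cdot> gen \<rho> \<noteq> 0" using a gen(1)[OF \<rho>(1)] aboveD(4)[OF \<rho>(1)] by blast
    moreover have "a \<cdot> gen \<rho>' = 0" if "\<rho>' \<in> faces 1 \<sigma>" "\<rho>' \<subseteq> \<tau>" "\<rho>' \<noteq> \<rho>" for \<rho>'
    proof -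
      have "\<rho>' \<in> faces 1 \<tau>" using that faces_sub[OF \<tau>(1)] by blast
      then have "\<rho>' = \<rho>2" using \<rho>2(2) that(3) by blast
      then show ?thesis using gen(1)[OF 2] a by blast
    qed
    ultimately show False using relation_single_ray[OF r(1) \<rho>(1)] r(2) by blast
  qed
qed

text \<open>The functional that is 0 on \<open>V\<close> and 1 at \<open>p\<close> exposes the base.
  A ray outside the base must contain \<open>p\<close>, so there is at most one, and a relation has
  coefficient 0 there.\<close>

lemma base_of_pyramid:
  assumes g: "g \<in> faces 4 \<sigma>" "g = K_conic (insert p V)"
    and V: "finite V" "p \<notin> vec.span V" "vec.dim (K_conic V) = 3"
  shows "\<exists>Q\<in>faces 3 g. relations g \<subseteq> relations Q"
proof -
  obtain a where a: "\<forall>y\<in>V. a \<cdot> y = 0" "a \<cdot> p = 1" using functional_separation[OF V(2)] by blast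
  have fin: "finite (insert p V)" using V(1) by simp
  have "\<forall>s\<in>insert p V. 0 \<le> a \<cdot> s" using a by auto
  then have nonneg: "\<forall>x\<in>K_conic (insert p V). 0 \<le> a \<cdot> x" using conic_sp_nonneg by blast
  have "{s\<in>insert p V. a \<cdot> s = 0} = V" using a V(2) vec.span_base by auto
  then have Q: "{x\<in>g. a \<cdot> x = 0} = K_conic V" using conic_face[OF fin nonneg] g(2) by simp
  have gf: "cone_face g \<sigma>" using aboveD(1)[OF g(1)] .
  have Qg: "cone_face (K_conic V) g" unfolding cone_face_def using nonneg Q g(2) by blast
  have Qf: "cone_face (K_conic V) \<sigma>" using cone_face_trans[OF fg gf Qg] .
  have "p \<noteq> 0" using V(2) vec.span_zero by blast
  have p: "p \<in> \<rho>" if \<rho>: "\<rho> \<in> faces 1 \<sigma>" "\<rho> \<subseteq> g" "a \<cdot> gen \<rho> \<noteq> 0" for \<rho>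
  proof (rule ccontr)
    assume "p \<notin> \<rho>"
    then have "insert p V \<inter> \<rho> \<subseteq> V" by blast
    then have "K_conic (insert p V \<inter> \<rho>) \<subseteq> K_conic V" using conic_mono[OF V(1)] by blast
    moreover have "\<rho> = K_conic (insert p V \<inter> \<rho>)"
      using cone_face_conic[OF fin] cone_face_sub[OF aboveD(1)[OF \<rho>(1)] \<rho>(2) cone_face_subset[OF gf]] g(2) by simp
    ultimately have "gen \<rho> \<in> K_conic V" using gen(1)[OF \<rho>(1)] by blast
    then show False using Q \<rho>(3) by blast
  qed
  have "r \<in> relations (K_conic V)" if r: "r \<in> relations g" for r
  proof -
    have "\<rho> \<subseteq> K_conic V" if nz: "r \<rho> \<noteq> 0" for \<rho>
    proof -
      have \<rho>: "\<rho> \<in> faces 1 \<sigma>" "\<rho> \<subseteq> g" using r nz by (auto simp: relations_def)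
      have "a \<cdot> gen \<rho> = 0"
      proof (rule ccontr)
        assume ne: "a \<cdot> gen \<rho> \<noteq> 0"
        have "a \<cdot> gen \<rho>' = 0" if "\<rho>' \<in> faces 1 \<sigma>" "\<rho>' \<subseteq> g" "\<rho>' \<noteq> \<rho>" for \<rho>'
          using ray_eqI[OF that(1) \<rho>(1) p[OF that(1,2)] p[OF \<rho> ne] \<open>p \<noteq> 0\<close>] that(3) by blast
        then show False using relation_single_ray[OF r \<rho>(1) ne] nz by blast
      qed
      then have "gen \<rho> \<in> K_conic V" using Q gen(1)[OF \<rho>(1)] \<rho>(2) by blast
      then show ?thesis using ray_subset[OF \<rho>(1) Qf gen(1)[OF \<rho>(1)] _ gen(2)[OF \<rho>(1)]] by blast
    qed
    then show ?thesis using r by (auto simp: relations_def)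
  qed
  moreover have "K_conic V \<in> faces 3 g" using facesI[OF Qf Qg V(3)] .
  ultimately show ?thesis by blast
qed

text \<open>By the count \<open>V\<close> is a basis of the span of \<tau>. Each ray contains a
  non-zero element of \<open>V\<close>, and the dual functional of this element vanishes on the
  generators of all other rays. The cones over triangles are of this kind.\<close>

lemma simplicial_conic:
  assumes \<tau>: "cone_face \<tau> \<sigma>" "\<tau> = K_conic V" and V: "finite V" "card V = vec.dim \<tau>"
  shows "simplicial \<tau>"
  unfolding simplicial_def
proof (intro ballI allI, rule ccontr)
  fix r \<rho> assume r: "r \<in> relations \<tau>" "r \<rho> \<noteq> 0"
  then have \<rho>: "\<rho> \<in> faces 1 \<sigma>" "\<rho> \<subseteq> \<tau>" by (auto simp: relations_def)
  have "vec.dim V = card V" using span_conic[OF V(1)] V(2) \<tau>(2) by (metis vec.dim_span)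
  then have ind: "vec.independent V" using V(1) vec.card_le_dim_spanning[of V V] vec.span_base by auto
  have conic: "\<rho>' = K_conic (V \<inter> \<rho>')" if "\<rho>' \<in> faces 1 \<sigma>" "\<rho>' \<subseteq> \<tau>" for \<rho>'
    using cone_face_conic[OF V(1)] cone_face_sub[OF aboveD(1)[OF that(1)] that(2) cone_face_subset[OF \<tau>(1)]] \<tau>(2) by simp
  have in_span: "gen \<rho>' \<in> vec.span (V \<inter> \<rho>')" if "\<rho>' \<in> faces 1 \<sigma>" "\<rho>' \<subseteq> \<tau>" for \<rho>'
  proof -
    have "gen \<rho>' \<in> vec.span (K_conic (V \<inter> \<rho>'))" using gen(1)[OF that(1)] conic[OF that] vec.span_base by blast
    then show ?thesis using span_conic[of "V \<inter> \<rho>'"] V(1) by simp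
  qed
  have "\<not> V \<inter> \<rho> \<subseteq> {0}"
  proof
    assume "V \<inter> \<rho> \<subseteq> {0}"
    then have "vec.span (V \<inter> \<rho>) \<subseteq> vec.span {0}" by (rule vec.span_mono)
    then show False using in_span[OF \<rho>] gen(2)[OF \<rho>(1)] by (auto simp: vec.span_insert_0)
  qed
  then obtain s where s: "s \<in> V" "s \<in> \<rho>" "s \<noteq> 0" by blast
  obtain a where a: "\<forall>x\<in>V. a \<cdot> x = (if x = s then 1 else 0)" using functional_extend[OF ind, of "\<lambda>x. if x = s then 1 else 0"] by blast
  obtain l where "link \<sigma> {0} l" using link_exists[OF fg pointed] by blast
  then interpret l: link \<sigma> "{0}" l .
  have a0: "\<forall>x\<in>{0}. a \<cdot> x = 0" by simp
  \<comment> \<open>Along the ray \<rho> the functional \<open>a\<close> is proportional to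
    \<open>l\<close>; being non-zero at \<open>s\<close>, it is non-zero at the generator as
    well.\<close>
  have "a \<cdot> s = (a \<cdot> l.pt \<rho>) * (l \<cdot> s)" using l.sp_cover[OF \<rho>(1) a0] s(2) vec.span_base by blast
  then have "a \<cdot> l.pt \<rho> \<noteq> 0" using a s(1) by auto
  moreover have "0 < l \<cdot> gen \<rho>" using l.l_pos gen[OF \<rho>(1)] aboveD(4)[OF \<rho>(1)] by blast
  moreover have "a \<cdot> gen \<rho> = (a \<cdot> l.pt \<rho>) * (l \<cdot> gen \<rho>)"
    using l.sp_cover[OF \<rho>(1) a0] gen(1)[OF \<rho>(1)] vec.span_base by blast
  ultimately have ne: "a \<cdot> gen \<rho> \<noteq> 0" by simp
  have "a \<cdot> gen \<rho>' = 0" if "\<rho>' \<in> faces 1 \<sigma>" "\<rho>' \<subseteq> \<tau>" "\<rho>' \<noteq> \<rho>" for \<rho>'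
  proof (rule sp_zero_span[OF _ in_span[OF that(1,2)]])
    have "s \<notin> \<rho>'" using ray_eqI[OF that(1) \<rho>(1) _ s(2,3)] that(3) by blast
    then show "\<forall>x\<in>V \<inter> \<rho>'. a \<cdot> x = 0" using a by auto
  qed
  then show False using relation_single_ray[OF r(1) \<rho>(1) ne] r(2) by blast
qed

end

text \<open>The two hypotheses on the polytope in terms of relations. As dim \<sigma> = n + 1, the
  bound n - 3 becomes dim \<sigma> - 4, written additively to avoid truncated subtraction.\<close>

locale pyramidal_cone = fan_cone \<sigma> inc
  for \<sigma> :: "('k::linordered_field ^ 'm) set" and inc :: "('k ^ 'm) set \<Rightarrow> ('k ^ 'm) set \<Rightarrow> 'k" +
  assumes base_exists: "\<And>g. g \<in> faces 4 \<sigma> \<Longrightarrow> \<exists>Q\<in>faces 3 g. relations g \<subseteq> relations Q"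
    and few_nonsimplicial: "\<And>\<rho>. \<rho> \<in> faces 1 \<sigma> \<Longrightarrow>
      card {f \<in> faces 3 \<sigma>. \<rho> \<subseteq> f \<and> \<not> simplicial f} + 4 \<le> vec.dim \<sigma>"
begin

text \<open>Relations of \<open>Q\<close> are relations of \<open>g\<close>, hence of
  \<open>B\<close>, hence of \<open>Q \<inter> B\<close>. If \<open>Q\<close> and \<open>B\<close>
  differ, this intersection has dimension at most 2 and carries no relations.\<close>

lemma base_unique:
  assumes g: "g \<in> faces 4 \<sigma>" and B: "B \<in> faces 3 g" "relations g \<subseteq> relations B"
    and Q: "Q \<in> faces 3 g" "\<not> simplicial Q"
  shows "Q = B"
proof (rule ccontr)
  assume ne: "Q \<noteq> B"
  have Q\<sigma>: "Q \<in> faces 3 \<sigma>" "B \<in> faces 3 \<sigma>" using faces_faces[OF g] B Q by auto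
  have i: "cone_face (Q \<inter> B) \<sigma>" using cone_face_inter Q\<sigma> aboveD(1) by blast
  have "vec.dim (Q \<inter> B) \<le> 2"
  proof (rule ccontr)
    assume "\<not> vec.dim (Q \<inter> B) \<le> 2"
    then have "Q \<inter> B = Q" "Q \<inter> B = B"
      using facesD[OF Q\<sigma>(1)] facesD[OF Q\<sigma>(2)] cone_face_sub[OF i _ aboveD(4)[OF Q\<sigma>(1)]] cone_face_sub[OF i _ aboveD(4)[OF Q\<sigma>(2)]]
      by (auto intro!: face_dim_eq)
    then show False using ne by blast
  qed
  then have "simplicial (Q \<inter> B)" using simplicial_dim_le_2[OF i] by blast
  moreover have "relations Q \<subseteq> relations B" using relations_mono[OF aboveD(4)[OF Q(1)]] B(2) by blast
  ultimately have "simplicial Q" using relations_inter unfolding simplicial_def by blast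
  then show False using Q(2) by blast
qed

lemma relations_base:
  assumes "g \<in> faces 4 \<sigma>" "Q \<in> faces 3 g" "\<not> simplicial Q"
  shows "relations g \<subseteq> relations Q"
  using base_exists[OF assms(1)] base_unique[OF assms(1)] assms by blast

text \<open>For a non-simplicial \<open>Q\<close> and a ray \<open>\<rho>\<close>, a cut in the link of \<open>Q\<close> consists of at least
  \<open>dim \<sigma> - 4\<close> faces of dimension 5, and each of them contains a further non-simplicial face through \<open>\<rho>\<close>.\<close>

lemma relation_cocycle_constant:
  assumes rel: "\<And>g. g \<in> faces 4 \<sigma> \<Longrightarrow> r g \<in> relations g"
    and closed: "\<And>h \<rho>. h \<in> faces 5 \<sigma> \<Longrightarrow> (\<Sum>g\<in>faces 4 h. inc g h * r g \<rho>) = 0"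
    and Q: "Q \<in> faces 3 \<sigma>" "\<not> simplicial Q" and g: "g1 \<in> above 1 Q \<sigma>" "g2 \<in> above 1 Q \<sigma>"
  shows "inc Q g1 * r g1 \<rho> = inc Q g2 * r g2 \<rho>"
proof (rule ccontr)
  assume ne: "inc Q g1 * r g1 \<rho> \<noteq> inc Q g2 * r g2 \<rho>"
  define A where "A g \<longleftrightarrow> inc Q g * r g \<rho> = inc Q g1 * r g1 \<rho>" for g
  define N where "N = {f \<in> faces 3 \<sigma>. \<rho> \<subseteq> f \<and> \<not> simplicial f}"
  have Qf: "cone_face Q \<sigma>" using aboveD(1)[OF Q(1)] .
  have dimQ: "vec.dim Q = 3" using facesD[OF Q(1)] .
  have up4: "g \<in> faces 4 \<sigma>" "Q \<in> faces 3 g" if "g \<in> above 1 Q \<sigma>" for g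
  proof -
    show "g \<in> faces 4 \<sigma>" using that above_faces[OF Q(1) cone_face_refl, of 1] by auto
    show "Q \<in> faces 3 g" using Q(1) aboveD(2)[OF that] faces_sub[OF aboveD(1)[OF that]] by blast
  qed
  \<comment> \<open>Different values require a non-zero coefficient at \<rho>, and this makes \<rho>
    a ray of \<open>Q\<close>.\<close>
  have "r g1 \<rho> \<noteq> 0 \<or> r g2 \<rho> \<noteq> 0" using ne by auto
  moreover have "\<rho> \<in> faces 1 \<sigma> \<and> \<rho> \<subseteq> Q" if "g \<in> above 1 Q \<sigma>" "r g \<rho> \<noteq> 0" for g
    using rel[OF up4(1)[OF that(1)]] relations_base[OF up4[OF that(1)] Q(2)] that(2) by (auto simp: relations_def)
  ultimately have \<rho>: "\<rho> \<in> faces 1 \<sigma>" "\<rho> \<subseteq> Q" using g by blast+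
  have finN: "finite N" using finite_faces[OF cone_face_refl] by (simp add: N_def)
  have QN: "Q \<in> N" using Q \<rho> by (simp add: N_def)
  \<comment> \<open>Otherwise every 4-dimensional face of \<open>h\<close> with non-zero coefficient
    at \<rho> has base \<open>Q\<close>, so it is one of the two faces between \<open>Q\<close> and
    \<open>h\<close>; the cocycle condition on \<open>h\<close> then equates their signed
    coefficients.\<close>
  have ex: "\<exists>Q'. Q' \<in> N - {Q} \<and> Q' \<subseteq> h" if h: "h \<in> cut Q \<sigma> A" for h
  proof (rule ccontr)
    assume none: "\<not> (\<exists>Q'. Q' \<in> N - {Q} \<and> Q' \<subseteq> h)"
    obtain g g' where h2: "h \<in> above 2 Q \<sigma>" and gg: "g \<in> above 1 Q h" "g' \<in> above 1 Q h" "A g" "\<not> A g'"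
      using h by (auto simp: cut_def)
    have hf: "cone_face h \<sigma>" using aboveD(1)[OF h2] .
    have h5: "h \<in> faces 5 \<sigma>" using h2 above_faces[OF Q(1) cone_face_refl, of 2] by auto
    have ne': "g \<noteq> g'" using gg by blast
    obtain l where l: "link \<sigma> Q l" using link_exists[OF fg Qf] by blast
    have gh: "above 1 Q h = {g, g'}" using link.above2_cases[OF l h2 gg(1)] gg(2) ne' by blast
    have g4: "g \<in> faces 4 h" "g' \<in> faces 4 h" using gg(1,2) above_faces[OF Q(1) hf, of 1] by auto
    have "0 = (\<Sum>k\<in>faces 4 h. inc k h * r k \<rho>)" using closed[OF h5] by simp
    also have "\<dots> = (\<Sum>k\<in>{g, g'}. inc k h * r k \<rho>)"
    proof (rule sum.mono_neutral_right)
      show "\<forall>k\<in>faces 4 h - {g, g'}. inc k h * r k \<rho> = 0"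
      proof (rule ballI, rule ccontr)
        fix k assume k: "k \<in> faces 4 h - {g, g'}" and "inc k h * r k \<rho> \<noteq> 0"
        then have rk: "r k \<rho> \<noteq> 0" by auto
        have k4: "k \<in> faces 4 \<sigma>" using k faces_faces[OF h5] by blast
        obtain B where B: "B \<in> faces 3 k" "relations k \<subseteq> relations B" using base_exists[OF k4] by blast
        have rB: "r k \<in> relations B" using rel[OF k4] B(2) by blast
        then have "\<not> simplicial B" using rk by (auto simp: simplicial_def)
        moreover have "\<rho> \<subseteq> B" using rB rk by (auto simp: relations_def)
        ultimately have "B \<in> N" using faces_faces[OF k4 B(1)] by (simp add: N_def)
        moreover have "B \<subseteq> h" using aboveD(4)[OF B(1)] aboveD(4) k by blast
        ultimately have "B = Q" using none by blast
        then have "k \<in> above 1 Q h" using k aboveD(4)[OF B(1)] above_faces[OF Q(1) hf, of 1] by auto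
        then show False using gh k by blast
      qed
    qed (use g4 finite_faces[OF hf] in auto)
    finally have e1: "inc g h * r g \<rho> = - (inc g' h * r g' \<rho>)" using ne' by (simp add: eq_neg_iff_add_eq_0)
    have e2: "inc Q g * inc g h = - (inc Q g' * inc g' h)" using inc_diamond[OF Qf h2 gh ne'] .
    have sq: "inc k h * inc k h = 1" if "k \<in> {g, g'}" for k
    proof (rule inc_square)
      have k: "k \<in> faces 4 h" using that g4 by blast
      show "cone_face k \<sigma>" using aboveD(1)[OF k] cone_face_trans[OF fg hf] by blast
      show "h \<in> above 1 k \<sigma>" using aboveI[OF hf aboveD(4)[OF k]] facesD[OF k] facesD[OF h5] by simp
    qed
    have "inc Q g * r g \<rho> = (inc Q g * inc g h) * (inc g h * r g \<rho>)" using sq[of g] by (simp add: algebra_simps)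
    also have "\<dots> = (inc Q g' * inc g' h) * (inc g' h * r g' \<rho>)" unfolding e1 e2 by simp
    also have "\<dots> = inc Q g' * r g' \<rho>" using sq[of g'] by (simp add: algebra_simps)
    finally show False using gg(3,4) by (simp add: A_def)
  qed
  then obtain \<phi> where \<phi>: "\<And>h. h \<in> cut Q \<sigma> A \<Longrightarrow> \<phi> h \<in> N - {Q} \<and> \<phi> h \<subseteq> h" by metis
  \<comment> \<open>\<open>h \<inter> h'\<close> is smaller than \<open>h\<close> but contains two
    distinct 3-dimensional faces, so its dimension is 4 and \<open>base_unique\<close> applies to
    it.\<close>
  have "inj_on \<phi> (cut Q \<sigma> A)"
  proof (rule inj_onI, rule ccontr)
    fix h h' assume hh: "h \<in> cut Q \<sigma> A" "h' \<in> cut Q \<sigma> A" "\<phi> h = \<phi> h'" "h \<noteq> h'"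
    have h2: "h \<in> above 2 Q \<sigma>" "h' \<in> above 2 Q \<sigma>" using hh by (auto simp: cut_def)
    have hf: "cone_face h \<sigma>" "cone_face h' \<sigma>" using h2 aboveD(1) by auto
    have dim: "vec.dim h = 5" "vec.dim h' = 5" using aboveD(3)[OF h2(1)] aboveD(3)[OF h2(2)] dimQ by auto
    define k where "k = h \<inter> h'"
    have k: "cone_face k \<sigma>" using cone_face_inter[OF hf] by (simp add: k_def)
    have kh: "cone_face k h" "cone_face k h'"
      using cone_face_sub[OF k _ cone_face_subset[OF hf(1)]] cone_face_sub[OF k _ cone_face_subset[OF hf(2)]]
      by (auto simp: k_def)
    define Q' where "Q' = \<phi> h"
    have Q': "Q' \<in> N" "Q' \<noteq> Q" "Q' \<subseteq> k" using \<phi>[OF hh(1)] \<phi>[OF hh(2)] hh(3) by (auto simp: Q'_def k_def)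
    have Q'\<sigma>: "Q' \<in> faces 3 \<sigma>" "\<not> simplicial Q'" using Q'(1) by (auto simp: N_def)
    have Qk: "Q \<subseteq> k" using aboveD(2)[OF h2(1)] aboveD(2)[OF h2(2)] by (simp add: k_def)
    have QQ: "Q \<in> faces 3 k" "Q' \<in> faces 3 k" using Q Q'\<sigma> Qk Q'(3) faces_sub[OF k] by auto
    have "k \<noteq> h"
    proof
      assume "k = h"
      then have "h = h'" using kh(2) dim by (intro face_dim_eq) auto
      then show False using hh(4) by blast
    qed
    then have "vec.dim k < 5" using face_dim_less[OF kh(1)] dim by simp
    moreover have "\<not> vec.dim k \<le> 3"
    proof
      assume "vec.dim k \<le> 3"
      then have "Q = k" "Q' = k" using QQ facesD aboveD(1) by (metis face_dim_eq)+
      then show False using Q'(2) by blast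
    qed
    ultimately have k4: "k \<in> faces 4 \<sigma>" by (intro facesI[OF k k]) simp
    obtain B where B: "B \<in> faces 3 k" "relations k \<subseteq> relations B" using base_exists[OF k4] by blast
    show False using base_unique[OF k4 B QQ(1) Q(2)] base_unique[OF k4 B QQ(2) Q'\<sigma>(2)] Q'(2) by simp
  qed
  moreover have "\<phi> ` cut Q \<sigma> A \<subseteq> N - {Q}" using \<phi> by blast
  ultimately have "card (cut Q \<sigma> A) \<le> card (N - {Q})" using finN by (meson card_inj_on_le finite_Diff)
  also have "\<dots> < card N" using finN QN by (rule card_Diff1_less)
  finally have "card (cut Q \<sigma> A) < card N" .
  moreover have "vec.dim \<sigma> \<le> vec.dim Q + 1 + card (cut Q \<sigma> A)"
    using card_cut[OF fg Qf g, of A] ne by (simp add: A_def)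
  moreover have "card N + 4 \<le> vec.dim \<sigma>" using few_nonsimplicial[OF \<rho>(1)] by (simp add: N_def)
  \<comment> \<open>The chain dim \<sigma> \<le> 4 + card(cut) < 4 + card(N) \<le> dim \<sigma> is
    contradictory; the strict step is due to \<open>Q\<close> itself lying in
    \<open>N\<close>.\<close>
  ultimately show False using dimQ by simp
qed

text \<open>By constancy each non-simplicial \<open>Q\<close> carries a well-defined signed
  relation. The coboundary of these at \<open>g\<close> has only the term of the base of
  \<open>g\<close>, and the squared sign there is 1.\<close>

lemma relation_cocycle_exact:
  assumes rel: "\<And>g. g \<in> faces 4 \<sigma> \<Longrightarrow> r g \<in> relations g"
    and closed: "\<And>h \<rho>. h \<in> faces 5 \<sigma> \<Longrightarrow> (\<Sum>g\<in>faces 4 h. inc g h * r g \<rho>) = 0"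
  shows "\<exists>s. (\<forall>f\<in>faces 3 \<sigma>. s f \<in> relations f) \<and>
    (\<forall>g\<in>faces 4 \<sigma>. \<forall>\<rho>. (\<Sum>f\<in>faces 3 g. inc f g * s f \<rho>) = r g \<rho>)"
proof -
  \<comment> \<open>Any choice of \<open>g\<close> gives the same relation. The value is 0 where
    \<open>Q\<close> has no relations, and where no 4-dimensional face lies above \<open>Q\<close>
    that could impose a condition.\<close>
  define s where "s Q = (if simplicial Q \<or> above 1 Q \<sigma> = {} then (\<lambda>\<rho>. 0)
    else (\<lambda>\<rho>. inc Q (SOME g. g \<in> above 1 Q \<sigma>) * r (SOME g. g \<in> above 1 Q \<sigma>) \<rho>))" for Q
  have zero: "(\<lambda>\<rho>. 0) \<in> relations \<tau>" for \<tau> by (simp add: relations_def)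
  have scale: "(\<lambda>\<rho>. c * q \<rho>) \<in> relations \<tau>" if "q \<in> relations \<tau>" for c q \<tau>
  proof -
    have "(\<Sum>\<rho>\<in>faces 1 \<sigma>. (c * q \<rho>) *s gen \<rho>) = c *s (\<Sum>\<rho>\<in>faces 1 \<sigma>. q \<rho> *s gen \<rho>)"
      by (simp add: vec.scale_sum_right)
    then show ?thesis using that by (auto simp: relations_def)
  qed
  have s_eq: "s Q \<rho> = inc Q g * r g \<rho>" if Q: "Q \<in> faces 3 \<sigma>" "\<not> simplicial Q" and g: "g \<in> above 1 Q \<sigma>" for Q g \<rho>
  proof -
    have ne: "above 1 Q \<sigma> \<noteq> {}" using g by blast
    have "(SOME g. g \<in> above 1 Q \<sigma>) \<in> above 1 Q \<sigma>" using someI[of "\<lambda>g. g \<in> above 1 Q \<sigma>"] g by blast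
    then have "inc Q (SOME g. g \<in> above 1 Q \<sigma>) * r (SOME g. g \<in> above 1 Q \<sigma>) \<rho> = inc Q g * r g \<rho>"
      using relation_cocycle_constant[where r = r, OF rel closed Q _ g] by simp
    then show ?thesis using Q(2) ne by (simp add: s_def)
  qed
  have s_rel: "s Q \<in> relations Q" if Q: "Q \<in> faces 3 \<sigma>" for Q
  proof (cases "simplicial Q \<or> above 1 Q \<sigma> = {}")
    case True
    then show ?thesis using zero by (simp add: s_def)
  next
    case False
    then obtain g where g: "g \<in> above 1 Q \<sigma>" by blast
    have g4: "g \<in> faces 4 \<sigma>" using g above_faces[OF Q cone_face_refl, of 1] by auto
    have "Q \<in> faces 3 g" using Q aboveD(2)[OF g] faces_sub[OF aboveD(1)[OF g]] by blast
    then have "r g \<in> relations Q" using rel[OF g4] relations_base[OF g4] False by blast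
    moreover have "s Q = (\<lambda>\<rho>. inc Q g * r g \<rho>)" using s_eq[OF Q _ g] False by blast
    ultimately show ?thesis using scale by simp
  qed
  have "(\<Sum>f\<in>faces 3 g. inc f g * s f \<rho>) = r g \<rho>" if g: "g \<in> faces 4 \<sigma>" for g \<rho>
  proof -
    obtain B where B: "B \<in> faces 3 g" "relations g \<subseteq> relations B" using base_exists[OF g] by blast
    have B\<sigma>: "B \<in> faces 3 \<sigma>" using faces_faces[OF g B(1)] .
    have gB: "g \<in> above 1 B \<sigma>" using g aboveD(4)[OF B(1)] above_faces[OF B\<sigma> cone_face_refl, of 1] by auto
    have "(\<Sum>f\<in>faces 3 g. inc f g * s f \<rho>) = (\<Sum>f\<in>{B}. inc f g * s f \<rho>)"
    proof (rule sum.mono_neutral_right)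
      show "\<forall>f\<in>faces 3 g - {B}. inc f g * s f \<rho> = 0"
        using base_unique[OF g B] by (auto simp: s_def)
    qed (use B(1) finite_faces[OF aboveD(1)[OF g]] in auto)
    also have "\<dots> = r g \<rho>"
    proof (cases "simplicial B")
      case True
      then have "r g \<rho> = 0" using rel[OF g] B(2) by (auto simp: simplicial_def)
      then show ?thesis using True by (simp add: s_def)
    next
      case False
      have "inc B g * s B \<rho> = (inc B g * inc B g) * r g \<rho>" using s_eq[OF B\<sigma> False gB] by (simp add: algebra_simps)
      then show ?thesis using inc_square[OF aboveD(1)[OF B\<sigma>] gB] by simp
    qed
    finally show ?thesis .
  qed
  then show ?thesis using s_rel by blast
qed

text \<open>A diagram chase for functions on rays mapping onto spans with kernel the relations: lift
  the cocycle, correct the lift by relations until it is closed, integrate it ray by ray, and map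
  the result back.\<close>

theorem cocycle_exact:
  fixes c :: "('k ^ 'm) set \<Rightarrow> 'k ^ 'm"
  assumes c: "\<And>f. f \<in> faces 3 \<sigma> \<Longrightarrow> c f \<in> vec.span f"
    and closed: "\<And>g. g \<in> faces 4 \<sigma> \<Longrightarrow> (\<Sum>f\<in>faces 3 g. inc f g *s c f) = 0"
  shows "\<exists>b. (\<forall>e\<in>faces 2 \<sigma>. b e \<in> vec.span e) \<and> (\<forall>f\<in>faces 3 \<sigma>. c f = (\<Sum>e\<in>faces 2 f. inc e f *s b e))"
proof -
  let ?X = "faces 1 \<sigma>"
  have "\<exists>u. f \<in> faces 3 \<sigma> \<longrightarrow> c f = (\<Sum>\<rho>\<in>?X. u \<rho> *s gen \<rho>) \<and> (\<forall>\<rho>. u \<rho> \<noteq> 0 \<longrightarrow> \<rho> \<in> faces 1 f)" for f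
    using coefficients_exist[OF aboveD(1) c] by blast
  then obtain u where u: "\<And>f. f \<in> faces 3 \<sigma> \<Longrightarrow> c f = (\<Sum>\<rho>\<in>?X. u f \<rho> *s gen \<rho>)"
    "\<And>f \<rho>. f \<in> faces 3 \<sigma> \<Longrightarrow> u f \<rho> \<noteq> 0 \<Longrightarrow> \<rho> \<in> faces 1 f" by metis
  \<comment> \<open>The coboundary of the lift \<open>u\<close>. Its image in the span is the
    coboundary of \<open>c\<close>, which is 0, so its values are relations.\<close>
  define r where "r g \<rho> = (\<Sum>f\<in>faces 3 g. inc f g * u f \<rho>)" for g \<rho>
  have rel: "r g \<in> relations g" if g: "g \<in> faces 4 \<sigma>" for g
  proof -
    have "\<rho> \<in> ?X \<and> \<rho> \<subseteq> g" if "r g \<rho> \<noteq> 0" for \<rho>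
    proof -
      have "\<exists>f\<in>faces 3 g. u f \<rho> \<noteq> 0"
      proof (rule ccontr)
        assume "\<not> (\<exists>f\<in>faces 3 g. u f \<rho> \<noteq> 0)"
        then have "r g \<rho> = 0" unfolding r_def by (intro sum.neutral) auto
        then show False using that by simp
      qed
      then obtain f where f: "f \<in> faces 3 g" "u f \<rho> \<noteq> 0" by blast
      have f3: "f \<in> faces 3 \<sigma>" using faces_faces[OF g f(1)] .
      have "\<rho> \<in> faces 1 f" using u(2)[OF f3 f(2)] .
      then show ?thesis using faces_faces[OF f3] aboveD(4)[of \<rho>] aboveD(4)[OF f(1)] by blast
    qed
    moreover have "(\<Sum>\<rho>\<in>?X. r g \<rho> *s gen \<rho>) = 0"
    proof -
      have "(\<Sum>\<rho>\<in>?X. r g \<rho> *s gen \<rho>) = (\<Sum>\<rho>\<in>?X. \<Sum>f\<in>faces 3 g. (inc f g * u f \<rho>) *s gen \<rho>)"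
        by (simp add: r_def vec.scale_sum_left)
      also have "\<dots> = (\<Sum>f\<in>faces 3 g. \<Sum>\<rho>\<in>?X. (inc f g * u f \<rho>) *s gen \<rho>)" by (rule sum.swap)
      also have "\<dots> = (\<Sum>f\<in>faces 3 g. inc f g *s c f)"
        using u(1) faces_faces[OF g] by (intro sum.cong) (simp_all add: vec.scale_sum_right)
      finally show ?thesis using closed[OF g] by simp
    qed
    ultimately show ?thesis by (simp add: relations_def)
  qed
  have rclosed: "(\<Sum>g\<in>faces 4 h. inc g h * r g \<rho>) = 0" if h: "h \<in> faces 5 \<sigma>" for h \<rho>
    using coboundary_coboundary[OF aboveD(1)[OF h], of "{0}" 3 "\<lambda>f. u f \<rho>"] aboveD(3)[OF h] by (simp add: r_def)
  obtain s where s: "\<And>f. f \<in> faces 3 \<sigma> \<Longrightarrow> s f \<in> relations f"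
    "\<And>g \<rho>. g \<in> faces 4 \<sigma> \<Longrightarrow> (\<Sum>f\<in>faces 3 g. inc f g * s f \<rho>) = r g \<rho>"
    using relation_cocycle_exact[where r = r, OF rel rclosed] by auto
  \<comment> \<open>Subtracting relations leaves the image \<open>c\<close> unchanged and makes the
    lift closed in the star of every ray.\<close>
  define z where "z \<rho> f = u f \<rho> - s f \<rho>" for \<rho> f
  have z0: "\<rho> \<subseteq> f" if "f \<in> faces 3 \<sigma>" "z \<rho> f \<noteq> 0" for \<rho> f
    using u(2)[OF that(1), of \<rho>] s(1)[OF that(1)] that(2) aboveD(4)[of \<rho> 1 "{0}" f]
    by (cases "s f \<rho> = 0") (auto simp: z_def relations_def)
  have "\<exists>p. \<forall>f\<in>above 2 \<rho> \<sigma>. z \<rho> f = (\<Sum>e\<in>above 1 \<rho> f. inc e f * p e)" if \<rho>: "\<rho> \<in> ?X" for \<rho>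
  proof (rule potential_exists[OF aboveD(1)[OF \<rho>]])
    fix k assume "k \<in> above 3 \<rho> \<sigma>"
    then have k: "k \<in> faces 4 \<sigma>" using above_faces[OF \<rho> cone_face_refl, of 3] by auto
    have "above 2 \<rho> k = {f \<in> faces 3 k. \<rho> \<subseteq> f}" using above_faces[OF \<rho> aboveD(1)[OF k], of 2] by (simp add: numeral_3_eq_3)
    moreover have "z \<rho> f = 0" if "f \<in> faces 3 k" "\<not> \<rho> \<subseteq> f" for f
      using z0[OF faces_faces[OF k that(1)]] that(2) by blast
    ultimately have "(\<Sum>f\<in>above 2 \<rho> k. inc f k * z \<rho> f) = (\<Sum>f\<in>faces 3 k. inc f k * z \<rho> f)"
      using finite_faces[OF aboveD(1)[OF k]] by (intro sum.mono_neutral_left) auto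
    also have "\<dots> = (\<Sum>f\<in>faces 3 k. inc f k * u f \<rho>) - (\<Sum>f\<in>faces 3 k. inc f k * s f \<rho>)"
      by (simp add: z_def right_diff_distrib sum_subtractf)
    also have "\<dots> = 0" using s(2)[OF k] by (simp add: r_def)
    finally show "(\<Sum>f\<in>above 2 \<rho> k. inc f k * z \<rho> f) = 0" .
  qed
  then obtain p where p: "\<And>\<rho> f. \<rho> \<in> ?X \<Longrightarrow> f \<in> above 2 \<rho> \<sigma> \<Longrightarrow> z \<rho> f = (\<Sum>e\<in>above 1 \<rho> f. inc e f * p \<rho> e)" by metis
  \<comment> \<open>Only the rays inside \<open>e\<close> enter, which places the value in the span
    of \<open>e\<close>.\<close>
  define b where "b e = (\<Sum>\<rho>\<in>{\<rho>\<in>?X. \<rho> \<subseteq> e}. p \<rho> e *s gen \<rho>)" for e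
  have "b e \<in> vec.span e" for e
    unfolding b_def using gen(1) by (intro vec.span_sum vec.span_scale vec.span_base) blast
  moreover have "c f = (\<Sum>e\<in>faces 2 f. inc e f *s b e)" if f: "f \<in> faces 3 \<sigma>" for f
  proof -
    have ff: "cone_face f \<sigma>" using aboveD(1)[OF f] .
    have "(\<Sum>e\<in>faces 2 f. inc e f *s b e) = (\<Sum>e\<in>faces 2 f. \<Sum>\<rho>\<in>{\<rho>\<in>?X. \<rho> \<subseteq> e}. (inc e f * p \<rho> e) *s gen \<rho>)"
      by (simp add: b_def vec.scale_sum_right)
    also have "\<dots> = (\<Sum>\<rho>\<in>?X. \<Sum>e\<in>{e\<in>faces 2 f. \<rho> \<subseteq> e}. (inc e f * p \<rho> e) *s gen \<rho>)"
      using finite_faces[OF ff] finite_faces[OF cone_face_refl] by (intro sum.swap_restrict) auto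
    also have "\<dots> = (\<Sum>\<rho>\<in>?X. z \<rho> f *s gen \<rho>)"
    proof (rule sum.cong[OF refl])
      fix \<rho> assume \<rho>: "\<rho> \<in> ?X"
      have eq: "{e\<in>faces 2 f. \<rho> \<subseteq> e} = above 1 \<rho> f" using above_faces[OF \<rho> ff, of 1] by (simp add: numeral_2_eq_2)
      have "z \<rho> f = (\<Sum>e\<in>above 1 \<rho> f. inc e f * p \<rho> e)"
      proof (cases "\<rho> \<subseteq> f")
        case True
        then have "f \<in> above 2 \<rho> \<sigma>" using f above_faces[OF \<rho> cone_face_refl, of 2] by (simp add: numeral_3_eq_3)
        then show ?thesis using p[OF \<rho>] by blast
      next
        case False
        then have "above 1 \<rho> f = {}" using aboveD(2,4) by blast
        then show ?thesis using z0[OF f] False by auto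
      qed
      then show "(\<Sum>e\<in>{e\<in>faces 2 f. \<rho> \<subseteq> e}. (inc e f * p \<rho> e) *s gen \<rho>) = z \<rho> f *s gen \<rho>"
        by (simp add: eq vec.scale_sum_left)
    qed
    also have "\<dots> = c f - (\<Sum>\<rho>\<in>?X. s f \<rho> *s gen \<rho>)"
      using u(1)[OF f] by (simp add: z_def vec.scale_left_diff_distrib sum_subtractf)
    also have "\<dots> = c f" using s(1)[OF f] by (simp add: relations_def)
    finally show ?thesis by simp
  qed
  ultimately show ?thesis by blast
qed

end

section \<open>From polytopes to cones\<close>

lemma lift1_None [simp]: "lift1 x $ None = 1" and lift1_Some [simp]: "lift1 x $ Some j = x $ j"
  by (simp_all add: lift1_def)

lemma lift1_comb: "u + v = 1 \<Longrightarrow> lift1 (u *s x + v *s y) = u *s lift1 x + v *s lift1 y"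
  by (simp add: Finite_Cartesian_Product.vec_eq_iff lift1_def split: option.splits)

lemma scale_lift1_eq: "t *s lift1 x = s *s lift1 y \<Longrightarrow> t = s" for x :: "'k::linordered_field ^ 'n"
  by (drule arg_cong[where f = "\<lambda>z. z $ None"]) simp

lemma lift1_eq_iff [simp]: "lift1 x = lift1 y \<longleftrightarrow> x = y"
proof
  assume "lift1 x = lift1 y"
  then have "lift1 x $ Some j = lift1 y $ Some j" for j by simp
  then show "x = y" by (simp add: Finite_Cartesian_Product.vec_eq_iff)
qed simp

lemma sp_lift1:
  fixes a :: "'k::linordered_field ^ ('n::finite) option"
  shows "a \<cdot> lift1 x = a $ None + (\<chi> j. a $ Some j) \<cdot> x"
proof -
  have "a \<cdot> lift1 x = (\<Sum>i\<in>insert None (range Some). a $ i * lift1 x $ i)"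
    unfolding scalar_product_def by (simp add: UNIV_option_conv)
  also have "\<dots> = a $ None + (\<Sum>i\<in>range Some. a $ i * lift1 x $ i)" by (subst sum.insert) auto
  also have "(\<Sum>i\<in>range Some. a $ i * lift1 x $ i) = (\<Sum>j\<in>UNIV. a $ Some j * x $ j)"
    by (subst sum.reindex) auto
  finally show ?thesis by (simp add: scalar_product_def)
qed

lemma sp_axis_None: "axis None 1 \<cdot> z = z $ None" for z :: "'k::linordered_field ^ ('n::finite) option"
  by (simp add: scalar_product_def axis_def if_distrib[of "\<lambda>u. u * _"] cong: if_cong)

lemma lift1_in_cone_over: "lift1 x \<in> cone_over P \<longleftrightarrow> x \<in> P"
proof
  assume "lift1 x \<in> cone_over P"
  moreover have "lift1 x \<noteq> 0" by (metis lift1_None zero_index zero_neq_one)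
  ultimately obtain t y where ty: "lift1 x = t *s lift1 y" "y \<in> P" by (auto simp: cone_over_def)
  then have "t = 1" using scale_lift1_eq[of 1 x t y] by simp
  then show "x \<in> P" using ty by simp
next
  assume "x \<in> P"
  then have "1 *s lift1 x \<in> cone_over P" unfolding cone_over_def by (intro insertI2 CollectI exI[of _ 1] exI[of _ x]) simp
  then show "lift1 x \<in> cone_over P" by simp
qed

lemma cone_over_scale: "z \<in> cone_over P \<Longrightarrow> 0 \<le> t \<Longrightarrow> t *s z \<in> cone_over P"
  unfolding cone_over_def by (fastforce intro: mult_nonneg_nonneg)

text \<open>A sum t p + s q of lifted points is t + s times the lift of their convex combination
  with weights t/(t + s) and s/(t + s).\<close>

lemma cone_over_add:
  fixes P :: "('k::linordered_field ^ 'n) set"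
  assumes P: "K_convex P" and "x \<in> cone_over P" "y \<in> cone_over P"
  shows "x + y \<in> cone_over P"
proof (cases "x = 0 \<or> y = 0")
  case True
  then show ?thesis using assms by auto
next
  case False
  then obtain t p s q where x: "x = t *s lift1 p" "0 \<le> t" "p \<in> P" and y: "y = s *s lift1 q" "0 \<le> s" "q \<in> P"
    using assms by (auto simp: cone_over_def)
  have "t \<noteq> 0" "s \<noteq> 0" using False x y by auto
  then have pos: "0 < t" "0 < s" using x y by auto
  define u v where "u = t / (t + s)" and "v = s / (t + s)"
  have uv: "0 \<le> u" "0 \<le> v" "u + v = 1" "(t + s) * u = t" "(t + s) * v = s"
    using pos by (auto simp: u_def v_def add_divide_distrib[symmetric])
  have "u *s p + v *s q \<in> P" using P x(3) y(3) uv unfolding K_convex_def by blast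
  then have "(t + s) *s lift1 (u *s p + v *s q) \<in> cone_over P"
    using pos by (intro cone_over_scale) (auto simp: lift1_in_cone_over)
  also have "(t + s) *s lift1 (u *s p + v *s q) = x + y"
    unfolding lift1_comb[OF uv(3)] x(1) y(1) by (simp add: vec.scale_right_distrib uv)
  finally show ?thesis .
qed

lemma K_convex_K_convex_hull: "K_convex (K_convex hull S)"
  by (rule hull_in) (auto simp: K_convex_def)

lemma cone_over_hull:
  fixes V :: "('k::linordered_field ^ 'n) set"
  assumes "finite V"
  shows "cone_over (K_convex hull V) = K_conic (lift1 ` V)"
proof
  have "K_convex {x. lift1 x \<in> K_conic (lift1 ` V)}"
    by (auto simp: K_convex_def lift1_comb intro: conic_add conic_scale)
  moreover have "V \<subseteq> {x. lift1 x \<in> K_conic (lift1 ` V)}" using assms conic_base[of "lift1 ` V"] by auto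
  ultimately have "K_convex hull V \<subseteq> {x. lift1 x \<in> K_conic (lift1 ` V)}" by (rule hull_minimal[rotated])
  then show "cone_over (K_convex hull V) \<subseteq> K_conic (lift1 ` V)"
    by (auto simp: cone_over_def conic_zero intro: conic_scale)
next
  let ?C = "cone_over (K_convex hull V)"
  have zero: "0 \<in> ?C" by (simp add: cone_over_def)
  have sum: "(\<And>i. i \<in> I \<Longrightarrow> f i \<in> ?C) \<Longrightarrow> (\<Sum>i\<in>I. f i) \<in> ?C" for f and I :: "('k ^ 'n option) set"
    by (induction I rule: infinite_finite_induct) (auto intro: zero cone_over_add[OF K_convex_K_convex_hull])
  show "K_conic (lift1 ` V) \<subseteq> ?C"
  proof
    fix z assume "z \<in> K_conic (lift1 ` V)"
    then obtain c where c: "\<forall>s\<in>lift1 ` V. 0 \<le> c s" "z = (\<Sum>s\<in>lift1 ` V. c s *s s)" by (auto simp: K_conic_def)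
    have "c s *s s \<in> ?C" if s: "s \<in> lift1 ` V" for s
      using s c(1) by (intro cone_over_scale) (auto simp: lift1_in_cone_over hull_inc)
    then show "z \<in> ?C" unfolding c(2) by (rule sum)
  qed
qed

lemma fg_cone_cone_over: "K_polytope P \<Longrightarrow> fg_cone (cone_over P)"
  unfolding K_polytope_def fg_cone_def using cone_over_hull by blast

lemma cone_over_pointed: "cone_face {0} (cone_over P)" for P :: "('k::linordered_field ^ 'n) set"
  unfolding cone_face_def by (rule exI[of _ "axis None 1"]) (auto simp: cone_over_def sp_axis_None)

text \<open>The inequality a x \<le> b is homogenised to the functional with last coordinate b and
  remaining coordinates - a. The empty face corresponds to the cone {0}, since
  \<open>cone_over\<close> always contains 0.\<close>

lemma cone_face_cone_over:
  fixes P :: "('k::linordered_field ^ 'n) set"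
  assumes "polytope_face F P"
  shows "cone_face (cone_over F) (cone_over P)"
proof -
  obtain a b where a: "\<And>x. x \<in> P \<Longrightarrow> a \<cdot> x \<le> b" "F = {x \<in> P. a \<cdot> x = b}"
    using assms by (auto simp: polytope_face_def)
  define c :: "'k ^ 'n option" where "c = (\<chi> i. case i of None \<Rightarrow> b | Some j \<Rightarrow> - (a $ j))"
  have "(\<chi> j. c $ Some j) = - a" by (simp add: c_def Finite_Cartesian_Product.vec_eq_iff)
  then have c: "c \<cdot> lift1 x = b - a \<cdot> x" for x by (simp add: sp_lift1) (simp add: c_def)
  show ?thesis unfolding cone_face_def
  proof (intro exI[of _ c] conjI ballI)
    show "0 \<le> c \<cdot> z" if "z \<in> cone_over P" for z
      using that a(1) by (auto simp: cone_over_def c)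
    show "cone_over F = {z \<in> cone_over P. c \<cdot> z = 0}"
      unfolding cone_over_def a(2) by (auto simp: c) (metis vec.scale_zero_left)+
  qed
qed

lemma cone_face_cone_overE:
  fixes P :: "('k::linordered_field ^ 'n) set"
  assumes "cone_face \<tau> (cone_over P)"
  shows "\<exists>F. polytope_face F P \<and> \<tau> = cone_over F"
proof -
  obtain a where a: "\<And>z. z \<in> cone_over P \<Longrightarrow> 0 \<le> a \<cdot> z" "\<tau> = {z \<in> cone_over P. a \<cdot> z = 0}"
    using assms by (auto simp: cone_face_def)
  define b where "b = - (\<chi> j. a $ Some j)"
  have b: "a \<cdot> lift1 x = a $ None - b \<cdot> x" for x by (simp add: sp_lift1 b_def)
  define F where "F = {x \<in> P. b \<cdot> x = a $ None}"
  have "b \<cdot> x \<le> a $ None" if "x \<in> P" for x using a(1)[of "lift1 x"] that by (simp add: lift1_in_cone_over b)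
  then have "polytope_face F P" unfolding polytope_face_def F_def by blast
  moreover have "\<tau> = cone_over F"
    unfolding a(2) F_def cone_over_def by (auto simp: b) (metis vec.scale_zero_left)+
  ultimately show ?thesis by blast
qed

text \<open>The span of the cone is generated by one lifted point and the differences of points,
  placed in the hyperplane where the last coordinate is 0. The convention - 1 for the empty set fits
  the cone {0}.\<close>

lemma dim_cone_over:
  fixes P :: "('k::linordered_field ^ 'n) set"
  shows "int (vec.dim (cone_over P)) = K_aff_dim P + 1"
proof (cases "P = {}")
  case True
  then show ?thesis by (simp add: cone_over_def K_aff_dim_def)
next
  case False
  then obtain p where p: "p \<in> P" by blast
  define W where "W = {x - y | x y. x \<in> P \<and> y \<in> P}"
  define em :: "'k ^ 'n \<Rightarrow> 'k ^ 'n option" where "em d = (\<chi> i. case i of None \<Rightarrow> 0 | Some j \<Rightarrow> d $ j)" for d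
  have em: "em (x - y) = lift1 x - lift1 y" for x y
    by (simp add: em_def lift1_def Finite_Cartesian_Product.vec_eq_iff split: option.splits)
  have lin: "Vector_Spaces.linear (*s) (*s) em"
    by (rule Vector_Spaces.linear.intro; unfold_locales) (auto simp: em_def Finite_Cartesian_Product.vec_eq_iff split: option.splits)
  have inj: "inj em" by (rule injI) (auto simp: em_def Finite_Cartesian_Product.vec_eq_iff split: option.splits)
  have "lift1 p \<notin> vec.span (em ` W)"
  proof
    assume "lift1 p \<in> vec.span (em ` W)"
    then have "axis None 1 \<cdot> lift1 p = 0" by (rule sp_zero_span[rotated]) (auto simp: sp_axis_None em_def)
    then show False by (simp add: sp_axis_None)
  qed
  moreover have "vec.span (cone_over P) = vec.span (insert (lift1 p) (em ` W))"
    unfolding vec.span_eq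
  proof
    let ?S = "vec.span (insert (lift1 p) (em ` W))"
    have "lift1 x \<in> ?S" if "x \<in> P" for x
    proof -
      have "em (x - p) \<in> ?S" using that p by (intro vec.span_base) (auto simp: W_def)
      then have "em (x - p) + lift1 p \<in> ?S" using vec.span_base[of "lift1 p"] by (intro vec.span_add) auto
      then show ?thesis by (simp add: em)
    qed
    then show "cone_over P \<subseteq> ?S" by (auto simp: cone_over_def intro: vec.span_zero vec.span_scale)
    have "lift1 x \<in> vec.span (cone_over P)" if "x \<in> P" for x
      using that by (simp add: lift1_in_cone_over vec.span_base)
    then show "insert (lift1 p) (em ` W) \<subseteq> vec.span (cone_over P)"
      using p by (auto simp: W_def em intro!: vec.span_diff)
  qed
  ultimately have "vec.dim (cone_over P) = vec.dim (em ` W) + 1"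
    by (metis vec.dim_insert vec.dim_span)
  also have "vec.dim (em ` W) = vec.dim W"
    using lin inj by (intro vec.dim_image_eq) (auto intro: inj_on_subset)
  finally show ?thesis using False by (simp add: K_aff_dim_def W_def)
qed

text \<open>The displacements from a point \<open>q\<close> of \<open>Q\<close> to its affine hull
  form a linear subspace, and \<open>low\<close> maps the span of the lifted points into it.\<close>

lemma lift1_in_span:
  fixes Q :: "('k::linordered_field ^ 'n) set"
  assumes "lift1 p \<in> vec.span (lift1 ` Q)" "Q \<noteq> {}"
  shows "p \<in> K_affine hull Q"
proof -
  obtain q where q: "q \<in> Q" using assms(2) by blast
  define A where "A = K_affine hull Q"
  have "K_affine A" unfolding A_def by (rule hull_in) (auto simp: K_affine_def)
  then have aff: "u *s x + v *s y \<in> A" if "x \<in> A" "y \<in> A" "u + v = 1" for x y u v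
    using that unfolding K_affine_def by blast
  have QA: "Q \<subseteq> A" unfolding A_def by (rule hull_subset)
  have scale: "q + c *s d \<in> A" if "q + d \<in> A" for c d
  proof -
    have "c *s (q + d) + (1 - c) *s q \<in> A" using that q QA by (intro aff) auto
    also have "c *s (q + d) + (1 - c) *s q = q + c *s d"
      by (simp add: vec.scale_right_distrib vec.scale_left_diff_distrib)
    finally show ?thesis .
  qed
  have add: "q + (d + d') \<in> A" if "q + d \<in> A" "q + d' \<in> A" for d d'
  proof -
    \<comment> \<open>The midpoint of the points at twice the displacements realises the sum as an
      affine combination.\<close>
    have "(1/2) *s (q + 2 *s d) + (1/2) *s (q + 2 *s d') \<in> A" using that by (intro aff scale) auto
    also have "(1/2) *s (q + 2 *s d) + (1/2) *s (q + 2 *s d') = q + (d + d')"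
      by (simp add: Finite_Cartesian_Product.vec_eq_iff field_simps)
    finally show ?thesis .
  qed
  \<comment> \<open>A linear map sending the lift of a point x to x - q.\<close>
  define low :: "'k ^ 'n option \<Rightarrow> 'k ^ 'n" where "low z = (\<chi> j. z $ Some j) - (z $ None) *s q" for z
  have low_lift: "low (lift1 x) = x - q" for x by (simp add: low_def Finite_Cartesian_Product.vec_eq_iff)
  have "q + low (lift1 p) \<in> A" using assms(1)
  proof (induction rule: vec.span_induct_alt)
    case base
    have "low 0 = 0" by (simp add: low_def Finite_Cartesian_Product.vec_eq_iff)
    then show ?case using q QA by auto
  next
    case (step c x y)
    then obtain x' where x': "x = lift1 x'" "x' \<in> Q" by blast
    have "q + low x \<in> A" using x' QA by (auto simp: low_lift)
    moreover have "low (c *s x + y) = c *s low x + low y" by (simp add: low_def Finite_Cartesian_Product.vec_eq_iff algebra_simps)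
    ultimately show ?case using add[OF scale step(2)] by simp
  qed
  then show ?thesis by (simp add: low_lift A_def)
qed

text \<open>The base is replaced by finitely many generators; affine independence of the apex
  becomes linear independence after lifting.\<close>

lemma pyramid_cone:
  fixes F :: "('k::linordered_field ^ 'n) set"
  assumes "pyramid F"
  shows "\<exists>p V. finite V \<and> p \<notin> vec.span V \<and> cone_over F = K_conic (insert p V) \<and> vec.dim (K_conic V) = 3"
proof -
  obtain Q p where Q: "polygon Q" "p \<notin> K_affine hull Q" "F = K_convex hull (insert p Q)"
    using assms by (auto simp: pyramid_def)
  obtain V where V: "finite V" "Q = K_convex hull V" and dim: "K_aff_dim Q = 2"
    using Q(1) by (auto simp: polygon_def K_polytope_def)
  have VQ: "V \<subseteq> Q" unfolding V(2) by (rule hull_subset)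
  have "V \<noteq> {}"
  proof
    assume "V = {}"
    then have "Q = {}" using V(2) hull_minimal[of "{}" "{}" K_convex] by (simp add: K_convex_def)
    then show False using dim by (simp add: K_aff_dim_def)
  qed
  moreover have "p \<notin> K_affine hull V" using Q(2) hull_mono[OF VQ] by blast
  ultimately have "lift1 p \<notin> vec.span (lift1 ` V)" using lift1_in_span by blast
  moreover have "F = K_convex hull (insert p V)"
  proof
    show "K_convex hull (insert p V) \<subseteq> F" unfolding Q(3) using VQ by (intro hull_mono) blast
    have "Q \<subseteq> K_convex hull (insert p V)" unfolding V(2) by (rule hull_mono) blast
    then show "F \<subseteq> K_convex hull (insert p V)"
      unfolding Q(3) by (intro hull_minimal K_convex_K_convex_hull) (auto intro: hull_inc)
  qed
  then have "cone_over F = K_conic (insert (lift1 p) (lift1 ` V))" using cone_over_hull[of "insert p V"] V(1) by simp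
  moreover have "vec.dim (K_conic (lift1 ` V)) = 3"
    using dim_cone_over[of Q] dim cone_over_hull[OF V(1)] V(2) by simp
  ultimately show ?thesis using V(1) by blast
qed

lemma polytope_face_unique: "cone_over F = cone_over G \<Longrightarrow> F = G"
  using lift1_in_cone_over by blast

lemma finite_polytope_faces:
  assumes "K_polytope P" shows "finite {F. polytope_face F P}"
proof -
  have "cone_over ` {F. polytope_face F P} \<subseteq> face_fan (cone_over P)"
    using cone_face_cone_over by (auto simp: face_fan_def)
  then have "finite (cone_over ` {F. polytope_face F P})"
    using finite_face_fan[OF fg_cone_cone_over[OF assms]] finite_subset by blast
  moreover have "inj_on cone_over {F. polytope_face F P}" by (rule inj_onI) (rule polytope_face_unique)
  ultimately show ?thesis by (rule finite_imageD)
qed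

lemma K_aff_dim_zeroD:
  assumes "K_aff_dim F = 0" shows "\<exists>v. F = {v}"
proof -
  have ne: "F \<noteq> {}" and d: "vec.dim {x - y | x y. x \<in> F \<and> y \<in> F} = 0"
    using assms by (auto simp: K_aff_dim_def split: if_splits)
  obtain v where v: "v \<in> F" using ne by blast
  have "x = v" if "x \<in> F" for x
  proof -
    have "x - v \<in> {x - y | x y. x \<in> F \<and> y \<in> F}" using that v by blast
    then show ?thesis using d vec.dim_eq_0 by fastforce
  qed
  then show ?thesis using v by blast
qed

section \<open>Triviality of the cohomology\<close>

text \<open>Cohomology is a set of cosets, so vanishing means that the coset of 0 is its only
  element. Each coboundary has the whole group of coboundaries as its coset.\<close>

lemma cohomology_trivial:
  fixes ori :: "('k::linordered_field ^ 'm) set \<Rightarrow> ('k ^ 'm) list"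
  assumes "cocycles \<Sigma> ori vec.span (\<lambda>\<tau> \<sigma> v. v) (Suc k) \<subseteq> coboundaries \<Sigma> ori vec.span (\<lambda>\<tau> \<sigma> v. v) (Suc k)"
  shows "cohomology \<Sigma> ori vec.span (\<lambda>\<tau> \<sigma> v. v) (Suc k) =
    {cohomology_class \<Sigma> ori vec.span (\<lambda>\<tau> \<sigma> v. v) (Suc k) (\<lambda>\<sigma>. 0)}"
proof -
  let ?d = "differential \<Sigma> ori (\<lambda>\<tau> \<sigma> v. v :: 'k ^ 'm) k" and ?C = "cochains \<Sigma> (vec.span :: ('k ^ 'm) set \<Rightarrow> _) k"
  let ?B = "coboundaries \<Sigma> ori vec.span (\<lambda>\<tau> \<sigma> v. v) (Suc k)"
  have B: "?B = ?d ` ?C" by (simp add: coboundaries_def)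
  have add: "?d (\<lambda>\<sigma>. x \<sigma> + y \<sigma>) = (\<lambda>\<sigma>. ?d x \<sigma> + ?d y \<sigma>)" for x y
    by (rule ext) (simp add: differential_def vec.scale_right_distrib sum.distrib)
  have diff: "?d (\<lambda>\<sigma>. x \<sigma> - y \<sigma>) = (\<lambda>\<sigma>. ?d x \<sigma> - ?d y \<sigma>)" for x y
    by (rule ext) (simp add: differential_def vec.scale_right_diff_distrib sum_subtractf)
  have Cadd: "(\<lambda>\<sigma>. x \<sigma> + y \<sigma>) \<in> ?C" if "x \<in> ?C" "y \<in> ?C" for x y
    using that by (auto simp: cochains_def intro: vec.span_add)
  have Cdiff: "(\<lambda>\<sigma>. x \<sigma> - y \<sigma>) \<in> ?C" if "x \<in> ?C" "y \<in> ?C" for x y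
    using that by (auto simp: cochains_def intro: vec.span_diff)
  have Badd: "(\<lambda>\<sigma>. x \<sigma> + y \<sigma>) \<in> ?B" if xy: "x \<in> ?B" "y \<in> ?B" for x y
  proof -
    obtain x' y' where "x' \<in> ?C" "y' \<in> ?C" "x = ?d x'" "y = ?d y'" using xy unfolding B by blast
    then show ?thesis unfolding B using Cadd[of x' y'] add[of x' y'] by (intro image_eqI[of _ _ "\<lambda>\<sigma>. x' \<sigma> + y' \<sigma>"]) auto
  qed
  have Bdiff: "(\<lambda>\<sigma>. x \<sigma> - y \<sigma>) \<in> ?B" if xy: "x \<in> ?B" "y \<in> ?B" for x y
  proof -
    obtain x' y' where "x' \<in> ?C" "y' \<in> ?C" "x = ?d x'" "y = ?d y'" using xy unfolding B by blast
    then show ?thesis unfolding B using Cdiff[of x' y'] diff[of x' y'] by (intro image_eqI[of _ _ "\<lambda>\<sigma>. x' \<sigma> - y' \<sigma>"]) auto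
  qed
  have class_eq: "cohomology_class \<Sigma> ori vec.span (\<lambda>\<tau> \<sigma> v. v) (Suc k) c = ?B" if c: "c \<in> ?B" for c
  proof
    show "cohomology_class \<Sigma> ori vec.span (\<lambda>\<tau> \<sigma> v. v) (Suc k) c \<subseteq> ?B"
      unfolding cohomology_class_def using Badd[OF c] by blast
    show "?B \<subseteq> cohomology_class \<Sigma> ori vec.span (\<lambda>\<tau> \<sigma> v. v) (Suc k) c"
    proof
      fix b assume "b \<in> ?B"
      then have "(\<lambda>\<sigma>. b \<sigma> - c \<sigma>) \<in> ?B" using Bdiff c by blast
      moreover have "b = (\<lambda>\<sigma>. c \<sigma> + (b \<sigma> - c \<sigma>))" by simp
      ultimately show "b \<in> cohomology_class \<Sigma> ori vec.span (\<lambda>\<tau> \<sigma> v. v) (Suc k) c"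
        unfolding cohomology_class_def by (intro CollectI exI[of _ "\<lambda>\<sigma>. b \<sigma> - c \<sigma>"] conjI)
    qed
  qed
  have "(\<lambda>\<sigma>. 0) \<in> cocycles \<Sigma> ori vec.span (\<lambda>\<tau> \<sigma> v. v :: 'k ^ 'm) (Suc k)"
    by (auto simp: cocycles_def cochains_def differential_def vec.span_zero)
  then show ?thesis unfolding cohomology_def using class_eq assms by blast
qed

lemma (in fan_cone) facets_eq_faces:
  assumes "g \<in> faces (j + 1) \<sigma>"
  shows "{\<tau>. \<tau> \<in> face_fan \<sigma> \<and> cone_facet \<tau> g} = faces j g"
proof -
  have g: "cone_face g \<sigma>" "vec.dim g = j + 1" using aboveD(1)[OF assms] facesD[OF assms] by auto
  have "\<tau> \<in> faces j g" if "cone_face \<tau> \<sigma>" "cone_facet \<tau> g" for \<tau>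
    using that g(2) by (intro facesI) (auto simp: cone_facet_def)
  moreover have "cone_face \<tau> \<sigma> \<and> cone_facet \<tau> g" if "\<tau> \<in> faces j g" for \<tau>
    using aboveD(1)[OF that] facesD[OF that] g cone_face_trans[OF fg g(1)] by (auto simp: cone_facet_def)
  ultimately show ?thesis by (auto simp: face_fan_def)
qed

lemma (in fan_cone) in_faces_iff: "\<tau> \<in> faces j \<sigma> \<longleftrightarrow> \<tau> \<in> face_fan \<sigma> \<and> vec.dim \<tau> = j"
  using facesI[of \<tau> \<sigma>] facesD[of \<tau>] aboveD(1) by (auto simp: face_fan_def)

theorem mainTheorem1:
  fixes \<iota> :: "'k::linordered_field \<Rightarrow> real"
    and \<Delta> :: "('k ^ 'n) set"
    and ori :: "('k ^ 'n option) set \<Rightarrow> ('k ^ 'n option) list"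
  assumes "ordered_field_embedding \<iota>"
    and "K_polytope \<Delta>"
    and "K_aff_dim \<Delta> = int CARD('n)"
    and "\<And>F. polytope_face F \<Delta> \<Longrightarrow> K_aff_dim F = 3 \<Longrightarrow> pyramid F"
    and "\<And>v. polytope_vertex v \<Delta> \<Longrightarrow>
      int (card {F. polytope_face F \<Delta> \<and> K_aff_dim F = 2 \<and> \<not> triangular F \<and> v \<in> F}) \<le> int CARD('n) - 3"
    and "fan_orientation (face_fan (cone_over \<Delta>)) ori"
  shows "D ori 2 \<Delta> = {D_zero ori 2 \<Delta>}"
proof -
  define \<sigma> where "\<sigma> = cone_over \<Delta>"
  have fg: "fg_cone \<sigma>" using fg_cone_cone_over[OF assms(2)] by (simp add: \<sigma>_def)
  have dim\<sigma>: "vec.dim \<sigma> = CARD('n) + 1" using dim_cone_over[of \<Delta>] assms(3) by (simp add: \<sigma>_def)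
  have fan: "fan_cone \<sigma> (incidence ori)"
    using incidence_signs_incidence[OF fg] assms(6) cone_over_pointed
    by (auto simp: fan_cone_def fan_cone_axioms_def \<sigma>_def)
  then interpret fan_cone \<sigma> "incidence ori" .
  have faceE: "\<exists>F. polytope_face F \<Delta> \<and> f = cone_over F \<and> K_aff_dim F = int j - 1" if f: "f \<in> faces j \<sigma>" for f j
  proof -
    obtain F where F: "polytope_face F \<Delta>" "f = cone_over F"
      using cone_face_cone_overE aboveD(1)[OF f] unfolding \<sigma>_def by blast
    then show ?thesis using dim_cone_over[of F] facesD[OF f] by auto
  qed
  have "pyramidal_cone \<sigma> (incidence ori)"
  proof
    fix g assume g: "g \<in> faces 4 \<sigma>"
    obtain F where F: "polytope_face F \<Delta>" "g = cone_over F" "K_aff_dim F = 3" using faceE[OF g] by auto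
    obtain p V where V: "finite V" "p \<notin> vec.span V" "g = K_conic (insert p V)" "vec.dim (K_conic V) = 3"
      using pyramid_cone[OF assms(4)[OF F(1,3)]] F(2) by blast
    show "\<exists>Q\<in>faces 3 g. relations g \<subseteq> relations Q" using base_of_pyramid[OF g V(3,1,2,4)] .
  next
    fix \<rho> assume \<rho>: "\<rho> \<in> faces 1 \<sigma>"
    obtain R where R: "polytope_face R \<Delta>" "\<rho> = cone_over R" "K_aff_dim R = 0" using faceE[OF \<rho>] by auto
    obtain v where v: "R = {v}" using K_aff_dim_zeroD[OF R(3)] by blast
    let ?S = "{f \<in> faces 3 \<sigma>. \<rho> \<subseteq> f \<and> \<not> simplicial f}"
    let ?T = "{F. polytope_face F \<Delta> \<and> K_aff_dim F = 2 \<and> \<not> triangular F \<and> v \<in> F}"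
    \<comment> \<open>Cones over triangles are simplicial, so a non-simplicial 3-dimensional face
      above \<rho> is the cone over a non-triangular face through \<open>v\<close>.\<close>
    have "?S \<subseteq> cone_over ` ?T"
    proof
      fix f assume f: "f \<in> ?S"
      then have f3: "f \<in> faces 3 \<sigma>" by blast
      obtain F where F: "polytope_face F \<Delta>" "f = cone_over F" "K_aff_dim F = 2" using faceE[OF f3] by auto
      have "lift1 v \<in> f" using f R(2) v lift1_in_cone_over by blast
      then have "v \<in> F" using F(2) lift1_in_cone_over by blast
      moreover have "\<not> triangular F"
      proof
        assume "triangular F"
        then obtain V where V: "card V = 3" "F = K_convex hull V" by (auto simp: triangular_def)
        have "finite V" using V(1) by (intro card_ge_0_finite) simp
        moreover have "card (lift1 ` V) = 3" using V(1) by (subst card_image) (auto intro: inj_onI)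
        ultimately have "simplicial f"
          using simplicial_conic[OF aboveD(1)[OF f3], of "lift1 ` V"] cone_over_hull[of V] F(2) V(2) facesD[OF f3] by simp
        then show False using f by blast
      qed
      ultimately show "f \<in> cone_over ` ?T" using F by blast
    qed
    moreover have "finite ?T" using finite_polytope_faces[OF assms(2)] by (rule finite_subset[rotated]) blast
    ultimately have "card ?S \<le> card ?T" by (rule surj_card_le[rotated])
    moreover have "polytope_vertex v \<Delta>" using R(1) v by (simp add: polytope_vertex_def)
    ultimately show "card ?S + 4 \<le> vec.dim \<sigma>" using assms(5)[of v] dim\<sigma> by linarith
  qed
  then interpret pyramidal_cone \<sigma> "incidence ori" .
  let ?id = "\<lambda>(\<tau> :: ('k ^ 'n option) set) (\<sigma> :: ('k ^ 'n option) set) (v :: 'k ^ 'n option). v"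
  have d: "differential (face_fan \<sigma>) ori ?id j c g = (\<Sum>f\<in>faces j g. incidence ori f g *s c f)"
    if "g \<in> faces (j + 1) \<sigma>" for j c g
    using that facets_eq_faces[OF that] in_faces_iff[of g "j + 1"] by (simp add: differential_def)
  have d0: "differential (face_fan \<sigma>) ori ?id j c g = 0" if "g \<notin> faces (j + 1) \<sigma>" for j c g
    using that in_faces_iff[of g "j + 1"] by (auto simp: differential_def)
  have "cocycles (face_fan \<sigma>) ori vec.span ?id (Suc 2) \<subseteq> coboundaries (face_fan \<sigma>) ori vec.span ?id (Suc 2)"
  proof
    fix c assume "c \<in> cocycles (face_fan \<sigma>) ori vec.span ?id (Suc 2)"
    then have c: "c \<in> cochains (face_fan \<sigma>) vec.span 3"
      and dc: "differential (face_fan \<sigma>) ori ?id 3 c = (\<lambda>\<sigma>. 0)"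
      by (auto simp: cocycles_def numeral_3_eq_3 numeral_2_eq_2)
    have c3: "c f \<in> vec.span f" if "f \<in> faces 3 \<sigma>" for f
      using c that in_faces_iff[of f 3] by (auto simp: cochains_def split: if_splits)
    have c0: "c f = 0" if "f \<notin> faces 3 \<sigma>" for f
      using c that in_faces_iff[of f 3] by (auto simp: cochains_def split: if_splits)
    have "(\<Sum>f\<in>faces 3 g. incidence ori f g *s c f) = 0" if "g \<in> faces 4 \<sigma>" for g
      using d[of g 3 c] that dc by simp
    then obtain b where b: "\<forall>e\<in>faces 2 \<sigma>. b e \<in> vec.span e"
      "\<forall>f\<in>faces 3 \<sigma>. c f = (\<Sum>e\<in>faces 2 f. incidence ori e f *s b e)"
      using cocycle_exact[of c] c3 by blast
    \<comment> \<open>A cochain must vanish off the cones of dimension 2, where nothing is known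
      about \<open>b\<close>.\<close>
    define b' where "b' e = (if e \<in> faces 2 \<sigma> then b e else 0)" for e
    have "b' \<in> cochains (face_fan \<sigma>) vec.span 2"
      using b(1) in_faces_iff[of _ 2] by (auto simp: cochains_def b'_def)
    moreover have "differential (face_fan \<sigma>) ori ?id 2 b' = c"
    proof
      fix f show "differential (face_fan \<sigma>) ori ?id 2 b' f = c f"
      proof (cases "f \<in> faces 3 \<sigma>")
        case True
        then have "differential (face_fan \<sigma>) ori ?id 2 b' f = (\<Sum>e\<in>faces 2 f. incidence ori e f *s b' e)"
          using d[of f 2 b'] by simp
        also have "\<dots> = (\<Sum>e\<in>faces 2 f. incidence ori e f *s b e)"
          using faces_faces[OF True] by (intro sum.cong) (auto simp: b'_def)
        finally show ?thesis using b(2) True by simp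
      next
        case False
        then show ?thesis using d0[of f 2 b'] c0[OF False] by simp
      qed
    qed
    ultimately show "c \<in> coboundaries (face_fan \<sigma>) ori vec.span ?id (Suc 2)"
      by (auto simp: coboundaries_def)
  qed
  from cohomology_trivial[OF this] show ?thesis
    by (simp add: D_def D_zero_def \<sigma>_def numeral_3_eq_3 numeral_2_eq_2)
qed

end
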